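(* Let $N=2n$ be a positive even integer, $k$ a positive integer and $u\in\mathbb{C}$. Let $\pi_\lambda$ be the irreducible representation of $\mathfrak{sp}(J_0)$ determined by the partition $\lambda=(\lambda_1,\ldots,\lambda_n)$. Then the element $$D_k(u)=\sum_{1\le\alpha_1\le\cdots\le\alpha_k\le N}\frac{1}{\alpha!}\operatorname{per}\Bigl(\widetilde F_\alpha+u\mathbf{1}_\alpha-\mathbf{1}_\alpha\operatorname{diag}\bigl(\tfrac k2-1,\tfrac k2-2,\ldots,-\tfrac k2\bigr)\Bigr)$$ of $U(\mathfrak{sp}(J_0))$ acts in $\pi_\lambda$ as the scalar $$\pi_\lambda(D_k(u))=\sum_{l=0}^{k}\ \sum_{\substack{1\le\alpha_1\le\cdots\le\alpha_l\le n\\ n+1\le\alpha_{l+1}\le\cdots\le\alpha_k\le N}}\ \prod_{j=1}^{l}\bigl(u+\lambda_{\alpha_j}-\tfrac k2+j\bigr)\ \prod_{j=l+1}^{k}\bigl(u-\lambda_{\alpha_j'}-\tfrac k2+j-1\bigr),$$ where $\alpha_j'=N+1-\alpha_j$.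
   Context: Let $N=2n$ be a positive even integer. Put $i'=N+1-i$, and $\varepsilon(i)=-1$ for $1\le i\le n$, $\varepsilon(i)=+1$ for $n+1\le i\le N$. Let $J_0$ be the $N\times N$ alternating matrix with $(i,j)$ entry $\varepsilon(j)\delta_{i,j'}$, and $\mathfrak{sp}(J_0)=\{Z\in\mathfrak{gl}_N(\mathbb{C}) : {}^tZJ_0+J_0Z=0\}$. With $E_{ij}$ the standard basis (matrix units) of $\mathfrak{gl}_N(\mathbb{C})$, put $F_{ij}=E_{ij}-\varepsilon(i)\varepsilon(j)E_{j'i'}\in\mathfrak{sp}(J_0)$, and let $F=(F_{ij})_{1\le i,j\le N}$, regarded as an $N\times N$ matrix with entries in $U(\mathfrak{sp}(J_0))$. Put $\widetilde F=F-\operatorname{diag}(0,\ldots,0,1,\ldots,1)$ with $n$ zeros and $n$ ones. $\mathbf{1}$ is the $N\times N$ unit matrix. Triangular decomposition: $\mathfrak{sp}(J_0)=\mathfrak{n}^-\oplus\mathfrak{h}\oplus\mathfrak{n}^+$, where $\mathfrak{n}^-,\mathfrak{h},\mathfrak{n}^+$ are spanned by the $F_{ij}$ with $i>j$, $i=j$, $i<j$ respectively. For a partition $\lambda=(\lambda_1\ge\cdots\ge\lambda_n\ge0)$, $\pi_\lambda$ is the finite-dimensional irreducible representation with highest weight $\lambda$: it is generated by a nonzero vector $v$ with $\mathfrak{n}^+v=0$ and $F_{ii}v=\lambda_iv$ for $1\le i\le n$. For an $N\times N$ matrix $Z=(Z_{ij})$ and $\alpha=(\alpha_1,\ldots,\alpha_k)$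 non-decreasing with values in $\{1,\ldots,N\}$, $Z_\alpha=(Z_{\alpha_i\alpha_j})_{1\le i,j\le k}$ (indices may be repeated, so e.g. $\mathbf 1_\alpha=(\delta_{\alpha_i\alpha_j})$), and $\alpha!=m_1!\cdots m_N!$ where $m_i$ is the multiplicity of $i$ in $\alpha$. For a $k\times k$ matrix $Z$ over a possibly non-commutative algebra, the column-permanent is $\operatorname{per}Z=\sum_{\sigma\in\mathfrak{S}_k}Z_{\sigma(1)1}Z_{\sigma(2)2}\cdots Z_{\sigma(k)k}$. *)

theory Defs
  imports
    "Jordan_Normal_Form.Matrix"
    "HOL-Algebra.QuotRing"
    "HOL-Library.Poly_Mapping"
    "HOL-Library.FuncSet"
    "HOL-Combinatorics.Permutations"
begin

section \<open>The universal enveloping algebra of a matrix Lie algebra\<close>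

text \<open>Lists are made the free monoid under concatenation, so that
  \<open>'a list \<Rightarrow>\<^sub>0 complex\<close> with the convolution product is the
  free associative unital algebra on \<open>'a\<close>.\<close>

instantiation list :: (type) monoid_add
begin
definition zero_list :: "'a list" where "zero_list = []"
definition plus_list :: "'a list \<Rightarrow> 'a list \<Rightarrow> 'a list" where "plus_list xs ys = xs @ ys"
instance by standard (simp_all add: zero_list_def plus_list_def)
end

definition lie_subalgebra :: "nat \<Rightarrow> complex mat set \<Rightarrow> bool" where
  "lie_subalgebra N g \<longleftrightarrow> g \<subseteq> carrier_mat N N \<and> 0\<^sub>m N N \<in> g
     \<and> (\<forall>X\<in>g. \<forall>Y\<in>g. X + Y \<in> g) \<and> (\<forall>c. \<forall>X\<in>g. c \<cdot>\<^sub>m X \<in> g)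
     \<and> (\<forall>X\<in>g. \<forall>Y\<in>g. X * Y - Y * X \<in> g)"

definition free_algebra :: "'a set \<Rightarrow> ('a list \<Rightarrow>\<^sub>0 complex) ring" where
  "free_algebra S = \<lparr>carrier = {p. \<forall>w\<in>Poly_Mapping.keys p. set w \<subseteq> S},
     mult = (*), one = 1, zero = 0, add = (+)\<rparr>"

definition env_relations :: "complex mat set \<Rightarrow> (complex mat list \<Rightarrow>\<^sub>0 complex) set" where
  "env_relations g =
     {Poly_Mapping.single [X + Y] 1 - Poly_Mapping.single [X] 1 - Poly_Mapping.single [Y] 1
       | X Y. X \<in> g \<and> Y \<in> g}
   \<union> {Poly_Mapping.single [c \<cdot>\<^sub>m X] 1 - Poly_Mapping.single [X] c | c X. X \<in> g}
   \<union> {Poly_Mapping.single [X, Y] 1 - Poly_Mapping.single [Y, X] 1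
        - Poly_Mapping.single [X * Y - Y * X] 1 | X Y. X \<in> g \<and> Y \<in> g}"

definition env_ideal :: "complex mat set \<Rightarrow> (complex mat list \<Rightarrow>\<^sub>0 complex) set" where
  "env_ideal g = Idl\<^bsub>free_algebra g\<^esub> (env_relations g)"

definition env_algebra :: "complex mat set \<Rightarrow> (complex mat list \<Rightarrow>\<^sub>0 complex) set ring" where
  "env_algebra g = free_algebra g Quot env_ideal g"

text \<open>The canonical map of the Lie algebra into its enveloping algebra, and the scalars
  \<open>c \<cdot> 1\<close> of the enveloping algebra.\<close>

definition env_incl :: "complex mat set \<Rightarrow> complex mat \<Rightarrow> (complex mat list \<Rightarrow>\<^sub>0 complex) set" where
  "env_incl g X = env_ideal g +>\<^bsub>free_algebra g\<^esub> Poly_Mapping.single [X] 1"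

definition env_scalar :: "complex mat set \<Rightarrow> complex \<Rightarrow> (complex mat list \<Rightarrow>\<^sub>0 complex) set" where
  "env_scalar g c = env_ideal g +>\<^bsub>free_algebra g\<^esub> Poly_Mapping.single [] c"

section \<open>Representations\<close>

definition lie_rep ::
  "complex mat set \<Rightarrow> (complex \<Rightarrow> 'v \<Rightarrow> 'v::ab_group_add) \<Rightarrow> (complex mat \<Rightarrow> 'v \<Rightarrow> 'v) \<Rightarrow> bool" where
  "lie_rep g scale \<rho> \<longleftrightarrow> vector_space scale
     \<and> (\<forall>X\<in>g. Vector_Spaces.linear scale scale (\<rho> X))
     \<and> (\<forall>X\<in>g. \<forall>Y\<in>g. \<forall>v. \<rho> (X + Y) v = \<rho> X v + \<rho> Y v)
     \<and> (\<forall>c. \<forall>X\<in>g. \<forall>v. \<rho> (c \<cdot>\<^sub>m X) v = scale c (\<rho> X v))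
     \<and> (\<forall>X\<in>g. \<forall>Y\<in>g. \<forall>v. \<rho> (X * Y - Y * X) v = \<rho> X (\<rho> Y v) - \<rho> Y (\<rho> X v))"

definition invariant_subspace ::
  "complex mat set \<Rightarrow> (complex \<Rightarrow> 'v \<Rightarrow> 'v::ab_group_add) \<Rightarrow> (complex mat \<Rightarrow> 'v \<Rightarrow> 'v) \<Rightarrow> 'v set \<Rightarrow> bool" where
  "invariant_subspace g scale \<rho> W \<longleftrightarrow> module.subspace scale W \<and> (\<forall>X\<in>g. \<forall>w\<in>W. \<rho> X w \<in> W)"

definition irreducible_rep ::
  "complex mat set \<Rightarrow> (complex \<Rightarrow> 'v \<Rightarrow> 'v::ab_group_add) \<Rightarrow> (complex mat \<Rightarrow> 'v \<Rightarrow> 'v) \<Rightarrow> bool" where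
  "irreducible_rep g scale \<rho> \<longleftrightarrow> lie_rep g scale \<rho> \<and> (UNIV :: 'v set) \<noteq> {0}
     \<and> (\<forall>W. invariant_subspace g scale \<rho> W \<longrightarrow> W = {0} \<or> W = UNIV)"

definition finite_dim :: "(complex \<Rightarrow> 'v \<Rightarrow> 'v::ab_group_add) \<Rightarrow> bool" where
  "finite_dim scale \<longleftrightarrow> (\<exists>B. finite B \<and> module.span scale B = UNIV)"

definition word_eval ::
  "(complex \<Rightarrow> 'v \<Rightarrow> 'v::ab_group_add) \<Rightarrow> ('a \<Rightarrow> 'v \<Rightarrow> 'v) \<Rightarrow> ('a list \<Rightarrow>\<^sub>0 complex) \<Rightarrow> 'v \<Rightarrow> 'v" where
  "word_eval scale \<rho> p v =
     (\<Sum>w\<in>Poly_Mapping.keys p. scale (Poly_Mapping.lookup p w) (foldr \<rho> w v))"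

text \<open>The extension of a representation to the enveloping algebra. An element of the latter is a
  coset; the choice of a representative is irrelevant by \<open>env_rep_coset\<close> below.\<close>

definition env_rep ::
  "(complex \<Rightarrow> 'v \<Rightarrow> 'v::ab_group_add) \<Rightarrow> (complex mat \<Rightarrow> 'v \<Rightarrow> 'v)
     \<Rightarrow> (complex mat list \<Rightarrow>\<^sub>0 complex) set \<Rightarrow> 'v \<Rightarrow> 'v" where
  "env_rep scale \<rho> x = word_eval scale \<rho> (SOME p. p \<in> x)"

section \<open>The symplectic Lie algebra\<close>

text \<open>The indices \<open>i\<close>, \<open>j\<close> of \<open>\<epsilon>\<close>, \<open>J0\<close>, \<open>E\<close>, \<open>F\<close>
  run over \<open>{1..2 * n}\<close>, whereas matrix entries (\<open>$$\<close>) are indexed from 0.\<close>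

definition prim :: "nat \<Rightarrow> nat \<Rightarrow> nat" where
  "prim n i = 2 * n + 1 - i"

definition eps :: "nat \<Rightarrow> nat \<Rightarrow> complex" where
  "eps n i = (if i \<le> n then - 1 else 1)"

definition J0 :: "nat \<Rightarrow> complex mat" where
  "J0 n = mat (2 * n) (2 * n) (\<lambda>(r, s). if Suc r = prim n (Suc s) then eps n (Suc s) else 0)"

definition sp :: "nat \<Rightarrow> complex mat set" where
  "sp n = {Z \<in> carrier_mat (2 * n) (2 * n). Z\<^sup>T * J0 n + J0 n * Z = 0\<^sub>m (2 * n) (2 * n)}"

definition E :: "nat \<Rightarrow> nat \<Rightarrow> nat \<Rightarrow> complex mat" where
  "E n i j = mat (2 * n) (2 * n) (\<lambda>(r, s). if Suc r = i \<and> Suc s = j then 1 else 0)"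

definition F :: "nat \<Rightarrow> nat \<Rightarrow> nat \<Rightarrow> complex mat" where
  "F n i j = E n i j - (eps n i * eps n j) \<cdot>\<^sub>m E n (prim n j) (prim n i)"

text \<open>\<open>highest_weight_rep n lam scale \<rho>\<close> says that \<open>\<rho>\<close> is (a model of) the representation
  \<open>\<pi>\<^sub>\<lambda>\<close>. The \<open>F n i j\<close> with \<open>i < j\<close> span the upper nilpotent subalgebra.\<close>

definition highest_weight_rep ::
  "nat \<Rightarrow> (nat \<Rightarrow> nat) \<Rightarrow> (complex \<Rightarrow> 'v \<Rightarrow> 'v::ab_group_add) \<Rightarrow> (complex mat \<Rightarrow> 'v \<Rightarrow> 'v) \<Rightarrow> bool" where
  "highest_weight_rep n lam scale \<rho> \<longleftrightarrow>
     irreducible_rep (sp n) scale \<rho> \<and> finite_dim scale \<and>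
     (\<exists>v. v \<noteq> 0
        \<and> (\<forall>W. invariant_subspace (sp n) scale \<rho> W \<and> v \<in> W \<longrightarrow> W = UNIV)
        \<and> (\<forall>i j. 1 \<le> i \<and> i < j \<and> j \<le> 2 * n \<longrightarrow> \<rho> (F n i j) v = 0)
        \<and> (\<forall>i\<in>{1..n}. \<rho> (F n i i) v = scale (of_nat (lam i)) v))"

section \<open>Column-permanents and the element \<open>D\<^sub>k(u)\<close>\<close>

definition col_per :: "('a, 'm) ring_scheme \<Rightarrow> nat \<Rightarrow> (nat \<Rightarrow> nat \<Rightarrow> 'a) \<Rightarrow> 'a" where
  "col_per R k Z = (\<Oplus>\<^bsub>R\<^esub>\<sigma>\<in>{\<sigma>. \<sigma> permutes {1..k}}.
     foldr (\<otimes>\<^bsub>R\<^esub>) (map (\<lambda>j. Z (\<sigma> j) j) [1..<Suc k]) \<one>\<^bsub>R\<^esub>)"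

definition nondec_seqs :: "nat \<Rightarrow> nat \<Rightarrow> (nat \<Rightarrow> nat) set" where
  "nondec_seqs N k = {\<alpha> \<in> {1..k} \<rightarrow>\<^sub>E {1..N}. mono_on {1..k} \<alpha>}"

definition seq_fact :: "nat \<Rightarrow> nat \<Rightarrow> (nat \<Rightarrow> nat) \<Rightarrow> nat" where
  "seq_fact N k \<alpha> = (\<Prod>i = 1..N. fact (card {j \<in> {1..k}. \<alpha> j = i}))"

definition Ftilde :: "nat \<Rightarrow> nat \<Rightarrow> nat \<Rightarrow> (complex mat list \<Rightarrow>\<^sub>0 complex) set" where
  "Ftilde n i j = env_incl (sp n) (F n i j)
     \<ominus>\<^bsub>env_algebra (sp n)\<^esub> env_scalar (sp n) (if i = j \<and> n < i then 1 else 0)"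

definition unit_sub :: "(nat \<Rightarrow> nat) \<Rightarrow> nat \<Rightarrow> nat \<Rightarrow> complex" where
  "unit_sub \<alpha> a b = (if \<alpha> a = \<alpha> b then 1 else 0)"

text \<open>Right multiplication by the diagonal matrix scales column \<open>b\<close> by \<open>k/2 - b\<close>.\<close>

definition D :: "nat \<Rightarrow> nat \<Rightarrow> complex \<Rightarrow> (complex mat list \<Rightarrow>\<^sub>0 complex) set" where
  "D n k u = (\<Oplus>\<^bsub>env_algebra (sp n)\<^esub>\<alpha>\<in>nondec_seqs (2 * n) k.
     env_scalar (sp n) (1 / of_nat (seq_fact (2 * n) k \<alpha>)) \<otimes>\<^bsub>env_algebra (sp n)\<^esub>
     col_per (env_algebra (sp n)) k
       (\<lambda>a b. Ftilde n (\<alpha> a) (\<alpha> b)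
          \<oplus>\<^bsub>env_algebra (sp n)\<^esub> env_scalar (sp n) (u * unit_sub \<alpha> a b)
          \<ominus>\<^bsub>env_algebra (sp n)\<^esub> env_scalar (sp n) (unit_sub \<alpha> a b * (of_nat k / 2 - of_nat b))))"

section \<open>Well-definedness\<close>

lemma lie_subalgebra_carrier: "lie_subalgebra N g \<Longrightarrow> X \<in> g \<Longrightarrow> X \<in> carrier_mat N N"
  unfolding lie_subalgebra_def by blast

lemma J0_carrier [simp]: "J0 n \<in> carrier_mat (2 * n) (2 * n)"
  unfolding J0_def by simp

lemma E_carrier [simp]: "E n i j \<in> carrier_mat (2 * n) (2 * n)"
  unfolding E_def by simp

lemma F_carrier [simp]: "F n i j \<in> carrier_mat (2 * n) (2 * n)"
  unfolding F_def by (intro minus_carrier_mat smult_carrier_mat E_carrier)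

lemma sp_index:
  "Z \<in> sp n \<longleftrightarrow> Z \<in> carrier_mat (2 * n) (2 * n) \<and>
     (\<forall>r<2 * n. \<forall>s<2 * n. eps n (Suc s) * Z $$ (2 * n - 1 - s, r)
        + eps n (2 * n - r) * Z $$ (2 * n - 1 - r, s) = 0)"
proof -
  have "(Z\<^sup>T * J0 n + J0 n * Z) $$ (r, s) = eps n (Suc s) * Z $$ (2 * n - 1 - s, r)
        + eps n (2 * n - r) * Z $$ (2 * n - 1 - r, s)"
    if Z: "Z \<in> carrier_mat (2 * n) (2 * n)" and r: "r < 2 * n" and s: "s < 2 * n" for r s
  proof -
    have "(Z\<^sup>T * J0 n) $$ (r, s) = (\<Sum>t<2 * n. Z $$ (t, r) * J0 n $$ (t, s))"
      using Z r s by (simp add: scalar_prod_def J0_def lessThan_atLeast0)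
    also have "\<dots> = (\<Sum>t<2 * n. if t = 2 * n - 1 - s then Z $$ (t, r) * eps n (Suc s) else 0)"
      using s by (intro sum.cong) (auto simp: J0_def prim_def)
    also have "\<dots> = eps n (Suc s) * Z $$ (2 * n - 1 - s, r)"
      using s by simp
    finally have 1: "(Z\<^sup>T * J0 n) $$ (r, s) = eps n (Suc s) * Z $$ (2 * n - 1 - s, r)" .
    have "(J0 n * Z) $$ (r, s) = (\<Sum>t<2 * n. J0 n $$ (r, t) * Z $$ (t, s))"
      using Z r s by (simp add: scalar_prod_def J0_def lessThan_atLeast0)
    also have "\<dots> = (\<Sum>t<2 * n. if t = 2 * n - 1 - r then eps n (2 * n - r) * Z $$ (t, s) else 0)"
      using r by (intro sum.cong) (auto simp: J0_def prim_def Suc_diff_Suc)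
    also have "\<dots> = eps n (2 * n - r) * Z $$ (2 * n - 1 - r, s)"
      using r by simp
    finally have 2: "(J0 n * Z) $$ (r, s) = eps n (2 * n - r) * Z $$ (2 * n - 1 - r, s)" .
    show ?thesis using 1 2 Z r s by (simp add: J0_def)
  qed
  moreover have "dim_row (Z\<^sup>T * J0 n + J0 n * Z) = 2 * n" "dim_col (Z\<^sup>T * J0 n + J0 n * Z) = 2 * n"
    if "Z \<in> carrier_mat (2 * n) (2 * n)"
    using that by (auto simp: J0_def)
  ultimately show ?thesis
    unfolding sp_def by (auto simp: mat_eq_iff)
qed

lemma F_in_sp:
  assumes "i \<in> {1..2 * n}" "j \<in> {1..2 * n}"
  shows "F n i j \<in> sp n"
  unfolding sp_index
proof (intro conjI allI impI)
  fix r s assume rs: "r < 2 * n" "s < 2 * n"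
  have E: "E n a b $$ (p, q) = (if Suc p = a \<and> Suc q = b then 1 else 0)"
    if "p < 2 * n" "q < 2 * n" for a b p q
    using that by (simp add: E_def)
  have Fi: "F n i j $$ (p, q) = E n i j $$ (p, q)
      - eps n i * eps n j * E n (prim n j) (prim n i) $$ (p, q)"
    if "p < 2 * n" "q < 2 * n" for p q
    using that by (simp add: F_def E_def)
  have p: "2 * n - 1 - s < 2 * n" "2 * n - 1 - r < 2 * n"
    using rs by auto
  have c: "Suc (2 * n - 1 - s) = i \<longleftrightarrow> Suc s = prim n i" "Suc (2 * n - 1 - r) = i \<longleftrightarrow> Suc r = prim n i"
    "Suc (2 * n - 1 - s) = prim n j \<longleftrightarrow> Suc s = j" "Suc (2 * n - 1 - r) = prim n j \<longleftrightarrow> Suc r = j"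
    using rs assms by (auto simp: prim_def)
  have e: "eps n (prim n a) = - eps n a" if "a \<in> {1..2 * n}" for a
    using that by (auto simp: eps_def prim_def)
  have e': "eps n (2 * n - r) = - eps n (Suc r)"
    using rs by (auto simp: eps_def)
  have sq: "eps n a * eps n a = 1" for a
    by (simp add: eps_def)
  let ?A = "Suc s = prim n i \<and> Suc r = j" and ?B = "Suc s = j \<and> Suc r = prim n i"
  have A: "eps n (Suc s) + eps n (Suc r) * (eps n i * eps n j) = 0" if ?A
  proof -
    have "eps n (Suc s) = - eps n i" "eps n (Suc r) = eps n j" using that e assms by metis+
    then show ?thesis using sq[of j] by (simp add: mult.left_commute)
  qed
  have B: "eps n (Suc s) * (eps n i * eps n j) + eps n (Suc r) = 0" if ?B
  proof -
    have "eps n (Suc s) = eps n j" "eps n (Suc r) = - eps n i" using that e assms by metis+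
    then show ?thesis using sq[of j] by (simp add: mult.left_commute)
  qed
  have aux: "x * ((if P1 \<and> Q1 then 1 else 0) - c * (if P2 \<and> Q2 then 1 else 0))
      + - y * ((if Q2 \<and> P2 then 1 else 0) - c * (if Q1 \<and> P1 then 1 else 0)) = 0"
    if "P1 \<and> Q1 \<Longrightarrow> x + y * c = 0" "P2 \<and> Q2 \<Longrightarrow> x * c + y = 0"
    for x y c :: complex and P1 P2 Q1 Q2
  proof -
    have "(if P1 \<and> Q1 then 1 else 0) * (x + y * c) - (if P2 \<and> Q2 then 1 else 0) * (x * c + y) = 0"
      using that by auto
    moreover have "x * (p - c * q) + - y * (q - c * p) = p * (x + y * c) - q * (x * c + y)" for p q
      by (simp add: algebra_simps)
    ultimately show ?thesis
      unfolding conj_commute[of Q2 P2] conj_commute[of Q1 P1] by presburger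
  qed
  show "eps n (Suc s) * F n i j $$ (2 * n - 1 - s, r)
        + eps n (2 * n - r) * F n i j $$ (2 * n - 1 - r, s) = 0"
    unfolding Fi[OF p(1) rs(1)] Fi[OF p(2) rs(2)] E[OF p(1) rs(1)] E[OF p(2) rs(2)] c e'
    by (rule aux) (use A B in blast)+
qed simp

lemma sp_lie_subalgebra: "lie_subalgebra (2 * n) (sp n)"
proof -
  define N where "N = 2 * n"
  note J = J0_carrier[of n, folded N_def]
  have sp: "Z \<in> sp n \<longleftrightarrow> Z \<in> carrier_mat N N \<and> Z\<^sup>T * J0 n + J0 n * Z = 0\<^sub>m N N" for Z
    by (simp add: sp_def N_def)
  have sub: "sp n \<subseteq> carrier_mat N N" using sp by blast
  have 1: "0\<^sub>m N N \<in> sp n" unfolding N_def sp_index by simp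
  have 2: "X + Y \<in> sp n" if "X \<in> sp n" "Y \<in> sp n" for X Y
  proof -
    have c: "X \<in> carrier_mat (2 * n) (2 * n)" "Y \<in> carrier_mat (2 * n) (2 * n)"
      using that sub by (auto simp: N_def)
    have xe: "eps n (Suc s) * X $$ (2 * n - 1 - s, r) + eps n (2 * n - r) * X $$ (2 * n - 1 - r, s) = 0"
      and ye: "eps n (Suc s) * Y $$ (2 * n - 1 - s, r) + eps n (2 * n - r) * Y $$ (2 * n - 1 - r, s) = 0"
      if "r < 2 * n" "s < 2 * n" for r s
      using \<open>X \<in> sp n\<close> \<open>Y \<in> sp n\<close> that unfolding sp_index by blast+
    show ?thesis unfolding sp_index
    proof (intro conjI allI impI)
      fix r s assume rs: "r < 2 * n" "s < 2 * n"
      show "eps n (Suc s) * (X + Y) $$ (2 * n - 1 - s, r)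
        + eps n (2 * n - r) * (X + Y) $$ (2 * n - 1 - r, s) = 0"
        using c rs arg_cong2[OF xe[OF rs] ye[OF rs], of "(+)"] by (simp add: algebra_simps)
    qed (use c in auto)
  qed
  have 3: "c \<cdot>\<^sub>m X \<in> sp n" if "X \<in> sp n" for c X
  proof -
    have cX: "X \<in> carrier_mat (2 * n) (2 * n)"
      using that sub by (auto simp: N_def)
    have xe: "eps n (Suc s) * X $$ (2 * n - 1 - s, r) + eps n (2 * n - r) * X $$ (2 * n - 1 - r, s) = 0"
      if "r < 2 * n" "s < 2 * n" for r s
      using \<open>X \<in> sp n\<close> that unfolding sp_index by blast
    show ?thesis unfolding sp_index
    proof (intro conjI allI impI)
      fix r s assume rs: "r < 2 * n" "s < 2 * n"
      show "eps n (Suc s) * (c \<cdot>\<^sub>m X) $$ (2 * n - 1 - s, r)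
        + eps n (2 * n - r) * (c \<cdot>\<^sub>m X) $$ (2 * n - 1 - r, s) = 0"
        using cX rs arg_cong[OF xe[OF rs], of "(*) c"] by (simp add: algebra_simps)
    qed (use cX in auto)
  qed
  have 4: "X * Y - Y * X \<in> sp n" if XY: "X \<in> sp n" "Y \<in> sp n" for X Y
  proof -
    have c: "X \<in> carrier_mat N N" "Y \<in> carrier_mat N N" using XY sub by auto
    have neg: "Z\<^sup>T * J0 n = - (J0 n * Z)" if "Z \<in> sp n" for Z
    proof -
      have Z: "Z \<in> carrier_mat N N" and "Z\<^sup>T * J0 n + J0 n * Z = 0\<^sub>m N N"
        using that sp by auto
      then have eq: "(Z\<^sup>T * J0 n + J0 n * Z) $$ ij = 0\<^sub>m N N $$ ij" for ij by simp
      have "(Z\<^sup>T * J0 n) $$ (i, j) = - ((J0 n * Z) $$ (i, j))" if "i < N" "j < N" for i j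
        using that Z J eq[of "(i, j)"] by (simp add: eq_neg_iff_add_eq_0 del: index_mult_mat(1))
      then show ?thesis using Z J by (intro eq_matI) (auto simp del: index_mult_mat(1))
    qed
    have xy: "(A * B)\<^sup>T * J0 n = J0 n * (B * A)" if "A \<in> sp n" "B \<in> sp n" for A B
    proof -
      have ab: "A \<in> carrier_mat N N" "B \<in> carrier_mat N N" using that sub by auto
      have "(A * B)\<^sup>T * J0 n = B\<^sup>T * (A\<^sup>T * J0 n)"
        using ab J by (simp add: transpose_mult[of _ N N _ N] assoc_mult_mat[of _ N N _ N _ N])
      also have "\<dots> = - (B\<^sup>T * (J0 n * A))"
        using neg[OF that(1)] ab J by (simp add: uminus_mult_right_mat)
      also have "B\<^sup>T * (J0 n * A) = (B\<^sup>T * J0 n) * A"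
        using ab J by (simp add: assoc_mult_mat[of _ N N _ N _ N])
      also have "\<dots> = - (J0 n * B * A)"
        using neg[OF that(2)] ab J by (simp add: uminus_mult_left_mat)
      finally show ?thesis
        using ab J by (simp add: assoc_mult_mat[of _ N N _ N _ N])
    qed
    have p: "X * Y \<in> carrier_mat N N" "Y * X \<in> carrier_mat N N" using c by auto
    have "(X * Y - Y * X)\<^sup>T * J0 n = (X * Y)\<^sup>T * J0 n - (Y * X)\<^sup>T * J0 n"
      using p J by (simp add: transpose_minus[of _ N N] minus_mult_distrib_mat[of _ N N _ _ N])
    also have "\<dots> = J0 n * (Y * X) - J0 n * (X * Y)" using xy XY by simp
    finally have "(X * Y - Y * X)\<^sup>T * J0 n = J0 n * (Y * X) - J0 n * (X * Y)" .
    moreover have "J0 n * (X * Y - Y * X) = J0 n * (X * Y) - J0 n * (Y * X)"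
      using p J by (simp add: mult_minus_distrib_mat[of _ N N _ N])
    moreover have "J0 n * (X * Y) \<in> carrier_mat N N" "J0 n * (Y * X) \<in> carrier_mat N N"
      using p J by auto
    moreover have "A - B + (B - A) = 0\<^sub>m N N" if "A \<in> carrier_mat N N" "B \<in> carrier_mat N N"
      for A B :: "complex mat"
      using that by (intro eq_matI) auto
    moreover have "X * Y - Y * X \<in> carrier_mat N N" using p(2) by (rule minus_carrier_mat)
    ultimately show ?thesis unfolding sp by simp
  qed
  show ?thesis
    unfolding lie_subalgebra_def N_def[symmetric] using sub 1 2 3 4 by blast
qed

lemma free_algebra_carrier:
  "p \<in> carrier (free_algebra S) \<longleftrightarrow> (\<forall>w\<in>Poly_Mapping.keys p. set w \<subseteq> S)"
  by (simp add: free_algebra_def)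

lemma free_algebra_ops [simp]:
  "(\<otimes>\<^bsub>free_algebra S\<^esub>) = (*)" "(\<oplus>\<^bsub>free_algebra S\<^esub>) = (+)"
  "\<one>\<^bsub>free_algebra S\<^esub> = 1" "\<zero>\<^bsub>free_algebra S\<^esub> = 0"
  by (simp_all add: free_algebra_def)

lemma free_algebra_closed:
  "0 \<in> carrier (free_algebra S)" "1 \<in> carrier (free_algebra S)"
  "p \<in> carrier (free_algebra S) \<Longrightarrow> q \<in> carrier (free_algebra S) \<Longrightarrow> p + q \<in> carrier (free_algebra S)"
  "p \<in> carrier (free_algebra S) \<Longrightarrow> q \<in> carrier (free_algebra S) \<Longrightarrow> p - q \<in> carrier (free_algebra S)"
  "p \<in> carrier (free_algebra S) \<Longrightarrow> q \<in> carrier (free_algebra S) \<Longrightarrow> p * q \<in> carrier (free_algebra S)"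
  "p \<in> carrier (free_algebra S) \<Longrightarrow> - p \<in> carrier (free_algebra S)"
  "set w \<subseteq> S \<Longrightarrow> Poly_Mapping.single w c \<in> carrier (free_algebra S)"
  unfolding free_algebra_carrier
  using keys_add[of p q] keys_diff[of p q] keys_mult[of p q]
  by (auto simp: zero_list_def plus_list_def keys_minus single_one[symmetric] simp del: single_one
      split: if_splits) (fastforce simp: plus_list_def)+

lemma free_algebra_ring: "ring (free_algebra S)"
proof (rule ringI)
  show "abelian_group (free_algebra S)"
  proof (rule abelian_groupI)
    fix p assume "p \<in> carrier (free_algebra S)"
    then show "\<exists>q\<in>carrier (free_algebra S). q \<oplus>\<^bsub>free_algebra S\<^esub> p = \<zero>\<^bsub>free_algebra S\<^esub>"
      by (intro bexI[of _ "- p"]) (simp_all add: free_algebra_closed)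
  qed (simp_all add: free_algebra_closed algebra_simps)
  show "monoid (free_algebra S)"
    by (rule monoidI) (simp_all add: free_algebra_closed algebra_simps)
qed (simp_all add: algebra_simps)

lemma env_relations_carrier:
  assumes "lie_subalgebra N g"
  shows "env_relations g \<subseteq> carrier (free_algebra g)"
  using assms unfolding env_relations_def lie_subalgebra_def
  by (auto intro!: free_algebra_closed)

lemma env_ideal_ideal:
  assumes "lie_subalgebra N g"
  shows "ideal (env_ideal g) (free_algebra g)"
  unfolding env_ideal_def
  by (rule ring.genideal_ideal[OF free_algebra_ring env_relations_carrier[OF assms]])

lemma env_algebra_ring:
  assumes "lie_subalgebra N g"
  shows "ring (env_algebra g)"
  unfolding env_algebra_def by (rule ideal.quotient_is_ring[OF env_ideal_ideal[OF assms]])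

lemma env_algebra_carrier:
  "carrier (env_algebra g) = {env_ideal g +>\<^bsub>free_algebra g\<^esub> p | p. p \<in> carrier (free_algebra g)}"
  by (auto simp: env_algebra_def FactRing_def A_RCOSETS_def' a_r_coset_def')

lemma word_eval_superset:
  assumes "vector_space scale" "finite K" "Poly_Mapping.keys p \<subseteq> K"
  shows "word_eval scale \<rho> p v = (\<Sum>w\<in>K. scale (Poly_Mapping.lookup p w) (foldr \<rho> w v))"
  unfolding word_eval_def
proof (rule sum.mono_neutral_left)
  interpret vector_space scale by fact
  show "\<forall>w\<in>K - Poly_Mapping.keys p. scale (Poly_Mapping.lookup p w) (foldr \<rho> w v) = 0"
    by (simp add: in_keys_iff)
qed (use assms in auto)

lemma word_eval_single:
  assumes "vector_space scale"
  shows "word_eval scale \<rho> (Poly_Mapping.single w c) v = scale c (foldr \<rho> w v)"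
proof -
  interpret vector_space scale by fact
  show ?thesis
    by (subst word_eval_superset[OF assms, of "{w}"]) auto
qed

lemma word_eval_add:
  assumes "vector_space scale"
  shows "word_eval scale \<rho> (p + q) v = word_eval scale \<rho> p v + word_eval scale \<rho> q v"
proof -
  interpret vector_space scale by fact
  let ?K = "Poly_Mapping.keys p \<union> Poly_Mapping.keys q"
  show ?thesis
    using word_eval_superset[OF assms, of ?K p] word_eval_superset[OF assms, of ?K q]
      word_eval_superset[OF assms, of ?K "p + q"] keys_add[of p q]
    by (simp add: lookup_add scale_left_distrib sum.distrib)
qed

lemma word_eval_minus:
  assumes "vector_space scale"
  shows "word_eval scale \<rho> (p - q) v = word_eval scale \<rho> p v - word_eval scale \<rho> q v"
  using word_eval_add[OF assms, of \<rho> "p - q" q v] by simp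

lemma word_eval_mult:
  assumes "lie_rep g scale \<rho>" "p \<in> carrier (free_algebra g)" "q \<in> carrier (free_algebra g)"
  shows "word_eval scale \<rho> (p * q) v = word_eval scale \<rho> p (word_eval scale \<rho> q v)"
proof -
  have vs: "vector_space scale" and lin: "\<And>X. X \<in> g \<Longrightarrow> Vector_Spaces.linear scale scale (\<rho> X)"
    using assms(1) by (auto simp: lie_rep_def)
  interpret vector_space scale by fact
  have sum_word: "word_eval scale \<rho> (\<Sum>i\<in>I. f i) v = (\<Sum>i\<in>I. word_eval scale \<rho> (f i) v)"
    if "finite I" for I :: "'b set" and f v
    using that by induction (auto simp: word_eval_add[OF vs], simp add: word_eval_def)
  have decomp: "p = (\<Sum>w\<in>Poly_Mapping.keys p. Poly_Mapping.single w (Poly_Mapping.lookup p w))"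
    for p :: "complex mat list \<Rightarrow>\<^sub>0 complex"
    by (rule poly_mapping_eqI)
       (auto simp: lookup_sum lookup_single when_def in_keys_iff)
  have hom: "foldr \<rho> w (\<Sum>i\<in>I. scale (c i) (x i)) = (\<Sum>i\<in>I. scale (c i) (foldr \<rho> w (x i)))"
    if "set w \<subseteq> g" for w and I :: "complex mat list set" and c x
    using that
  proof (induction w)
    case (Cons X w)
    then interpret X: Vector_Spaces.linear scale scale "\<rho> X" using lin by auto
    show ?case using Cons by (simp add: X.sum X.scale)
  qed simp
  have "p * q = (\<Sum>w\<in>Poly_Mapping.keys p. \<Sum>w'\<in>Poly_Mapping.keys q.
      Poly_Mapping.single (w @ w') (Poly_Mapping.lookup p w * Poly_Mapping.lookup q w'))"
    by (subst decomp[of p], subst decomp[of q])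
       (simp add: sum_product mult_single plus_list_def)
  then have "word_eval scale \<rho> (p * q) v = (\<Sum>w\<in>Poly_Mapping.keys p. \<Sum>w'\<in>Poly_Mapping.keys q.
      scale (Poly_Mapping.lookup p w * Poly_Mapping.lookup q w') (foldr \<rho> w (foldr \<rho> w' v)))"
    by (simp add: sum_word word_eval_single[OF vs])
  also have "\<dots> = (\<Sum>w\<in>Poly_Mapping.keys p. scale (Poly_Mapping.lookup p w)
      (foldr \<rho> w (word_eval scale \<rho> q v)))"
    by (rule sum.cong)
       (use assms(2) in \<open>auto simp: word_eval_def hom free_algebra_carrier scale_sum_right\<close>)
  finally show ?thesis by (simp add: word_eval_def)
qed

lemma word_eval_env_ideal:
  assumes g: "lie_subalgebra N g" and \<rho>: "lie_rep g scale \<rho>" and p: "p \<in> env_ideal g"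
  shows "word_eval scale \<rho> p v = 0"
proof -
  have vs: "vector_space scale" and lin: "\<And>X. X \<in> g \<Longrightarrow> Vector_Spaces.linear scale scale (\<rho> X)"
    using \<rho> by (auto simp: lie_rep_def)
  interpret vector_space scale by fact
  let ?R = "free_algebra g"
  interpret R: ring ?R by (rule free_algebra_ring)
  let ?K = "{p \<in> carrier ?R. \<forall>v. word_eval scale \<rho> p v = 0}"
  have w0: "word_eval scale \<rho> p 0 = 0" if "p \<in> carrier ?R" for p
    using word_eval_mult[OF \<rho> that free_algebra_closed(1), of 0] by (simp add: word_eval_def)
  have inv: "\<ominus>\<^bsub>?R\<^esub> p = - p" if "p \<in> carrier ?R" for p
    by (rule R.minus_equality) (use that in \<open>simp_all add: free_algebra_closed\<close>)
  have neg: "word_eval scale \<rho> (- p) v = - word_eval scale \<rho> p v" for p v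
    using word_eval_minus[OF vs, of \<rho> 0 p v] by (simp add: word_eval_def)
  have "ideal ?K ?R"
  proof (rule idealI)
    show "subgroup ?K (add_monoid ?R)"
    proof (rule R.add.subgroupI)
      show "?K \<noteq> {}" using free_algebra_closed(1)[of g] by (auto simp: word_eval_def intro!: exI[of _ 0])
    qed (auto simp: inv neg word_eval_add[OF vs] free_algebra_closed)
  qed (use free_algebra_ring in \<open>auto simp: word_eval_mult[OF \<rho>] w0 free_algebra_closed\<close>)
  moreover have "word_eval scale \<rho> p v = 0" if "p \<in> env_relations g" for p v
    using that \<rho> unfolding env_relations_def lie_rep_def
    by (auto simp: word_eval_minus[OF vs] word_eval_single[OF vs])
  then have "env_relations g \<subseteq> ?K"
    using env_relations_carrier[OF g] by auto
  ultimately have "env_ideal g \<subseteq> ?K"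
    unfolding env_ideal_def by (rule R.genideal_minimal)
  then show ?thesis using p by auto
qed

lemma env_rep_coset:
  assumes g: "lie_subalgebra N g" and \<rho>: "lie_rep g scale \<rho>" and p: "p \<in> carrier (free_algebra g)"
  shows "env_rep scale \<rho> (env_ideal g +>\<^bsub>free_algebra g\<^esub> p) = word_eval scale \<rho> p"
proof
  fix v
  have vs: "vector_space scale" using \<rho> by (auto simp: lie_rep_def)
  interpret I: ideal "env_ideal g" "free_algebra g" by (rule env_ideal_ideal[OF g])
  let ?x = "env_ideal g +>\<^bsub>free_algebra g\<^esub> p"
  have "p \<in> ?x" by (rule I.a_rcos_self[OF p])
  then have "(SOME q. q \<in> ?x) \<in> ?x" by (rule someI)
  then obtain h where "h \<in> env_ideal g" "(SOME q. q \<in> ?x) = h + p"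
    by (auto simp: a_r_coset_def r_coset_def)
  then show "env_rep scale \<rho> ?x v = word_eval scale \<rho> p v"
    by (simp add: env_rep_def word_eval_add[OF vs] word_eval_env_ideal[OF g \<rho>])
qed

lemma env_rep_incl:
  assumes "lie_subalgebra N g" "lie_rep g scale \<rho>" "X \<in> g"
  shows "env_rep scale \<rho> (env_incl g X) = \<rho> X"
proof -
  have vs: "vector_space scale" using assms(2) by (auto simp: lie_rep_def)
  interpret vector_space scale by fact
  show ?thesis
    using assms unfolding env_incl_def
    by (subst env_rep_coset) (auto simp: free_algebra_closed word_eval_single[OF vs] fun_eq_iff)
qed

lemma env_rep_mult:
  assumes g: "lie_subalgebra N g" and \<rho>: "lie_rep g scale \<rho>"
    and x: "x \<in> carrier (env_algebra g)" and y: "y \<in> carrier (env_algebra g)"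
  shows "env_rep scale \<rho> (x \<otimes>\<^bsub>env_algebra g\<^esub> y) v = env_rep scale \<rho> x (env_rep scale \<rho> y v)"
proof -
  interpret I: ideal "env_ideal g" "free_algebra g" by (rule env_ideal_ideal[OF g])
  obtain p q where pq: "p \<in> carrier (free_algebra g)" "q \<in> carrier (free_algebra g)"
    and "x = env_ideal g +>\<^bsub>free_algebra g\<^esub> p" "y = env_ideal g +>\<^bsub>free_algebra g\<^esub> q"
    using x y by (auto simp: env_algebra_carrier)
  moreover have "x \<otimes>\<^bsub>env_algebra g\<^esub> y = env_ideal g +>\<^bsub>free_algebra g\<^esub> (p * q)"
    using calculation I.rcoset_mult_add[OF pq] by (simp add: env_algebra_def FactRing_def)
  ultimately show ?thesis
    by (simp add: env_rep_coset[OF g \<rho>] free_algebra_closed word_eval_mult[OF \<rho>])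
qed

lemma env_closed:
  assumes g: "lie_subalgebra N g"
  shows "X \<in> g \<Longrightarrow> env_incl g X \<in> carrier (env_algebra g)"
    and "env_scalar g c \<in> carrier (env_algebra g)"
  using free_algebra_closed(7)[of "[X]" g 1] free_algebra_closed(7)[of "[]" g c]
  by (auto simp: env_algebra_carrier env_incl_def env_scalar_def)

lemma prod_list_closed:
  assumes "monoid R" "set xs \<subseteq> carrier R"
  shows "foldr (\<otimes>\<^bsub>R\<^esub>) xs \<one>\<^bsub>R\<^esub> \<in> carrier R"
  using assms(2) by (induction xs) (auto intro: monoid.m_closed[OF assms(1)] monoid.one_closed[OF assms(1)])

lemma col_per_closed:
  assumes R: "ring R" and Z: "\<And>a b. a \<in> {1..k} \<Longrightarrow> b \<in> {1..k} \<Longrightarrow> Z a b \<in> carrier R"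
  shows "col_per R k Z \<in> carrier R"
proof -
  interpret ring R by fact
  show ?thesis
    unfolding col_per_def
  proof (rule finsum_closed, intro funcsetI prod_list_closed monoid_axioms subsetI)
    fix \<sigma> x assume s: "\<sigma> \<in> {\<sigma>. \<sigma> permutes {1..k}}"
      and "x \<in> set (map (\<lambda>j. Z (\<sigma> j) j) [1..<Suc k])"
    then obtain j where "j \<in> set [1..<Suc k]" and x: "x = Z (\<sigma> j) j"
      by (auto simp del: upt_Suc)
    then have j: "j \<in> {1..k}" by auto
    moreover have "\<sigma> j \<in> {1..k}" using s j(1) permutes_in_image by fastforce
    ultimately show "x \<in> carrier R" using Z x by auto
  qed
qed

lemma D_closed: "D n k u \<in> carrier (env_algebra (sp n))"
proof -
  let ?U = "env_algebra (sp n)"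
  note g = sp_lie_subalgebra[of n]
  interpret U: ring ?U by (rule env_algebra_ring[OF g])
  note env_closed[OF g, simp]
  have "Ftilde n i j \<in> carrier ?U" if "i \<in> {1..2 * n}" "j \<in> {1..2 * n}" for i j
    unfolding Ftilde_def using F_in_sp[OF that] by simp
  then have Ft: "Ftilde n (\<alpha> a) (\<alpha> b) \<in> carrier ?U"
    if "\<alpha> \<in> nondec_seqs (2 * n) k" "a \<in> {1..k}" "b \<in> {1..k}" for \<alpha> a b
    using that by (auto simp: nondec_seqs_def PiE_iff)
  show ?thesis
    unfolding D_def
    by (intro U.finsum_closed funcsetI U.m_closed col_per_closed U.ring_axioms U.minus_closed U.add.m_closed)
       (simp_all add: Ft)
qed

end

(* In the symmetric algebra over U(sp), put x_i(s) = sum_a e_a F_ai + s e_i. Pairing with a dual set of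
   variables p_i turns D_k(u) into the vacuum expectation value of the ordered sum over l + m = k of
   xi^l / l! times eta^m / m!, where xi and eta collect the p_i x_i with i <= n and with i > n, and the shifts
   of the diagonal entries are absorbed into a shift operator T. After this, [xi, eta] = - theta Q is central
   for xi and eta, so the ordered exponential is exp(zeta) exp(- theta Q / 2) with zeta = xi + eta, up to a
   correction coming from Ftilde. Contracting one factor Q against theta gives a recursion by which all terms
   containing theta telescope, and D_k(u) becomes the expectation of
     zeta^k / k! - (2n + k - 1) / 2 * zeta^(k-1) / (k-1)!,
   which is invariant because zeta is. Hence D_k(u) commutes with sp and acts by the scalar that it takes
   on the highest weight vector; there every factor of a column-permanent is upper triangular, and only the
   permutations preserving alpha, which are alpha! in number, contribute. *)
theory Submission
  imports Defs "HOL-Combinatorics.Multiset_Permutations" "HOL-Library.Function_Algebras"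
begin

text \<open>The obstacle is that neither correction to \<open>exp zeta\<close> is invariant by
  itself: the symplectic form is alternating, whereas \<open>theta\<close> is symmetric in the
  \<open>p\<close>, and \<open>kp\<close> involves only the upper half of the indices. Invariance
  cannot be seen term by term. It appears after pairing, because each summand of \<open>Q\<close>
  carries an explicit \<open>e\<close>: the expectation of \<open>Q1\<close> times a word is
  evaluated in two ways, by shifting with \<open>T\<close> and by contracting \<open>e\<close>
  against \<open>p\<close>. This gives one linear relation, just enough to eliminate the only
  unknown expectations, those that contain \<open>eta\<close>. The constant (2n + k - 1) / 2 is half
  of the number 2n of indices plus the degree k - 1 in \<open>p\<close> of the words met. All
  operators act on power series with values in the representation space, so the argument takes place
  in the representation rather than in U(sp); linear functionals turn the vector-valued expectations
  into complex numbers. The parameter \<open>W\<close> is evaluated at u - k/2 + 1, the shift of the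
  first column.\<close>

definition idx :: "nat \<Rightarrow> nat set" where "idx n = {1..2 * n}"

lemma finite_idx [simp]: "finite (idx n)"
  by (simp add: idx_def)

lemma prim_in: "i \<in> idx n \<Longrightarrow> prim n i \<in> idx n"
  by (auto simp: prim_def idx_def)

lemma prim_prim: "i \<in> idx n \<Longrightarrow> prim n (prim n i) = i"
  by (auto simp: prim_def idx_def)

lemma prim_le_iff: "i \<in> idx n \<Longrightarrow> prim n i \<le> n \<longleftrightarrow> \<not> i \<le> n"
  by (auto simp: prim_def idx_def)

lemma sum_prim: "(\<Sum>i\<in>idx n. h (prim n i)) = (\<Sum>i\<in>idx n. h i)"
  by (rule sum.reindex_bij_witness[of _ "prim n" "prim n"]) (simp_all add: prim_in prim_prim)

lemma sum_prim_low: "(\<Sum>i\<in>{1..n}. h (prim n i)) = (\<Sum>i\<in>{n + 1..2 * n}. h i)"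
  by (rule sum.reindex_bij_witness[of _ "prim n" "prim n"]) (auto simp: prim_def)

lemma sum_split_half: "(\<Sum>i\<in>idx n. h i) = (\<Sum>i\<in>{1..n}. h i) + (\<Sum>i\<in>{n + 1..2 * n}. h (i::nat))"
proof -
  have "idx n = {1..n} \<union> {n + 1..2 * n}" by (auto simp: idx_def)
  then show ?thesis by (simp add: sum.union_disjoint)
qed

lemma sum_delta_if:
  assumes "finite A" "c \<in> A"
  shows "(\<Sum>i\<in>A. if c = i then h i else 0) = h c" "(\<Sum>i\<in>A. if i = c then h i else 0) = h c"
  using assms by (simp_all add: sum.delta sum.delta')

section \<open>Divided powers\<close>

text \<open>The scalars enter as the image of the rationals in a ring, so that a ring of additive
  endomorphisms can be an instance. Centrality of this image is a consequence, see
  \<open>sc_comm\<close>.\<close>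

locale rational_scalars =
  fixes sc :: "rat \<Rightarrow> 'r::{ring,monoid_mult}"
  assumes sc_add: "sc (q + r) = sc q + sc r" and sc_mult: "sc (q * r) = sc q * sc r"
    and sc_1: "sc 1 = 1"
begin

lemma sc_0: "sc 0 = 0"
  using sc_add[of 0 0] by simp

lemma sc_minus: "sc (- q) = - sc q"
  using sc_add[of q "- q"] by (simp add: sc_0 add_eq_0_iff2 minus_unique)

text \<open>Integers are sums of the unit and hence central, and the inverse of a central element is
  central.\<close>

lemma sc_comm: "x * sc q = sc q * x"
proof -
  have nat: "x * sc (of_nat m) = sc (of_nat m) * x" for m
    by (induction m) (simp_all add: sc_0 sc_add sc_1 distrib_left distrib_right)
  have int: "x * sc (of_int z) = sc (of_int z) * x" for z
    by (cases z rule: int_cases2) (simp_all add: nat sc_minus)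
  obtain a b where ab: "quotient_of q = (a, b)" by fastforce
  then have b: "b > 0" and q: "q = of_int a / of_int b"
    using quotient_of_denom_pos quotient_of_div by blast+
  define r :: rat where "r = 1 / of_int b"
  have 1: "sc r * sc (of_int b) = 1" "sc (of_int b) * sc q = sc (of_int a)" "sc q = sc r * sc (of_int a)"
    using b by (simp_all add: q r_def sc_mult[symmetric] sc_1)
  have "x * sc q = sc r * (sc (of_int b) * x) * sc q" by (simp add: mult.assoc[symmetric] 1)
  also have "\<dots> = sc r * (x * (sc (of_int b) * sc q))" by (simp only: int[symmetric] mult.assoc)
  also have "\<dots> = sc q * x" by (simp only: 1(2) int) (simp only: 1(3) mult.assoc)
  finally show ?thesis .
qed

lemma sc_lcomm: "x * (sc q * y) = sc q * (x * y)"
  by (metis sc_comm mult.assoc)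

lemma sc_sc: "sc q * (sc r * x) = sc (q * r) * x"
  by (simp add: sc_mult mult.assoc)

lemma sc_cancel: "q \<noteq> 0 \<Longrightarrow> sc q * x = sc q * y \<Longrightarrow> x = y"
  by (metis sc_sc sc_1 left_inverse mult_1)

text \<open>The divided power \<open>z ^ k / k!\<close>, extended by zero to negative \<open>k\<close> so that \<open>dp_step\<close> below holds for
  every integer.\<close>

definition dp :: "'r \<Rightarrow> int \<Rightarrow> 'r" where
  "dp z k = (if k < 0 then 0 else sc (1 / fact (nat k)) * z ^ nat k)"

lemma dp_neg: "k < 0 \<Longrightarrow> dp z k = 0" and dp_0: "dp z 0 = 1"
  by (simp_all add: dp_def sc_1)

lemma dp_step: "z * dp z k = sc (of_int (k + 1)) * dp z (k + 1)"
proof (cases "k < 0")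
  case True
  then show ?thesis by (cases "k = -1") (auto simp: dp_def sc_0)
next
  case False
  then obtain m where m: "k = int m" by (metis not_less zero_le_imp_eq_int)
  have "nat (k + 1) = Suc m" using m by simp
  moreover have "sc (of_int (k + 1)) * sc (1 / fact (Suc m)) = sc (1 / fact m)"
  proof -
    have "(of_int (k + 1) :: rat) = of_nat (Suc m)" by (simp add: m)
    then show ?thesis unfolding sc_mult[symmetric] by (simp del: of_nat_Suc)
  qed
  ultimately show ?thesis using m
    by (simp add: dp_def sc_lcomm mult.assoc[symmetric] sc_comm[of z] del: of_int_add)
qed

lemma dp_commute: "z * y = y * z \<Longrightarrow> y * dp z k = dp z k * y"
  by (simp add: dp_def sc_lcomm power_commuting_commutes mult.assoc)

lemma dp_step': "dp z k * z = sc (of_int (k + 1)) * dp z (k + 1)"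
  by (metis dp_step dp_commute)

lemma dp_step_pred: "z * dp z (k - 1) = sc (of_int k) * dp z k" "dp z (k - 1) * z = sc (of_int k) * dp z k"
  using dp_step[of z "k - 1"] dp_step'[of z "k - 1"] by simp_all

lemma sc_of_int_add: "sc (of_int (k + 1)) * x = sc (of_int k) * x + x"
  by (simp add: sc_add sc_1 distrib_right)

lemma dp_int_induct:
  assumes "\<And>k. k < 0 \<Longrightarrow> P k" and "P 0" and "\<And>k. 0 \<le> k \<Longrightarrow> P k \<Longrightarrow> P (k + 1)"
  shows "P (k::int)"
proof (cases "k < 0")
  case False
  then have "0 \<le> k" by simp
  then show ?thesis by (induction k rule: int_ge_induct) (use assms in auto)
qed (use assms in auto)

text \<open>Coefficient form of \<open>exp x * y = (y + c) * exp x\<close>. As in the later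
  inductions, the factor k + 1 is multiplied in and cancelled at the end.\<close>

lemma dp_Heisenberg_commute:
  assumes c: "x * y = y * x + c" and xc: "x * c = c * x"
  shows "dp x k * y = y * dp x k + c * dp x (k - 1)"
proof (induction k rule: dp_int_induct)
  case (3 k)
  have "sc (of_int (k + 1)) * (dp x (k + 1) * y) = x * (dp x k * y)"
    by (simp only: mult.assoc[symmetric] dp_step[symmetric])
  also have "\<dots> = x * y * dp x k + c * (x * dp x (k - 1))"
    by (simp add: 3 distrib_left mult.assoc[symmetric] xc)
  also have "\<dots> = y * (x * dp x k) + c * (dp x k + sc (of_int k) * dp x k)"
    by (simp add: c distrib_right distrib_left dp_step_pred mult.assoc add.assoc)
  also have "\<dots> = sc (of_int (k + 1)) * (y * dp x (k + 1) + c * dp x k)"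
    by (simp only: dp_step sc_of_int_add[of k "dp x k", symmetric] add.commute[of "dp x k"] sc_lcomm distrib_left)
  finally show ?case using \<open>0 \<le> k\<close> sc_cancel[of "of_int (k + 1)"] by simp
qed (use c in \<open>simp_all add: dp_neg dp_0\<close>)

text \<open>Coefficient form of \<open>a * exp z = exp z * a + (y + h) * exp z\<close>: the
  commutator with \<open>a\<close> replaces one factor \<open>z\<close> by \<open>y\<close>, and
  collecting all these \<open>y\<close> on the left costs on average half of the commutator of
  \<open>z\<close> and \<open>y\<close>.\<close>

lemma dp_derivation:
  assumes a: "a * z = z * a + y" and zy: "z * y = y * z + (h + h)" and zh: "z * h = h * z"
  shows "a * dp z k = dp z k * a + y * dp z (k - 1) + h * dp z (k - 2)"
proof (induction k rule: dp_int_induct)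
  case (3 k)
  have zc: "z * (h + h) = (h + h) * z" by (simp add: zh distrib_left distrib_right)
  have e: "dp z (k - 2) * z = sc (of_int (k - 1)) * dp z (k - 1)"
    using dp_step_pred(2)[of z "k - 1"] by simp
  have "sc (of_int (k + 1)) * (a * dp z (k + 1)) = (a * dp z k) * z"
    by (simp only: mult.assoc dp_step' sc_lcomm)
  also have "\<dots> = dp z k * (a * z) + y * (dp z (k - 1) * z) + h * (dp z (k - 2) * z)"
    by (simp only: 3 distrib_right mult.assoc)
  also have "\<dots> = dp z k * z * a + dp z k * y + sc (of_int k) * (y * dp z k) + sc (of_int (k - 1)) * (h * dp z (k - 1))"
    by (simp only: a distrib_left mult.assoc dp_step_pred e sc_lcomm)
  also have "dp z k * y = y * dp z k + (h + h) * dp z (k - 1)"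
    by (rule dp_Heisenberg_commute[OF zy zc])
  also have "dp z k * z * a + (y * dp z k + (h + h) * dp z (k - 1)) + sc (of_int k) * (y * dp z k)
      + sc (of_int (k - 1)) * (h * dp z (k - 1))
    = sc (of_int (k + 1)) * (dp z (k + 1) * a) + (sc (of_int k) * (y * dp z k) + y * dp z k)
      + ((sc (of_int (k - 1)) * (h * dp z (k - 1)) + h * dp z (k - 1)) + h * dp z (k - 1))"
    by (simp add: dp_step' algebra_simps)
  also have "\<dots> = sc (of_int (k + 1)) * (dp z (k + 1) * a + y * dp z k + h * dp z (k - 1))"
    using sc_of_int_add[of "k - 1" "h * dp z (k - 1)"]
    by (simp only: sc_of_int_add[symmetric] distrib_left diff_add_cancel)
  finally show ?case using \<open>0 \<le> k\<close> sc_cancel[of "of_int (k + 1)"] by simp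
qed (simp_all add: dp_neg dp_0)

text \<open>In generating form, exp (s (y - t)) = exp (s y) (1 - s t). The relation between
  \<open>t\<close> and \<open>y\<close> cancels the terms quadratic in \<open>t\<close>, so the
  correction remains linear.\<close>

lemma dp_minus_shift:
  assumes t: "t * y = y * t + t * t"
  shows "dp (y - t) k = dp y k - dp y (k - 1) * t"
proof (induction k rule: dp_int_induct)
  case (3 k)
  have "sc (of_int (k + 1)) * dp (y - t) (k + 1) = (dp y k - dp y (k - 1) * t) * (y - t)"
    by (simp only: dp_step'[symmetric] 3)
  also have "\<dots> = dp y k * y - dp y k * t - dp y (k - 1) * (t * y - t * t)"
    by (simp add: algebra_simps)
  also have "\<dots> = dp y k * y - dp y k * t - (dp y (k - 1) * y) * t"
    by (simp add: t mult.assoc)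
  also have "\<dots> = sc (of_int (k + 1)) * dp y (k + 1) - (sc (of_int k) * (dp y k * t) + dp y k * t)"
    by (simp add: dp_step' dp_step_pred mult.assoc algebra_simps)
  also have "\<dots> = sc (of_int (k + 1)) * (dp y (k + 1) - dp y k * t)"
    by (simp only: sc_of_int_add[symmetric] right_diff_distrib)
  finally show ?case using \<open>0 \<le> k\<close> sc_cancel[of "of_int (k + 1)"] by simp
qed (simp_all add: dp_neg dp_0)

lemma dp_conjugate: "T * y = z * T \<Longrightarrow> T * dp y k = dp z k * T"
proof (induction k rule: dp_int_induct)
  case (3 k)
  have "sc (of_int (k + 1)) * (T * dp y (k + 1)) = T * dp y k * y"
    by (simp only: mult.assoc dp_step' sc_lcomm)
  also have "\<dots> = sc (of_int (k + 1)) * (dp z (k + 1) * T)"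
    using 3 by (simp add: mult.assoc) (simp add: mult.assoc[symmetric] dp_step')
  finally show ?case using \<open>0 \<le> k\<close> sc_cancel[of "of_int (k + 1)"] by simp
qed (simp_all add: dp_neg dp_0)

section \<open>The product of two exponentials\<close>

definition dp_conv :: "'r \<Rightarrow> 'r \<Rightarrow> int \<Rightarrow> 'r" where
  "dp_conv x y k = (\<Sum>l\<in>{0..k}. dp x l * dp y (k - l))"

lemma dp_conv_neg: "k < 0 \<Longrightarrow> dp_conv x y k = 0" and dp_conv_0: "dp_conv x y 0 = 1"
  by (simp_all add: dp_conv_def dp_0)

lemma dp_conv_pred: "0 \<le> k \<Longrightarrow> (\<Sum>l\<in>{0..k}. dp x l * dp y (k - 1 - l)) = dp_conv x y (k - 1)"
  unfolding dp_conv_def by (rule sum.mono_neutral_right) (auto simp: dp_neg)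

lemma dp_conv_pred':
  assumes "0 \<le> k" shows "(\<Sum>l\<in>{0..k}. dp x (l - 1) * dp y (k - l)) = dp_conv x y (k - 1)"
proof -
  have "(\<Sum>l\<in>{0..k}. dp x (l - 1) * dp y (k - l)) = (\<Sum>l\<in>{1..k}. dp x (l - 1) * dp y (k - l))"
    by (rule sum.mono_neutral_right) (auto simp: dp_neg)
  also have "\<dots> = dp_conv x y (k - 1)"
    unfolding dp_conv_def
    by (rule sum.reindex_bij_witness[of _ "\<lambda>l. l + 1" "\<lambda>l. l - 1"]) (auto simp: algebra_simps)
  finally show ?thesis .
qed

text \<open>Differentiating exp (s x) exp (s y) in s multiplies the degree k part by k; the factor
  \<open>y\<close> that appears in the middle is moved to the left, which produces
  \<open>c\<close>.\<close>

lemma dp_conv_rec: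
  assumes c: "x * y = y * x + c" and xc: "x * c = c * x" and k: "0 \<le> k"
  shows "sc (of_int k) * dp_conv x y k = (x + y) * dp_conv x y (k - 1) + c * dp_conv x y (k - 2)"
proof -
  have 1: "sc (of_int k) * (dp x l * dp y (k - l)) = x * (dp x (l - 1) * dp y (k - l))
      + (y * (dp x l * dp y (k - 1 - l)) + c * (dp x (l - 1) * dp y (k - 1 - l)))" for l
  proof -
    have "sc (of_int k) * (dp x l * dp y (k - l)) = (sc (of_int l) * dp x l) * dp y (k - l)
        + dp x l * (sc (of_int (k - l)) * dp y (k - l))"
      by (simp add: sc_lcomm mult.assoc sc_add[symmetric] distrib_right[symmetric])
    also have "\<dots> = x * (dp x (l - 1) * dp y (k - l)) + (dp x l * y) * dp y (k - l - 1)"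
      by (simp only: dp_step_pred(1)[symmetric] mult.assoc)
    also have "dp x l * y = y * dp x l + c * dp x (l - 1)" by (rule dp_Heisenberg_commute[OF c xc])
    finally show ?thesis by (simp add: distrib_right mult.assoc algebra_simps)
  qed
  have 2: "(\<Sum>l\<in>{0..k}. dp x (l - 1) * dp y (k - 1 - l)) = dp_conv x y (k - 2)"
  proof -
    have "(\<Sum>l\<in>{0..k}. dp x (l - 1) * dp y (k - 1 - l)) = (\<Sum>l\<in>{0..k - 1}. dp x (l - 1) * dp y (k - 1 - l))"
      by (rule sum.mono_neutral_right) (auto simp: dp_neg)
    also have "\<dots> = dp_conv x y (k - 2)"
      using dp_conv_pred'[of "k - 1" x y] dp_conv_neg[of "k - 2" x y] k by (cases "k = 0") auto
    finally show ?thesis .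
  qed
  have "sc (of_int k) * dp_conv x y k = (\<Sum>l\<in>{0..k}. x * (dp x (l - 1) * dp y (k - l))
      + (y * (dp x l * dp y (k - 1 - l)) + c * (dp x (l - 1) * dp y (k - 1 - l))))"
    unfolding dp_conv_def sum_distrib_left 1 ..
  also have "\<dots> = x * dp_conv x y (k - 1) + (y * dp_conv x y (k - 1) + c * dp_conv x y (k - 2))"
    unfolding sum.distrib sum_distrib_left[symmetric] 2 dp_conv_pred[OF k] dp_conv_pred'[OF k] ..
  finally show ?thesis by (simp add: distrib_right add.assoc)
qed

text \<open>The coefficientwise form of \<open>exp x * exp y = exp (x + y) * exp h\<close> for \<open>[x, y] = 2 h\<close> central:
  both sides satisfy the recursion obtained by differentiating in a scaling parameter.\<close>

lemma dp_conv_Heisenberg: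
  assumes c: "x * y = y * x + (h + h)" and xh: "x * h = h * x" and yh: "y * h = h * y"
  shows "dp_conv x y k = (\<Sum>i\<in>{0..k}. dp (x + y) (k - 2 * i) * dp h i)"
proof -
  define z where "z = x + y"
  define S where "S k = (\<Sum>i\<in>{0..k}. dp z (k - 2 * i) * dp h i)" for k
  have zh: "z * h = h * z" by (simp add: z_def xh yh distrib_left distrib_right)
  have S: "sc (of_int k) * S k = z * S (k - 1) + (h + h) * S (k - 2)" if k: "0 \<le> k" for k
  proof -
    have 1: "sc (of_int k) * (dp z (k - 2 * i) * dp h i) =
        z * (dp z (k - 1 - 2 * i) * dp h i) + (h + h) * (dp z (k - 2 * i) * dp h (i - 1))" for i
    proof -
      have "of_int k = of_int (k - 2 * i) + (of_int i + of_int i :: rat)" by simp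
      then have "sc (of_int k) * (dp z (k - 2 * i) * dp h i) = (sc (of_int (k - 2 * i)) * dp z (k - 2 * i)) * dp h i
        + (dp z (k - 2 * i) * (sc (of_int i) * dp h i) + dp z (k - 2 * i) * (sc (of_int i) * dp h i))"
        by (simp only: sc_lcomm mult.assoc sc_add distrib_right)
      also have "\<dots> = z * (dp z (k - 2 * i - 1) * dp h i)
          + (dp z (k - 2 * i) * h * dp h (i - 1) + dp z (k - 2 * i) * h * dp h (i - 1))"
        by (simp only: dp_step_pred(1)[symmetric] mult.assoc)
      also have "dp z (k - 2 * i) * h = h * dp z (k - 2 * i)"
        using dp_commute[OF zh] by simp
      finally show ?thesis by (simp add: distrib_right mult.assoc algebra_simps)
    qed
    have 2: "(\<Sum>i\<in>{0..k}. dp z (k - 1 - 2 * i) * dp h i) = S (k - 1)"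
      unfolding S_def by (rule sum.mono_neutral_right) (auto simp: dp_neg)
    \<comment> \<open>The two boundary terms vanish: \<open>i = 0\<close> through
      \<open>dp h (- 1)\<close>, and \<open>i = k > 0\<close> through
      \<open>dp z (- k)\<close>.\<close>
    have "(\<Sum>i\<in>{0..k}. dp z (k - 2 * i) * dp h (i - 1)) = (\<Sum>i\<in>{1..k - 1}. dp z (k - 2 * i) * dp h (i - 1))"
    proof (rule sum.mono_neutral_right)
      show "\<forall>i\<in>{0..k} - {1..k - 1}. dp z (k - 2 * i) * dp h (i - 1) = 0"
      proof
        fix i assume "i \<in> {0..k} - {1..k - 1}"
        then have "i = 0 \<or> i = k \<and> 0 < k" by auto
        then show "dp z (k - 2 * i) * dp h (i - 1) = 0" by (auto simp: dp_neg)
      qed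
    qed auto
    also have "\<dots> = S (k - 2)"
      unfolding S_def
      by (rule sum.reindex_bij_witness[of _ "\<lambda>l. l + 1" "\<lambda>l. l - 1"]) (auto simp: algebra_simps)
    finally have 3: "(\<Sum>i\<in>{0..k}. dp z (k - 2 * i) * dp h (i - 1)) = S (k - 2)" .
    have "sc (of_int k) * S k = (\<Sum>i\<in>{0..k}. z * (dp z (k - 1 - 2 * i) * dp h i)
        + (h + h) * (dp z (k - 2 * i) * dp h (i - 1)))"
      unfolding S_def sum_distrib_left 1 ..
    then show ?thesis by (simp only: sum.distrib sum_distrib_left[symmetric] 2 3)
  qed
  have xc: "x * (h + h) = (h + h) * x" by (simp add: xh distrib_left distrib_right)
  have "dp_conv x y (int m) = S (int m)" for m
  proof (induction m rule: less_induct)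
    case (less m)
    have eq: "dp_conv x y j = S j" if "j < int m" for j
      by (cases "j < 0") (use that less[of "nat j"] in \<open>auto simp: dp_conv_neg S_def\<close>)
    show ?case
    proof (cases "m = 0")
      case False
      have "sc (of_int (int m)) * dp_conv x y (int m) = sc (of_int (int m)) * S (int m)"
        unfolding dp_conv_rec[OF c xc of_nat_0_le_iff] S[OF of_nat_0_le_iff]
        by (simp add: eq z_def)
      then show ?thesis using sc_cancel False by (metis of_int_of_nat_eq of_nat_0_eq_iff)
    qed (simp add: dp_conv_0 S_def dp_0)
  qed
  from this[of "nat k"] show ?thesis
    unfolding S_def z_def by (cases "k < 0") (simp_all add: dp_conv_neg)
qed

end

section \<open>The oscillator algebra\<close>

text \<open>\<open>f i j\<close> plays the role of the generator \<open>F n i j\<close>, \<open>e\<close> and \<open>p\<close> are two commuting sequences of variables,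
  \<open>d a\<close> is the derivative with respect to \<open>p a\<close>, and \<open>T\<close> shifts the parameter \<open>W\<close>. The shift turns the varying
  diagonal entries of a column-permanent into powers of the single element \<open>X i\<close>, and the \<open>X i\<close> then satisfy
  Heisenberg relations (lemma \<open>XX\<close>) with central element \<open>QQ\<close>.\<close>

locale symplectic_oscillator = rational_scalars sc
  for sc :: "rat \<Rightarrow> 'r::{ring,monoid_mult}" +
  fixes n :: nat and f :: "nat \<Rightarrow> nat \<Rightarrow> 'r" and e p d :: "nat \<Rightarrow> 'r" and T W :: 'r
  assumes ee: "e a * e b = e b * e a" and pp: "p a * p b = p b * p a" and ep: "e a * p b = p b * e a"
    and fe: "f i j * e a = e a * f i j" and fp: "f i j * p a = p a * f i j"
    and Te: "T * e a = e a * T" and Tp: "T * p a = p a * T"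
    and We: "W * e a = e a * W" and Wp: "W * p a = p a * W"
    and Tf: "T * f i j = f i j * T" and Wf: "W * f i j = f i j * W"
    and TW: "T * W = W * T + T"
    and de: "d a * e b = e b * d a" and df: "d a * f i j = f i j * d a"
    and dT: "d a * T = T * d a" and dW: "d a * W = W * d a"
    and dp: "d a * p b = p b * d a + (if a = b then 1 else 0)"
    and ff: "\<lbrakk>i \<in> idx n; j \<in> idx n; k \<in> idx n; l \<in> idx n\<rbrakk> \<Longrightarrow>
      f i j * f k l - f k l * f i j =
        (if j = k then f i l else 0) - (if i = l then f k j else 0)
        - (if i \<le> n \<longleftrightarrow> j \<le> n then 1 else -1) *
          ((if prim n i = k then f (prim n j) l else 0) - (if prim n j = l then f k (prim n i) else 0))"
begin

definition sg :: "nat \<Rightarrow> 'r" where "sg i = (if i \<le> n then - 1 else 1)"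
definition g :: "nat \<Rightarrow> 'r" where "g i = (\<Sum>a\<in>idx n. e a * f a i)"
definition X :: "nat \<Rightarrow> 'r" where "X i = (g i + e i * W) * T"
text \<open>The alternating form applied to the sequences \<open>e\<close> and \<open>g\<close>; it
  is the defect in the commutator of \<open>g i\<close> and \<open>g (prim n i)\<close>, see
  \<open>gg\<close>.\<close>

definition Q :: "'r" where "Q = (\<Sum>a\<in>idx n. sg a * (e a * g (prim n a)))"
definition QQ :: "'r" where "QQ = Q * (T * T)"

lemma left_comm: "x * y = y * x \<Longrightarrow> x * (y * z) = y * (x * (z::'r))"
  by (metis mult.assoc)

lemmas generator_left_comm = ee[THEN left_comm] pp[THEN left_comm] ep[THEN left_comm] fe[THEN left_comm] fp[THEN left_comm]
  Te[THEN left_comm] Tp[THEN left_comm] We[THEN left_comm] Wp[THEN left_comm] Tf[THEN left_comm] Wf[THEN left_comm]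
  de[THEN left_comm] df[THEN left_comm] dT[THEN left_comm] dW[THEN left_comm]
lemmas generator_comm = ee pp ep fe fp Te Tp We Wp Tf Wf de df dT dW generator_left_comm

lemma TW': "T * (W * x) = W * (T * x) + T * x"
  by (metis TW mult.assoc distrib_right)

lemma sg_lcomm: "e a * (sg i * y) = sg i * (e a * y)" "g j * (sg i * y) = sg i * (g j * y)"
  "f k l * (sg i * y) = sg i * (f k l * y)" "p a * (sg i * y) = sg i * (p a * y)"
  "d a * (sg i * y) = sg i * (d a * y)" "T * (sg i * y) = sg i * (T * y)" "W * (sg i * y) = sg i * (W * y)"
  "sg a * (sg i * y) = sg i * (sg a * y)"
  by (simp_all add: sg_def)
lemma sg_sg: "sg i * sg i = 1" "sg i * (sg i * x) = x" by (simp_all add: sg_def)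
lemma sg_prim: "i \<in> idx n \<Longrightarrow> sg (prim n i) = - sg i" by (auto simp add: sg_def prim_le_iff)

lemma ge: "g i * e a = e a * g i" and gp: "g i * p a = p a * g i"
  and Tg: "T * g i = g i * T" and Wg: "W * g i = g i * W" and dg: "d a * g i = g i * d a"
  by (simp_all add: g_def sum_distrib_left sum_distrib_right mult.assoc generator_comm)

lemmas g_comm = ge gp Tg Wg dg ge[THEN left_comm] gp[THEN left_comm] Tg[THEN left_comm] Wg[THEN left_comm] dg[THEN left_comm]

lemma Xe: "X i * e a = e a * X i" and Xp: "X i * p a = p a * X i" and dX: "d a * X i = X i * d a"
  by (simp_all add: X_def distrib_left distrib_right mult.assoc generator_comm g_comm)

lemma TX: "T * X i = X i * T + e i * (T * T)"
  by (simp add: X_def distrib_left distrib_right mult.assoc generator_comm g_comm TW')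

lemma Qe: "Q * e a = e a * Q" and Qp: "Q * p a = p a * Q" and TQ: "T * Q = Q * T"
  and WQ: "W * Q = Q * W" and dQ: "d a * Q = Q * d a"
  by (simp_all add: Q_def sum_distrib_left sum_distrib_right mult.assoc generator_comm g_comm sg_lcomm)

text \<open>The \<open>e\<close> commute while \<open>sg\<close> changes sign under
  \<open>prim n\<close>, so the terms of \<open>a\<close> and \<open>prim n a\<close>
  cancel.\<close>

lemma sum_anti: "(\<Sum>a\<in>idx n. sg a * (e a * (e (prim n a) * x))) = 0"
proof -
  let ?S = "(\<Sum>a\<in>idx n. sg a * (e a * (e (prim n a) * x)))"
  have 1: "?S = (\<Sum>a\<in>{1..n}. sg a * (e a * (e (prim n a) * x)))
      + (\<Sum>a\<in>{1..n}. sg (prim n a) * (e (prim n a) * (e (prim n (prim n a)) * x)))"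
    by (simp only: sum_split_half sum_prim_low[of "\<lambda>a. sg a * (e a * (e (prim n a) * x))"])
  show ?thesis unfolding 1 sum.distrib[symmetric]
  proof (intro sum.neutral ballI)
    fix a assume "a \<in> {1..n}"
    then have a: "a \<in> idx n" by (auto simp: idx_def)
    show "sg a * (e a * (e (prim n a) * x)) + sg (prim n a) * (e (prim n a) * (e (prim n (prim n a)) * x)) = 0"
      unfolding sg_prim[OF a] prim_prim[OF a]
      by (simp add: generator_left_comm(1))
  qed
qed

lemma f_f_sg:
  assumes "i \<in> idx n" "j \<in> idx n" "k \<in> idx n" "l \<in> idx n"
  shows "f i j * f k l - f k l * f i j =
        (if j = k then f i l else 0) - (if i = l then f k j else 0)
        - sg i * (sg j * ((if prim n i = k then f (prim n j) l else 0) - (if prim n j = l then f k (prim n i) else 0)))"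
  unfolding ff[OF assms] by (auto simp: sg_def)

section \<open>Heisenberg relations between the shifted columns\<close>

text \<open>Of the four terms of the commutator of two \<open>f\<close>, two give
  \<open>e i * g j\<close> and \<open>e j * g i\<close>, one vanishes by \<open>sum_anti\<close>,
  and the one that requires \<open>prim n i = j\<close> sums up to \<open>Q\<close>.\<close>

lemma gg:
  assumes ij: "i \<in> idx n" "j \<in> idx n"
  shows "g i * g j - g j * g i = e i * g j - e j * g i + (if prim n i = j then sg i * Q else 0)"
proof -
  let ?I = "idx n"
  have "g i * g j = (\<Sum>a\<in>?I. \<Sum>b\<in>?I. e a * (e b * (f a i * f b j)))"
    by (simp add: g_def sum_product mult.assoc generator_comm)
  moreover have "g j * g i = (\<Sum>a\<in>?I. \<Sum>b\<in>?I. e a * (e b * (f b j * f a i)))"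
    unfolding g_def sum_product by (subst sum.swap) (simp add: mult.assoc generator_comm)
  ultimately have "g i * g j - g j * g i = (\<Sum>a\<in>?I. \<Sum>b\<in>?I. e a * (e b * (f a i * f b j - f b j * f a i)))"
    by (simp add: sum_subtractf right_diff_distrib)
  also have "\<dots> = (\<Sum>a\<in>?I. \<Sum>b\<in>?I. e a * (e b * (
      (if i = b then f a j else 0) - (if a = j then f b i else 0)
        - sg a * (sg i * ((if prim n a = b then f (prim n i) j else 0) - (if prim n i = j then f b (prim n a) else 0))))))"
    by (intro sum.cong refl arg_cong2[where f = "(*)"] f_f_sg ij) simp_all
  also have "\<dots> = (\<Sum>a\<in>?I. \<Sum>b\<in>?I. (if i = b then e a * (e b * f a j) else 0)
      - (if a = j then e a * (e b * f b i) else 0)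
      - (if prim n a = b then e a * (e b * (sg a * (sg i * f (prim n i) j))) else 0)
      + (if prim n i = j then e a * (e b * (sg a * (sg i * f b (prim n a)))) else 0))"
    by (intro sum.cong refl) (simp add: right_diff_distrib)
  also have "\<dots> = (\<Sum>a\<in>?I. \<Sum>b\<in>?I. (if i = b then e a * (e b * f a j) else 0))
      - (\<Sum>a\<in>?I. \<Sum>b\<in>?I. (if a = j then e a * (e b * f b i) else 0))
      - (\<Sum>a\<in>?I. \<Sum>b\<in>?I. if prim n a = b then e a * (e b * (sg a * (sg i * f (prim n i) j))) else 0)
      + (\<Sum>a\<in>?I. \<Sum>b\<in>?I. if prim n i = j then e a * (e b * (sg a * (sg i * f b (prim n a)))) else 0)"
    by (simp only: sum_subtractf sum.distrib)
  also have "(\<Sum>a\<in>?I. \<Sum>b\<in>?I. (if a = j then e a * (e b * f b i) else 0))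
      = (\<Sum>b\<in>?I. \<Sum>a\<in>?I. (if a = j then e a * (e b * f b i) else 0))" by (rule sum.swap)
  also have "(\<Sum>a\<in>?I. \<Sum>b\<in>?I. (if i = b then e a * (e b * f a j) else 0)) = e i * g j"
    using ij by (simp add: sum_delta_if g_def sum_distrib_left generator_comm)
  also have "(\<Sum>b\<in>?I. \<Sum>a\<in>?I. (if a = j then e a * (e b * f b i) else 0)) = e j * g i"
    using ij by (simp add: sum_delta_if g_def sum_distrib_left generator_comm)
  also have "(\<Sum>a\<in>?I. \<Sum>b\<in>?I. if prim n a = b then e a * (e b * (sg a * (sg i * f (prim n i) j))) else 0)
     = (\<Sum>a\<in>?I. sg a * (e a * (e (prim n a) * (sg i * f (prim n i) j))))"
    by (intro sum.cong refl) (simp add: sum_delta_if prim_in sg_lcomm)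
  also have "\<dots> = 0" by (rule sum_anti)
  also have "(\<Sum>a\<in>?I. \<Sum>b\<in>?I. if prim n i = j then e a * (e b * (sg a * (sg i * f b (prim n a)))) else 0)
     = (if prim n i = j then sg i * Q else 0)"
    by (simp add: Q_def g_def sum_distrib_left sg_lcomm)
  finally show ?thesis by simp
qed

text \<open>The two terms \<open>e j * Q\<close> have different sources in \<open>gg\<close>: one is
  the term with \<open>e j\<close>, the other comes from the single \<open>a\<close> whose partner
  is conjugate to \<open>j\<close>. Together they match the shift of \<open>W\<close> by two under
  \<open>T * T\<close>, which makes \<open>QQ\<close> commute with \<open>X j\<close>.\<close>

lemma Qg:
  assumes j: "j \<in> idx n"
  shows "Q * g j = g j * Q - e j * Q - e j * Q"
proof -
  let ?I = "idx n"
  have "Q * g j - g j * Q = (\<Sum>a\<in>?I. sg a * (e a * (g (prim n a) * g j - g j * g (prim n a))))"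
    by (simp add: Q_def sum_distrib_left sum_distrib_right sum_subtractf right_diff_distrib mult.assoc sg_lcomm g_comm)
  also have "\<dots> = (\<Sum>a\<in>?I. sg a * (e a * (e (prim n a) * g j - e j * g (prim n a) + (if a = j then - (sg a * Q) else 0))))"
    by (intro sum.cong refl arg_cong2[where f = "(*)"]) (use j in \<open>simp add: gg prim_in prim_prim sg_prim\<close>)
  also have "\<dots> = (\<Sum>a\<in>?I. sg a * (e a * (e (prim n a) * g j))) - e j * (\<Sum>a\<in>?I. sg a * (e a * g (prim n a)))
      - (\<Sum>a\<in>?I. if a = j then e j * Q else 0)"
    unfolding sum_distrib_left sum_subtractf[symmetric]
    by (intro sum.cong refl) (auto simp: right_diff_distrib distrib_left sg_lcomm sg_sg generator_comm)
  also have "\<dots> = - (e j * Q) - e j * Q"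
    using j by (simp add: sum_anti sum.delta Q_def[symmetric])
  finally show ?thesis by (simp add: algebra_simps)
qed

text \<open>Since \<open>T\<close> raises \<open>W\<close> by one, the commutator acquires
  \<open>e j * g i - e i * g j\<close>, which cancels the terms of \<open>gg\<close> without
  \<open>Q\<close>.\<close>

lemma XX:
  assumes ij: "i \<in> idx n" "j \<in> idx n"
  shows "X i * X j - X j * X i = (if prim n i = j then sg i * QQ else 0)"
proof -
  have X: "X i * X j = (g i * g j + e j * (g i * W) + e i * (g j * W) + e i * (e j * (W * W)) + e j * g i + e i * (e j * W)) * (T * T)"
    for i j
    by (simp add: X_def distrib_left distrib_right mult.assoc generator_comm g_comm TW')
  have "X i * X j - X j * X i = (g i * g j - g j * g i + e j * g i - e i * g j) * (T * T)"
    by (simp add: X[of i j] X[of j i] ee generator_left_comm(1) left_diff_distrib distrib_right)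
  also have "\<dots> = (if prim n i = j then sg i * QQ else 0)"
    by (simp add: gg[OF ij] QQ_def mult.assoc)
  finally show ?thesis .
qed

lemma QQe: "QQ * e a = e a * QQ" and QQp: "QQ * p a = p a * QQ" and TQQ: "T * QQ = QQ * T"
  and dQQ: "d a * QQ = QQ * d a"
  by (simp_all add: QQ_def mult.assoc generator_comm Qe Qp TQ dQ Qe[THEN left_comm] Qp[THEN left_comm] TQ[THEN left_comm] dQ[THEN left_comm])

lemma QQX:
  assumes j: "j \<in> idx n"
  shows "QQ * X j = X j * QQ"
proof -
  have "QQ * X j = Q * (g j + e j * W + e j + e j) * (T * (T * T))"
    by (simp add: QQ_def X_def distrib_left distrib_right mult.assoc generator_comm g_comm TW' TW)
  also have "Q * (g j + e j * W + e j + e j) = (g j + e j * W) * Q"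
    by (simp add: distrib_left distrib_right Qg[OF j] mult.assoc Qe[THEN left_comm] WQ Qe)
  also have "\<dots> * (T * (T * T)) = X j * QQ"
    by (simp add: QQ_def X_def mult.assoc TQ[THEN left_comm])
  finally show ?thesis .
qed

text \<open>\<open>Q\<close> with \<open>X\<close> in place of \<open>g\<close>. Each summand has an
  \<open>e a\<close> that can be contracted, and \<open>Q1 * T = QQ\<close> by \<open>Q1T\<close>,
  where the contribution of \<open>W\<close> vanishes by antisymmetry.\<close>

definition Q1 :: 'r where "Q1 = (\<Sum>a\<in>idx n. sg a * (e a * X (prim n a)))"

lemma Q1T: "Q1 = Q * T" 
  using sum_anti[of "W * T"]
  by (simp add: Q1_def X_def Q_def distrib_left distrib_right mult.assoc sum.distrib sum_distrib_right)


section \<open>The generating sums and their commutators\<close>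

definition xi :: 'r where "xi = (\<Sum>i\<in>{1..n}. p i * X i)"
definition eta :: 'r where "eta = (\<Sum>i\<in>{n + 1..2 * n}. p i * X i)"
definition zeta :: 'r where "zeta = (\<Sum>i\<in>idx n. p i * X i)"
definition kp :: 'r where "kp = (\<Sum>i\<in>{n + 1..2 * n}. p i * e i)"
definition kappa :: 'r where "kappa = (\<Sum>i\<in>idx n. p i * e i)"
definition theta :: 'r where "theta = (\<Sum>i\<in>{1..n}. p i * p (prim n i))"

lemma zeta_split: "zeta = xi + eta"
  by (simp add: zeta_def xi_def eta_def sum_split_half)

lemma half_idx: "i \<in> {1..n} \<Longrightarrow> i \<in> idx n" "i \<in> {n + 1..2 * n} \<Longrightarrow> i \<in> idx n"
  by (auto simp: idx_def)

lemmas X_comm = Xe Xp dX Xe[THEN left_comm] Xp[THEN left_comm] dX[THEN left_comm]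
lemmas QQ_comm = QQe QQp dQQ TQQ QQe[THEN left_comm] QQp[THEN left_comm] dQQ[THEN left_comm] TQQ[THEN left_comm]

lemma sg_lcomm': "X i * (sg j * x) = sg j * (X i * x)" "QQ * (sg j * x) = sg j * (QQ * x)"
  by (simp_all add: sg_def)

lemma QQ_xi: "QQ * xi = xi * QQ" and QQ_eta: "QQ * eta = eta * QQ" and QQ_zeta: "QQ * zeta = zeta * QQ"
  and QQ_theta: "QQ * theta = theta * QQ"
  by (simp_all add: xi_def eta_def zeta_def theta_def sum_distrib_left sum_distrib_right mult.assoc QQ_comm
      cong: sum.cong)
     (auto intro!: sum.cong simp: QQX half_idx)

lemma theta_comm: "X i * theta = theta * X i" "e a * theta = theta * e a" "p a * theta = theta * p a"
  "T * theta = theta * T" "xi * theta = theta * xi" "eta * theta = theta * eta" "zeta * theta = theta * zeta"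
  by (simp_all add: xi_def eta_def zeta_def theta_def sum_distrib_left sum_distrib_right mult.assoc X_comm generator_comm)
     (subst sum.swap, simp add: pp generator_left_comm)+

lemma xi_eta: "xi * eta - eta * xi = - (theta * QQ)"
proof -
  let ?A = "{1..n}" and ?B = "{n + 1..2 * n}"
  have "xi * eta - eta * xi = (\<Sum>i\<in>?A. \<Sum>j\<in>?B. p i * (p j * (X i * X j - X j * X i)))"
    unfolding xi_def eta_def sum_product
    by (subst (2) sum.swap) (simp add: sum_subtractf[symmetric] right_diff_distrib mult.assoc X_comm generator_comm)
  also have "\<dots> = (\<Sum>i\<in>?A. \<Sum>j\<in>?B. if prim n i = j then - (p i * (p j * QQ)) else 0)"
    by (intro sum.cong refl) (subst XX, auto simp: half_idx sg_def)
  also have "\<dots> = (\<Sum>i\<in>?A. - (p i * (p (prim n i) * QQ)))"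
    by (intro sum.cong refl sum_delta_if(1)) (auto simp: prim_def)
  finally show ?thesis by (simp add: theta_def sum_negf sum_distrib_right mult.assoc)
qed

lemma zeta_X:
  assumes a: "a \<in> idx n"
  shows "zeta * X a = X a * zeta - sg a * (p (prim n a) * QQ)"
proof -
  have "zeta * X a - X a * zeta = (\<Sum>i\<in>idx n. p i * (X i * X a - X a * X i))"
    by (simp add: zeta_def sum_distrib_left sum_distrib_right sum_subtractf right_diff_distrib mult.assoc X_comm)
  also have "\<dots> = (\<Sum>i\<in>idx n. if i = prim n a then - (sg a * (p (prim n a) * QQ)) else 0)"
    by (intro sum.cong refl) (use a in \<open>auto simp: XX prim_prim sg_prim sg_lcomm\<close>)
  finally show ?thesis using a by (simp add: sum_delta_if prim_in algebra_simps)
qed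

lemma Tzeta: "T * zeta = zeta * T + kappa * (T * T)" and Teta: "T * eta = eta * T + kp * (T * T)"
  by (simp_all add: zeta_def eta_def kappa_def kp_def sum_distrib_left sum_distrib_right TX distrib_left
      sum.distrib mult.assoc generator_comm)

lemma kappa_comm: "T * kappa = kappa * T" "zeta * kappa = kappa * zeta"
  and kp_comm: "T * kp = kp * T" "eta * kp = kp * eta" "xi * kp = kp * xi"
  by (simp_all add: zeta_def xi_def eta_def kappa_def kp_def sum_distrib_left sum_distrib_right mult.assoc generator_comm X_comm)
     (subst sum.swap, simp add: generator_comm X_comm)+

lemma kappa_comm': "kappa * theta = theta * kappa" "QQ * kappa = kappa * QQ"
  and kp_comm': "kp * theta = theta * kp" "kp * QQ = QQ * kp"
  by (simp_all add: kappa_def kp_def theta_def sum_distrib_left sum_distrib_right mult.assoc generator_comm QQ_comm)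
     (subst sum.swap, simp add: generator_comm)+

text \<open>Every index occurs in exactly one summand of \<open>theta\<close>, as first or as second
  factor according to its half.\<close>

lemma d_theta:
  assumes a: "a \<in> idx n"
  shows "d a * theta = theta * d a + p (prim n a)"
proof -
  have dpp: "d a * (p i * p j) = p i * p j * d a + (if i = a then p j else 0) + (if j = a then p i else 0)" for i j
  proof -
    have "d a * (p i * p j) = (d a * p i) * p j" by (simp add: mult.assoc)
    also have "\<dots> = p i * (d a * p j) + (if i = a then p j else 0)"
      by (simp add: dp distrib_right mult.assoc)
    also have "\<dots> = p i * p j * d a + (if i = a then p j else 0) + (if j = a then p i else 0)"
      by (simp add: dp distrib_left mult.assoc)
    finally show ?thesis .
  qed
  have "d a * theta = theta * d a + ((\<Sum>i\<in>{1..n}. if i = a then p (prim n i) else 0)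
      + (\<Sum>i\<in>{1..n}. if prim n i = a then p i else 0))"
    by (simp add: theta_def sum_distrib_left sum_distrib_right dpp sum.distrib add.assoc)
  also have "(\<Sum>i\<in>{1..n}. if prim n i = a then p i else 0) = (\<Sum>i\<in>{1..n}. if i = prim n a then p (prim n a) else 0)"
    using a by (intro sum.cong refl) (auto simp: prim_def idx_def)
  also have "(\<Sum>i\<in>{1..n}. if i = a then p (prim n i) else 0)
      + (\<Sum>i\<in>{1..n}. if i = prim n a then p (prim n a) else 0) = p (prim n a)"
  proof (cases "a \<le> n")
    case True
    then have "a \<in> {1..n}" "prim n a \<notin> {1..n}" using a by (auto simp: idx_def prim_def)
    then show ?thesis by (simp only: sum.delta[OF finite_atLeastAtMost] if_True if_False add_0_left add_0_right)
  next
    case False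
    then have "a \<notin> {1..n}" "prim n a \<in> {1..n}" using a by (auto simp: idx_def prim_def)
    then show ?thesis by (simp only: sum.delta[OF finite_atLeastAtMost] if_True if_False add_0_left add_0_right)
  qed
  finally show ?thesis .
qed

lemma d_zeta:
  assumes a: "a \<in> idx n"
  shows "d a * zeta = zeta * d a + X a"
proof -
  have 1: "d a * (p i * X i) = p i * X i * d a + (if i = a then X i else 0)" for i
  proof -
    have "d a * (p i * X i) = (d a * p i) * X i" by (simp add: mult.assoc)
    then show ?thesis by (simp add: dp distrib_right mult.assoc dX)
  qed
  show ?thesis
    using a by (simp add: zeta_def sum_distrib_left sum_distrib_right 1 sum.distrib sum_delta_if)
qed

lemma d_theta_power:
  assumes a: "a \<in> idx n"
  shows "d a * theta ^ i = theta ^ i * d a + sc (of_nat i) * (p (prim n a) * theta ^ (i - 1))"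
proof (induction i)
  case (Suc i)
  have "d a * theta ^ Suc i = theta * (d a * theta ^ i) + p (prim n a) * theta ^ i"
    by (simp add: mult.assoc[symmetric] d_theta[OF a] distrib_right)
  also have "theta * (d a * theta ^ i) = theta ^ Suc i * d a + sc (of_nat i) * (p (prim n a) * (theta * theta ^ (i - 1)))"
    by (simp add: Suc distrib_left mult.assoc sc_lcomm theta_comm(3)[symmetric] left_comm[OF theta_comm(3)[symmetric]])
  \<comment> \<open>For \<open>i = 0\<close> the exponent is truncated, but then the scalar is
    zero.\<close>
  also have "sc (of_nat i) * (p (prim n a) * (theta * theta ^ (i - 1))) = sc (of_nat i) * (p (prim n a) * theta ^ i)"
    by (cases i) (simp_all add: sc_0)
  finally show ?case by (simp add: sc_add sc_1 distrib_right algebra_simps)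
qed (simp add: sc_0)

lemma pow_comm: "x * y = y * x \<Longrightarrow> x * y ^ m = y ^ m * (x::'r)"
  by (metis power_commuting_commutes)

section \<open>The ordered exponential in terms of \<open>zeta\<close>\<close>

text \<open>Half of the commutator of \<open>xi\<close> and \<open>eta\<close>, in the role of
  \<open>h\<close> in \<open>dp_conv_Heisenberg\<close>.\<close>

definition hh :: 'r where "hh = sc (- 1 / 2) * (theta * QQ)"

lemma sc_half: "sc (- 1 / 2) * x + sc (- 1 / 2) * x = - x"
proof -
  have "sc (- 1 / 2) * x + sc (- 1 / 2) * x = sc (- 1 / 2 + - 1 / 2) * x"
    by (simp only: sc_add distrib_right)
  then show ?thesis by (simp add: sc_minus sc_1)
qed

lemma dp_hh: "dp hh (int i) = sc ((- 1 / 2) ^ i / fact i) * (theta ^ i * QQ ^ i)"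
proof -
  have "hh ^ i = sc ((- 1 / 2) ^ i) * (theta ^ i * QQ ^ i)"
  proof (induction i)
    case (Suc i)
    have "theta * QQ * (theta ^ i * QQ ^ i) = theta ^ Suc i * QQ ^ Suc i"
      using left_comm[OF pow_comm[OF QQ_theta], of i] by (simp add: mult.assoc)
    then have "hh * (sc ((- 1 / 2) ^ i) * (theta ^ i * QQ ^ i)) = sc ((- 1 / 2) ^ Suc i) * (theta ^ Suc i * QQ ^ Suc i)"
      by (simp only: hh_def mult.assoc sc_lcomm[of theta] sc_lcomm[of QQ] sc_sc power_Suc)
    then show ?case by (simp only: power_Suc[of hh] Suc)
  qed (simp add: sc_1)
  then show ?thesis by (simp add: dp_def sc_sc)
qed

lemma hh_comm: "xi * hh = hh * xi" "eta * hh = hh * eta" "zeta * hh = hh * zeta" "kp * hh = hh * kp" "T * hh = hh * T"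
  by (simp_all add: hh_def sc_lcomm mult.assoc QQ_xi QQ_eta QQ_zeta kp_comm' TQQ theta_comm theta_comm[THEN left_comm] kp_comm'[THEN left_comm])

text \<open>The generating object of \<open>D n k u\<close>: \<open>eta - kp * T\<close> is \<open>eta\<close> with the shift caused by
  the correction \<open>diag(0, \<dots>, 0, 1, \<dots>, 1)\<close> of \<open>Ftilde\<close>.\<close>

definition PP :: "int \<Rightarrow> 'r" where "PP k = dp_conv xi (eta - kp * T) k"

text \<open>By \<open>dp_minus_shift\<close> the correction \<open>kp * T\<close> enters linearly,
  behind the exponential of \<open>eta\<close>. Then \<open>kp\<close> is moved to the front, ready
  for contraction, while \<open>T\<close> stays at the right end, where the vacuum absorbs
  it.\<close>

lemma PP_expand:
  assumes "0 \<le> k"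
  shows "PP k = (\<Sum>i\<in>{0..k}. dp hh i * dp zeta (k - 2 * i)) - (\<Sum>i\<in>{0..k}. kp * (dp hh i * (dp zeta (k - 1 - 2 * i) * T)))"
proof -
  have t: "(kp * T) * eta = eta * (kp * T) + (kp * T) * (kp * T)"
    by (simp add: mult.assoc Teta distrib_left kp_comm left_comm[OF kp_comm(1)] left_comm[OF kp_comm(2)])
  have "hh + hh = - (theta * QQ)" by (simp only: hh_def sc_half)
  then have c: "xi * eta = eta * xi + (hh + hh)"
    using xi_eta by (simp add: algebra_simps)
  have R: "dp_conv xi eta j = (\<Sum>i\<in>{0..j}. dp hh i * dp zeta (j - 2 * i))" for j
  proof -
    have "dp_conv xi eta j = (\<Sum>i\<in>{0..j}. dp zeta (j - 2 * i) * dp hh i)"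
      unfolding zeta_split by (rule dp_conv_Heisenberg[OF c hh_comm(1,2)])
    also have "\<dots> = (\<Sum>i\<in>{0..j}. dp hh i * dp zeta (j - 2 * i))"
      by (intro sum.cong refl) (metis dp_commute hh_comm(3))
    finally show ?thesis .
  qed
  have "PP k = (\<Sum>l\<in>{0..k}. dp xi l * (dp eta (k - l) - dp eta (k - l - 1) * (kp * T)))"
    by (simp only: PP_def dp_conv_def dp_minus_shift[OF t])
  also have "\<dots> = dp_conv xi eta k - (\<Sum>l\<in>{0..k}. dp xi l * dp eta (k - 1 - l)) * (kp * T)"
    by (simp add: dp_conv_def sum_distrib_right sum_subtractf right_diff_distrib mult.assoc algebra_simps)
  also have "\<dots> = dp_conv xi eta k - dp_conv xi eta (k - 1) * (kp * T)"
    using assms by (simp add: dp_conv_pred)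
  also have "dp_conv xi eta (k - 1) * (kp * T) = (\<Sum>i\<in>{0..k - 1}. kp * (dp hh i * (dp zeta (k - 1 - 2 * i) * T)))"
  proof -
    have "kp * zeta = zeta * kp" by (simp add: zeta_split kp_comm distrib_left distrib_right)
    then have "dp hh i * dp zeta j * (kp * T) = kp * (dp hh i * (dp zeta j * T))" for i j
      using dp_commute[of hh kp i] dp_commute[of zeta kp j] hh_comm(4)
      by (simp add: mult.assoc left_comm[of "dp zeta j" kp] left_comm[of "dp hh i" kp])
    then show ?thesis by (simp add: R sum_distrib_right)
  qed
  \<comment> \<open>The added term \<open>i = k\<close> contains a divided power of negative
    degree.\<close>
  also have "\<dots> = (\<Sum>i\<in>{0..k}. kp * (dp hh i * (dp zeta (k - 1 - 2 * i) * T)))"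
    by (rule sum.mono_neutral_left) (use assms in \<open>auto simp: dp_neg\<close>)
  finally show ?thesis by (simp only: R)
qed

section \<open>Two ways of treating a factor \<open>Q1\<close>\<close>

lemma sum_sg_pX: "(\<Sum>a\<in>idx n. sg a * (p (prim n a) * X (prim n a))) = xi - eta"
proof -
  have "(\<Sum>a\<in>idx n. sg a * (p (prim n a) * X (prim n a))) = (\<Sum>a\<in>idx n. - (sg (prim n a) * (p (prim n a) * X (prim n a))))"
    by (intro sum.cong refl) (simp add: sg_prim)
  also have "\<dots> = (\<Sum>a\<in>idx n. - (sg a * (p a * X a)))"
    by (rule sum_prim[of "\<lambda>a. - (sg a * (p a * X a))"])
  finally show ?thesis
    by (simp add: sum_split_half xi_def eta_def sg_def sum_negf)
qed

text \<open>The two terms of each of the n conjugate pairs form one commutator, equal to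
  \<open>- QQ\<close>.\<close>

lemma sum_sg_XX: "(\<Sum>a\<in>idx n. sg a * (X (prim n a) * X a)) = - (sc (of_nat n) * QQ)"
proof -
  have "(\<Sum>a\<in>idx n. sg a * (X (prim n a) * X a))
    = (\<Sum>a\<in>{1..n}. sg a * (X (prim n a) * X a) + sg (prim n a) * (X (prim n (prim n a)) * X (prim n a)))"
    unfolding sum_split_half sum.distrib sum_prim_low[of "\<lambda>a. sg a * (X (prim n a) * X a)"] ..
  also have "\<dots> = (\<Sum>a\<in>{1..n}. - QQ)"
  proof (intro sum.cong refl)
    fix a assume "a \<in> {1..n}"
    then have a: "a \<in> idx n" and s: "sg a = - 1" by (auto simp: idx_def sg_def)
    show "sg a * (X (prim n a) * X a) + sg (prim n a) * (X (prim n (prim n a)) * X (prim n a)) = - QQ"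
      using XX[OF a prim_in[OF a]] by (simp add: sg_prim prim_prim a s algebra_simps)
  qed
  also have "\<dots> = - (sc (of_nat n) * QQ)"
  proof -
    have "(\<Sum>a\<in>{1..m}. QQ) = sc (of_nat m) * QQ" for m
      by (induction m) (simp_all add: sc_0 sc_add sc_1 distrib_right)
    then show ?thesis by (simp add: sum_negf)
  qed
  finally show ?thesis .
qed

text \<open>The trailing \<open>T\<close> is moved to the front, where it turns \<open>Q1\<close>
  into \<open>QQ\<close>. This conjugation replaces \<open>zeta\<close> by
  \<open>zeta - kappa * T\<close>, whose divided powers are given by
  \<open>dp_minus_shift\<close>.\<close>

lemma Q1_T: "Q1 * (G * (dp zeta j * T)) = G * (QQ * dp zeta j) - kappa * (G * (QQ * (dp zeta (j - 1) * T)))"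
  if G: "Q1 * G = G * Q1" "kappa * G = G * kappa"
proof -
  have t: "(kappa * T) * zeta = zeta * (kappa * T) + (kappa * T) * (kappa * T)"
    by (simp add: mult.assoc Tzeta distrib_left kappa_comm left_comm[OF kappa_comm(1)] left_comm[OF kappa_comm(2)])
  have "T * (zeta - kappa * T) = zeta * T"
    by (simp add: right_diff_distrib Tzeta left_comm[OF kappa_comm(1)])
  then have "T * dp (zeta - kappa * T) j = dp zeta j * T" by (rule dp_conjugate)
  then have "Q1 * (G * (dp zeta j * T)) = G * (Q1 * (T * dp (zeta - kappa * T) j))"
    by (simp add: left_comm[OF G(1)])
  also have "\<dots> = G * (QQ * (dp zeta j - dp zeta (j - 1) * (kappa * T)))"
    by (simp add: Q1T QQ_def mult.assoc dp_minus_shift[OF t])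
  also have "QQ * (dp zeta j - dp zeta (j - 1) * (kappa * T)) = QQ * dp zeta j - kappa * (QQ * (dp zeta (j - 1) * T))"
    using left_comm[OF dp_commute[OF kappa_comm(2), of "j - 1", symmetric]]
    by (simp add: right_diff_distrib left_comm[OF kappa_comm'(2)])
  finally show ?thesis by (simp add: right_diff_distrib left_comm[OF G(2)])
qed


lemma GG_comm:
  shows "p a * (theta ^ i * QQ ^ j) = theta ^ i * QQ ^ j * p a"
    "e a * (theta ^ i * QQ ^ j) = theta ^ i * QQ ^ j * e a"
    "T * (theta ^ i * QQ ^ j) = theta ^ i * QQ ^ j * T"
    "QQ * (theta ^ i * QQ ^ j) = theta ^ i * QQ ^ j * QQ"
    "xi * (theta ^ i * QQ ^ j) = theta ^ i * QQ ^ j * xi"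
    "eta * (theta ^ i * QQ ^ j) = theta ^ i * QQ ^ j * eta"
    "kappa * (theta ^ i * QQ ^ j) = theta ^ i * QQ ^ j * kappa"
    "a \<in> idx n \<Longrightarrow> X a * (theta ^ i * QQ ^ j) = theta ^ i * QQ ^ j * X a"
    "sg a * (theta ^ i * QQ ^ j) = theta ^ i * QQ ^ j * sg a"
proof -
  have *: "x * (theta ^ i * QQ ^ j) = theta ^ i * QQ ^ j * x" if "x * theta = theta * x" "x * QQ = QQ * x" for x
    using pow_comm[OF that(2), of j] by (simp add: mult.assoc left_comm[OF pow_comm[OF that(1), of i]])
  show "p a * (theta ^ i * QQ ^ j) = theta ^ i * QQ ^ j * p a"
    "e a * (theta ^ i * QQ ^ j) = theta ^ i * QQ ^ j * e a"
    "T * (theta ^ i * QQ ^ j) = theta ^ i * QQ ^ j * T"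
    "QQ * (theta ^ i * QQ ^ j) = theta ^ i * QQ ^ j * QQ"
    "xi * (theta ^ i * QQ ^ j) = theta ^ i * QQ ^ j * xi"
    "eta * (theta ^ i * QQ ^ j) = theta ^ i * QQ ^ j * eta"
    "kappa * (theta ^ i * QQ ^ j) = theta ^ i * QQ ^ j * kappa"
    "sg a * (theta ^ i * QQ ^ j) = theta ^ i * QQ ^ j * sg a"
    by (rule *; simp add: theta_comm QQ_theta QQe QQp TQQ QQ_xi QQ_eta kappa_comm' sg_def)+
  show "X a * (theta ^ i * QQ ^ j) = theta ^ i * QQ ^ j * X a" if "a \<in> idx n"
    by (rule *) (simp_all add: theta_comm QQX that)
qed

lemma Q1_GG: "Q1 * (theta ^ i * QQ ^ j) = theta ^ i * QQ ^ j * Q1"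
  unfolding Q1_def sum_distrib_left sum_distrib_right
  by (intro sum.cong refl)
     (simp only: mult.assoc[of "sg _"] mult.assoc[of "e _"] GG_comm prim_in left_comm[OF GG_comm(9), symmetric]
       left_comm[OF GG_comm(2), symmetric])

lemma d_G:
  assumes a: "a \<in> idx n"
  shows "d a * (theta ^ Suc i * QQ ^ i) = theta ^ Suc i * QQ ^ i * d a
    + sc (of_nat (Suc i)) * (p (prim n a) * (theta ^ i * QQ ^ i))"
proof -
  have "d a * (theta ^ Suc i * QQ ^ i) = (d a * theta ^ Suc i) * QQ ^ i" by (simp only: mult.assoc)
  also have "\<dots> = theta ^ Suc i * (d a * QQ ^ i) + sc (of_nat (Suc i)) * (p (prim n a) * (theta ^ i * QQ ^ i))"
    by (simp only: d_theta_power[OF a] distrib_right mult.assoc diff_Suc_1)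
  finally show ?thesis by (simp only: pow_comm[OF dQQ] mult.assoc)
qed

lemma d_dp_zeta:
  assumes a: "a \<in> idx n"
  shows "d a * dp zeta j = dp zeta j * d a + X a * dp zeta (j - 1)
    + sc (- 1 / 2) * (sg a * (p (prim n a) * (QQ * dp zeta (j - 2))))"
proof -
  \<comment> \<open>Half of the commutator of \<open>zeta\<close> and \<open>X a\<close>, as
    \<open>dp_derivation\<close> requires.\<close>
  define h where "h = sc (- 1 / 2) * (sg a * (p (prim n a) * QQ))"
  have zp: "zeta * p b = p b * zeta" for b
    by (simp add: zeta_def sum_distrib_left sum_distrib_right mult.assoc X_comm generator_comm)
  have "zeta * h = h * zeta"
    by (simp add: h_def mult.assoc sc_lcomm QQ_zeta left_comm[OF zp] sg_def)
  moreover have "h + h = - (sg a * (p (prim n a) * QQ))" by (simp only: h_def sc_half)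
  then have "zeta * X a = X a * zeta + (h + h)" by (simp add: zeta_X[OF a])
  ultimately have "d a * dp zeta j = dp zeta j * d a + X a * dp zeta (j - 1) + h * dp zeta (j - 2)"
    by (intro dp_derivation d_zeta[OF a])
  then show ?thesis by (simp add: h_def mult.assoc)
qed

text \<open>Each \<open>d a\<close> is moved to the right end. Its action on the power of
  \<open>theta\<close> gives \<open>xi - eta\<close>. On the divided power of \<open>zeta\<close>,
  the first-order part gives \<open>- n QQ\<close> by \<open>sum_sg_XX\<close>; the second-order
  part restores a factor \<open>zeta\<close>, which \<open>dp_step_pred\<close> absorbs at the cost
  of the factor j - 1, whence the coefficient (j - 1) / 2.\<close>

lemma XD_identity:
  fixes i :: nat and j :: int
  defines "G \<equiv> theta ^ Suc i * QQ ^ i"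
  shows "(\<Sum>a\<in>idx n. sg a * (X (prim n a) * (d a * (G * (dp zeta j * T))))) =
     sc (of_nat (Suc i)) * ((xi - eta) * (theta ^ i * QQ ^ i * (dp zeta j * T)))
     - sc (of_nat n + of_int (j - 1) / 2) * (G * (QQ * (dp zeta (j - 1) * T)))
     + (\<Sum>a\<in>idx n. sg a * (X (prim n a) * (G * (dp zeta j * T))) * d a)"
proof -
  have summand: "sg a * (X (prim n a) * (d a * (G * (dp zeta j * T)))) =
      sc (of_nat (Suc i)) * ((sg a * (p (prim n a) * X (prim n a))) * (theta ^ i * QQ ^ i * (dp zeta j * T)))
    + G * ((sg a * (X (prim n a) * X a)) * (dp zeta (j - 1) * T))
    + G * (sc (- 1 / 2) * ((p (prim n a) * X (prim n a)) * (QQ * (dp zeta (j - 2) * T))))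
    + sg a * (X (prim n a) * (G * (dp zeta j * T))) * d a" if a: "a \<in> idx n" for a
  proof -
    note G = GG_comm(8)[where i = "Suc i" and j = i, folded G_def] GG_comm(9)[where i = "Suc i" and j = i, folded G_def]
    have dG: "d a * (G * y) = G * (d a * y) + sc (of_nat (Suc i)) * (p (prim n a) * (theta ^ i * QQ ^ i * y))" for y
      using arg_cong[OF d_G[OF a, of i], of "\<lambda>x. x * y"] by (simp add: G_def mult.assoc distrib_right)
    have dz: "d a * (dp zeta j * T) = dp zeta j * (T * d a) + X a * (dp zeta (j - 1) * T)
        + sc (- 1 / 2) * (sg a * (p (prim n a) * (QQ * (dp zeta (j - 2) * T))))"
      using arg_cong[OF d_dp_zeta[OF a, of j], of "\<lambda>x. x * T"] by (simp add: mult.assoc distrib_right dT)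
    note XG = left_comm[OF G(1)[OF prim_in[OF a]]] and sG = left_comm[OF G(2)]
    have "d a * (G * (dp zeta j * T)) = sc (of_nat (Suc i)) * (p (prim n a) * (theta ^ i * QQ ^ i * (dp zeta j * T)))
      + G * (X a * (dp zeta (j - 1) * T))
      + G * (sc (- 1 / 2) * (sg a * (p (prim n a) * (QQ * (dp zeta (j - 2) * T)))))
      + G * (dp zeta j * T) * d a"
      unfolding dG dz distrib_left mult.assoc by (simp only: add_ac)
    then show ?thesis
      by (simp only: distrib_left mult.assoc XG sG sg_lcomm' sg_sg sc_lcomm[of "X _"] sc_lcomm[of "sg _"]
          X_comm(5)[of "prim n a"])
  qed
  have "(\<Sum>a\<in>idx n. sg a * (X (prim n a) * (d a * (G * (dp zeta j * T))))) =
      sc (of_nat (Suc i)) * ((\<Sum>a\<in>idx n. sg a * (p (prim n a) * X (prim n a))) * (theta ^ i * QQ ^ i * (dp zeta j * T)))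
    + G * ((\<Sum>a\<in>idx n. sg a * (X (prim n a) * X a)) * (dp zeta (j - 1) * T))
    + G * (sc (- 1 / 2) * ((\<Sum>a\<in>idx n. p (prim n a) * X (prim n a)) * (QQ * (dp zeta (j - 2) * T))))
    + (\<Sum>a\<in>idx n. sg a * (X (prim n a) * (G * (dp zeta j * T))) * d a)"
    unfolding sum_distrib_left sum_distrib_right sum.distrib[symmetric]
    by (intro sum.cong refl) (rule summand)
  also have "(\<Sum>a\<in>idx n. p (prim n a) * X (prim n a)) = zeta"
    unfolding zeta_def by (rule sum_prim)
  also have "zeta * (QQ * (dp zeta (j - 2) * T)) = sc (of_int (j - 1)) * (QQ * (dp zeta (j - 1) * T))"
    using arg_cong[OF dp_step_pred(1)[of zeta "j - 1"], of "\<lambda>x. QQ * (x * T)"]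
    by (simp add: left_comm[OF QQ_zeta, symmetric] mult.assoc sc_lcomm)
  finally show ?thesis
    unfolding sum_sg_pX sum_sg_XX
    by (simp add: sc_lcomm[of G] sc_sc mult.assoc sc_add sc_minus distrib_right right_diff_distrib diff_divide_distrib)
qed

section \<open>Euler operators\<close>

text \<open>\<open>EE\<close> counts the degree in all the \<open>p\<close>, \<open>EP\<close> the
  degree in those with index above n. They are what remains of \<open>kappa\<close> and
  \<open>kp\<close> after contraction.\<close>

definition EE :: 'r where "EE = (\<Sum>a\<in>idx n. p a * d a)"
definition EP :: 'r where "EP = (\<Sum>a\<in>{n + 1..2 * n}. p a * d a)"

lemma EE_zeta: "EE * zeta = zeta * EE + zeta" and EP_zeta: "EP * zeta = zeta * EP + eta"
proof -
  have zp: "zeta * p b = p b * zeta" for b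
    by (simp add: zeta_def sum_distrib_left sum_distrib_right mult.assoc X_comm generator_comm)
  have *: "(\<Sum>a\<in>A. p a * d a) * zeta = zeta * (\<Sum>a\<in>A. p a * d a) + (\<Sum>a\<in>A. p a * X a)" if "A \<subseteq> idx n" for A
    unfolding sum_distrib_left sum_distrib_right sum.distrib[symmetric]
    by (intro sum.cong refl) (use that in \<open>simp add: mult.assoc d_zeta distrib_left left_comm[OF zp] subset_iff\<close>)
  show "EE * zeta = zeta * EE + zeta" using *[of "idx n"] by (simp add: EE_def zeta_def)
  show "EP * zeta = zeta * EP + eta" using *[of "{n + 1..2 * n}"] half_idx(2) by (simp add: EP_def eta_def subset_iff)
qed

text \<open>A summand of \<open>theta\<close> has degree two, with exactly one factor from the upper
  half. The factor \<open>sc 1\<close> is kept to match \<open>Euler_power\<close>.\<close>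

lemma EE_theta: "EE * theta = theta * EE + sc 2 * theta" and EP_theta: "EP * theta = theta * EP + sc 1 * theta"
proof -
  have *: "(\<Sum>a\<in>A. p a * d a) * theta = theta * (\<Sum>a\<in>A. p a * d a) + (\<Sum>a\<in>A. p a * p (prim n a))" if "A \<subseteq> idx n" for A
    unfolding sum_distrib_left sum_distrib_right sum.distrib[symmetric]
    by (intro sum.cong refl)
       (use that in \<open>simp add: mult.assoc d_theta distrib_left left_comm[OF theta_comm(3)[symmetric]] subset_iff\<close>)
  have up: "(\<Sum>a\<in>{n + 1..2 * n}. p a * p (prim n a)) = theta"
    unfolding theta_def sum_prim_low[of "\<lambda>a. p a * p (prim n a)", symmetric]
    by (intro sum.cong refl) (simp add: prim_prim half_idx pp del: atLeastAtMost_iff)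
  have "(\<Sum>a\<in>idx n. p a * p (prim n a)) = theta + theta"
    unfolding sum_split_half up by (simp add: theta_def)
  moreover have "sc 2 = 1 + 1" using sc_add[of 1 1] by (simp add: sc_1)
  ultimately show "EE * theta = theta * EE + sc 2 * theta" using *[of "idx n"] by (simp add: EE_def distrib_right)
  show "EP * theta = theta * EP + sc 1 * theta"
    using *[of "{n + 1..2 * n}"] half_idx(2) unfolding up EP_def by (simp add: sc_1 subset_iff)
qed

lemma E_QQ: "EE * QQ = QQ * EE" "EP * QQ = QQ * EP" and E_T: "EE * T = T * EE" "EP * T = T * EP"
  by (simp_all add: EE_def EP_def sum_distrib_left sum_distrib_right mult.assoc dQQ QQp[THEN left_comm] dT Tp[THEN left_comm])

lemma Euler_power:
  assumes "y * z = z * y + sc c * z"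
  shows "y * z ^ i = z ^ i * y + sc (of_nat i * c) * z ^ i"
proof (induction i)
  case (Suc i)
  have "y * z ^ Suc i = z * (y * z ^ i) + sc c * z ^ Suc i"
    by (simp add: mult.assoc[symmetric] assms distrib_right)
  also have "\<dots> = z ^ Suc i * y + sc (of_nat (Suc i) * c) * z ^ Suc i"
  proof -
    have q: "of_nat (Suc i) * c = of_nat i * c + c" by (simp add: algebra_simps)
    show ?thesis by (simp add: Suc q sc_add distrib_left distrib_right mult.assoc sc_lcomm[of z] del: of_nat_Suc)
  qed
  finally show ?case .
qed (simp add: sc_0)

lemma EE_word:
  "EE * (theta ^ i * QQ ^ m * dp zeta j) = theta ^ i * QQ ^ m * dp zeta j * EE
    + sc (2 * of_nat i + of_int j) * (theta ^ i * QQ ^ m * dp zeta j)"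
proof -
  have z: "EE * dp zeta j = dp zeta j * EE + sc (of_int j) * dp zeta j"
    using dp_derivation[OF EE_zeta, of 0 j] by (simp add: dp_step_pred)
  have "EE * (theta ^ i * (QQ ^ m * dp zeta j)) = (EE * theta ^ i) * (QQ ^ m * dp zeta j)" by (simp only: mult.assoc)
  also have "\<dots> = theta ^ i * (QQ ^ m * (EE * dp zeta j)) + sc (of_nat i * 2) * (theta ^ i * (QQ ^ m * dp zeta j))"
    by (simp only: Euler_power[OF EE_theta] distrib_right mult.assoc left_comm[OF pow_comm[OF E_QQ(1)]])
  finally show ?thesis
    by (simp add: z distrib_left mult.assoc sc_lcomm sc_add distrib_right mult.commute[of 2] algebra_simps)
qed

text \<open>\<open>zeta\<close> is not an eigenvector for \<open>EP\<close>: its image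
  \<open>eta\<close> does not commute with \<open>zeta\<close>, and half of the commutator,
  \<open>hh\<close>, raises the exponents of \<open>theta\<close> and \<open>QQ\<close> in the last
  term.\<close>

lemma EP_word:
  "EP * (theta ^ i * QQ ^ i * dp zeta j) = theta ^ i * QQ ^ i * dp zeta j * EP
    + sc (of_nat i) * (theta ^ i * QQ ^ i * dp zeta j)
    + theta ^ i * QQ ^ i * (eta * dp zeta (j - 1))
    - sc (1 / 2) * (theta ^ Suc i * QQ ^ Suc i * dp zeta (j - 2))"
proof -
  have "zeta * eta = eta * zeta - theta * QQ"
    using xi_eta by (simp add: zeta_split algebra_simps)
  moreover have "hh + hh = - (theta * QQ)" by (simp only: hh_def sc_half)
  ultimately have z: "EP * dp zeta j = dp zeta j * EP + eta * dp zeta (j - 1) + hh * dp zeta (j - 2)"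
    by (intro dp_derivation EP_zeta hh_comm) simp
  have h: "theta ^ i * (QQ ^ i * (hh * dp zeta (j - 2))) = - (sc (1 / 2) * (theta ^ Suc i * (QQ ^ Suc i * dp zeta (j - 2))))"
  proof -
    have pw: "z ^ i * (z * y) = z ^ Suc i * y" for z y :: 'r by (simp only: power_Suc2 mult.assoc)
    have "theta ^ i * (QQ ^ i * (hh * dp zeta (j - 2)))
        = sc (- 1 / 2) * (theta ^ i * (theta * (QQ ^ i * (QQ * dp zeta (j - 2)))))"
      by (simp only: hh_def mult.assoc sc_lcomm[of "theta ^ i"] sc_lcomm[of "QQ ^ i"]
          left_comm[OF pow_comm[OF QQ_theta[symmetric], symmetric]])
    then show ?thesis by (simp only: pw minus_divide_left[symmetric] sc_minus mult_minus_left)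
  qed
  have "EP * (theta ^ i * (QQ ^ i * dp zeta j)) = (EP * theta ^ i) * (QQ ^ i * dp zeta j)" by (simp only: mult.assoc)
  also have "\<dots> = theta ^ i * (QQ ^ i * (EP * dp zeta j)) + sc (of_nat i * 1) * (theta ^ i * (QQ ^ i * dp zeta j))"
    by (simp only: Euler_power[OF EP_theta] distrib_right mult.assoc left_comm[OF pow_comm[OF E_QQ(2)]])
  finally show ?thesis
    by (simp only: z distrib_left mult.assoc h mult_1_right) (simp only: add_ac diff_conv_add_uminus)
qed

end

section \<open>Vacuum expectation values\<close>

text \<open>A vacuum expectation value in which \<open>e a\<close> acts to the left as the derivative \<open>d a\<close>; on words of equal degree in
  \<open>e\<close> and \<open>p\<close> it is the apolar pairing of polynomials.\<close>

locale oscillator_vacuum = symplectic_oscillator sc n f e p d T W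
  for sc :: "rat \<Rightarrow> 'r::{ring,monoid_mult}" and n f e p d T W +
  fixes vev :: "'r \<Rightarrow> complex"
  assumes vev_add: "vev (x + y) = vev x + vev y"
    and vev_sc: "vev (sc q * x) = of_rat q * vev x"
    and vev_e: "vev (e a * x) = vev (d a * x)"
    and vev_d: "vev (x * d a) = 0"
    and vev_T: "vev (x * T) = vev x"
begin

lemma vev_0: "vev 0 = 0"
  using vev_add[of 0 0] by simp

lemma vev_minus: "vev (- x) = - vev x"
  using vev_add[of x "- x"] by (simp add: vev_0 add_eq_0_iff2)

lemma vev_diff: "vev (x - y) = vev x - vev y"
  using vev_add[of x "- y"] by (simp add: vev_minus)

lemma vev_sum: "vev (\<Sum>a\<in>A. h a) = (\<Sum>a\<in>A. vev (h a))"
  by (induction A rule: infinite_finite_induct) (simp_all add: vev_0 vev_add)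

text \<open>Each \<open>e a\<close> becomes \<open>d a\<close>, and moving it behind
  \<open>p a\<close> contributes one, hence the summand with the number of indices.\<close>

lemma vev_contract:
  assumes "finite A"
  shows "vev ((\<Sum>a\<in>A. p a * e a) * x) = vev ((\<Sum>a\<in>A. p a * d a) * x) + of_nat (card A) * vev x"
proof -
  have "vev (p a * e a * x) = vev (p a * d a * x) + vev x" for a
  proof -
    have "vev (p a * e a * x) = vev (e a * (p a * x))" by (simp add: ep[symmetric] mult.assoc)
    also have "\<dots> = vev ((d a * p a) * x)" by (simp only: vev_e mult.assoc)
    finally show ?thesis by (simp add: dp distrib_right vev_add mult.assoc)
  qed
  then show ?thesis by (simp add: sum_distrib_right vev_sum sum.distrib)
qed

lemma vev_EE: "vev (x * EE) = 0" and vev_EP: "vev (x * EP) = 0"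
  by (simp_all add: EE_def EP_def sum_distrib_left vev_sum mult.assoc[symmetric] vev_d)

lemma derivation_T:
  assumes "y * w = w * y + r" "y * T = T * y"
  shows "y * (w * T) = w * T * y + r * T"
proof -
  have "y * (w * T) = (y * w) * T" by (simp only: mult.assoc)
  then show ?thesis by (simp only: assms distrib_right mult.assoc)
qed

section \<open>The recursion for the expectation values\<close>

definition tt :: "nat \<Rightarrow> int \<Rightarrow> complex" where "tt i j = vev (theta ^ i * QQ ^ i * dp zeta j)"

lemma tt_neg: "j < 0 \<Longrightarrow> tt i j = 0"
  by (simp add: tt_def dp_neg vev_0)

lemma tt_Suc: "tt (Suc i) j = vev (theta ^ Suc i * QQ ^ i * (QQ * dp zeta j))"
proof -
  have "theta ^ Suc i * QQ ^ Suc i * dp zeta j = theta ^ Suc i * QQ ^ i * (QQ * dp zeta j)"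
    by (simp only: power_Suc2[of QQ] mult.assoc)
  then show ?thesis by (simp only: tt_def)
qed

lemma idx_card: "card (idx n) = 2 * n" by (simp add: idx_def)

text \<open>In the factor, 2n is the number of contracted indices and the rest is the degree in
  \<open>p\<close> of the word.\<close>

lemma vev_kappa: "vev (kappa * (theta ^ Suc i * QQ ^ i * (QQ * (dp zeta j * T)))) = (2 * of_nat n + 2 * of_nat (Suc i) + of_int j) * tt (Suc i) j"
proof -
  let ?w = "theta ^ Suc i * QQ ^ Suc i * dp zeta j"
  have w: "theta ^ Suc i * QQ ^ i * (QQ * (dp zeta j * T)) = ?w * T"
    by (simp only: power_Suc2[of QQ] mult.assoc)
  have "vev (EE * (?w * T)) = of_rat (2 * of_nat (Suc i) + of_int j) * tt (Suc i) j"
    unfolding derivation_T[OF EE_word E_T(1)] vev_add vev_EE mult.assoc[of "sc _"] vev_sc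
    by (simp only: vev_T tt_def add_0_left)
  then show ?thesis
    unfolding w kappa_def vev_contract[OF finite_idx] EE_def[symmetric]
    by (simp only: vev_T tt_def[symmetric] idx_card) (simp add: of_rat_add of_rat_mult algebra_simps del: of_nat_Suc)
qed

definition yy :: "nat \<Rightarrow> int \<Rightarrow> complex" where "yy i j = vev (theta ^ i * QQ ^ i * (eta * dp zeta j))"

lemma vev_xi_eta:
  "vev ((xi - eta) * (theta ^ i * QQ ^ i * (dp zeta j * T))) = of_int (j + 1) * tt i (j + 1) - 2 * yy i j"
proof -
  have "(xi - eta) * (theta ^ i * QQ ^ i * (dp zeta j * T)) = theta ^ i * QQ ^ i * ((xi - eta) * dp zeta j) * T"
    by (simp only: mult.assoc left_diff_distrib right_diff_distrib left_comm[OF GG_comm(5), unfolded mult.assoc] left_comm[OF GG_comm(6), unfolded mult.assoc])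
  also have "(xi - eta) * dp zeta j = zeta * dp zeta j - eta * dp zeta j - eta * dp zeta j"
    by (simp add: zeta_split algebra_simps)
  also have "zeta * dp zeta j = sc (of_int (j + 1)) * dp zeta (j + 1)" by (rule dp_step)
  finally have "vev ((xi - eta) * (theta ^ i * QQ ^ i * (dp zeta j * T)))
    = vev (theta ^ i * QQ ^ i * (sc (of_int (j + 1)) * dp zeta (j + 1) - eta * dp zeta j - eta * dp zeta j))"
    by (simp only: vev_T)
  then show ?thesis
    by (simp only: right_diff_distrib vev_diff sc_lcomm[of "theta ^ i * QQ ^ i"] vev_sc tt_def[symmetric] yy_def[symmetric])
      (simp add: of_rat_add)
qed

lemma vev_Q1_contract:
  "vev (Q1 * x) = vev (\<Sum>a\<in>idx n. sg a * (X (prim n a) * (d a * x)))"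
proof -
  have "vev (sg a * (e a * X (prim n a)) * x) = vev (sg a * (X (prim n a) * (d a * x)))" for a
  proof -
    have "sg a * (e a * X (prim n a)) * x = e a * (sg a * (X (prim n a) * x))"
      by (simp add: mult.assoc sg_lcomm)
    then have "vev (sg a * (e a * X (prim n a)) * x) = vev (d a * (sg a * (X (prim n a) * x)))" by (simp add: vev_e)
    also have "d a * (sg a * (X (prim n a) * x)) = sg a * (X (prim n a) * (d a * x))"
      by (simp add: sg_lcomm X_comm)
    finally show ?thesis .
  qed
  then show ?thesis by (simp only: Q1_def sum_distrib_right vev_sum)
qed

text \<open>Both sides come from the expectation of \<open>Q1\<close> times the word with one
  \<open>theta\<close> more than \<open>QQ\<close>. By \<open>Q1_T\<close> it is expressed through
  \<open>tt\<close> alone; contracting the \<open>e\<close> in \<open>Q1\<close> and applying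
  \<open>XD_identity\<close> brings in \<open>yy\<close>.\<close>

lemma yy_relation:
  "of_nat (Suc i) * (of_int (j + 1) * tt i (j + 1) - 2 * yy i j)
    = tt (Suc i) j - (of_nat n + 2 * of_nat i + (of_int j + 3) / 2) * tt (Suc i) (j - 1)"
proof -
  let ?G = "theta ^ Suc i * QQ ^ i"
  have "vev (Q1 * (?G * (dp zeta j * T))) = tt (Suc i) j - (2 * of_nat n + 2 * of_nat (Suc i) + of_int (j - 1)) * tt (Suc i) (j - 1)"
    by (simp only: Q1_T[OF Q1_GG GG_comm(7)] vev_diff vev_kappa tt_Suc[symmetric])
  moreover have "vev (Q1 * (?G * (dp zeta j * T)))
      = of_nat (Suc i) * (of_int (j + 1) * tt i (j + 1) - 2 * yy i j) - (of_nat n + of_int (j - 1) / 2) * tt (Suc i) (j - 1)"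
  proof -
    have T: "vev (?G * (QQ * (dp zeta (j - 1) * T))) = tt (Suc i) (j - 1)"
      by (simp only: tt_Suc mult.assoc[symmetric] vev_T)
    have q: "of_rat (of_nat n + of_int (j - 1) / 2) = of_nat n + of_int (j - 1) / (2::complex)"
      by (simp add: of_rat_add of_rat_divide of_rat_diff)
    show ?thesis
      unfolding vev_Q1_contract XD_identity vev_add vev_diff vev_sc vev_xi_eta T vev_sum vev_d q
      by (simp del: of_nat_Suc)
  qed
  ultimately have "of_nat (Suc i) * (of_int (j + 1) * tt i (j + 1) - 2 * yy i j)
      = tt (Suc i) j - (2 * of_nat n + 2 * of_nat (Suc i) + of_int (j - 1)) * tt (Suc i) (j - 1)
        + (of_nat n + of_int (j - 1) / 2) * tt (Suc i) (j - 1)"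
    by (simp only: diff_eq_eq)
  then show ?thesis by (simp only:) (simp add: field_simps)
qed

text \<open>Here n counts the indices of the upper half and i is the degree of
  \<open>theta ^ i\<close> in their variables; the other two terms are those of
  \<open>EP_word\<close>.\<close>

lemma vev_kp:
  "vev (kp * (theta ^ i * QQ ^ i * (dp zeta j * T))) = (of_nat n + of_nat i) * tt i j + yy i (j - 1) - tt (Suc i) (j - 2) / 2"
proof -
  let ?w = "theta ^ i * QQ ^ i * dp zeta j"
  have w: "theta ^ i * QQ ^ i * (dp zeta j * T) = ?w * T"
    by (simp only: mult.assoc)
  have "EP * ?w = ?w * EP + (sc (of_nat i) * ?w + theta ^ i * QQ ^ i * (eta * dp zeta (j - 1))
      - sc (1 / 2) * (theta ^ Suc i * QQ ^ Suc i * dp zeta (j - 2)))"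
    unfolding EP_word by simp
  from derivation_T[OF this E_T(2)]
  have "vev (EP * (?w * T)) = of_nat i * tt i j + yy i (j - 1) - tt (Suc i) (j - 2) / 2"
    unfolding vev_T by (simp only: vev_T vev_add vev_diff vev_EP vev_sc tt_def[symmetric] yy_def[symmetric] add_0_left)
      (simp add: of_rat_divide)
  then show ?thesis
    unfolding w kp_def vev_contract[OF finite_atLeastAtMost] EP_def[symmetric]
    by (simp only: vev_T tt_def[symmetric]) (simp add: algebra_simps)
qed

text \<open>A discrete antiderivative, up to sign, of the i-th term of \<open>PP_expand\<close>. The
  leading factor is the coefficient in \<open>dp_hh\<close>.\<close>

definition aa :: "int \<Rightarrow> nat \<Rightarrow> complex" where
  "aa k i = (- 1 / 2) ^ i / fact i * (tt i (k - 2 * int i) - (2 * of_nat n + of_int k - 1) / 2 * tt i (k - 1 - 2 * int i))"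

text \<open>The sum for \<open>vev (PP k)\<close> telescopes; only the manifestly invariant boundary term survives.\<close>

lemma vev_PP:
  "vev (PP (int k)) = vev (dp zeta (int k)) - (2 * of_nat n + of_nat k - 1) / 2 * vev (dp zeta (int k - 1))"
proof -
  \<comment> \<open>\<open>yy_relation\<close> eliminates \<open>yy\<close> from
    \<open>vev_kp\<close>. With k = j + 1 + 2i the coefficients of \<open>tt i j\<close> and of
    \<open>tt (Suc i) (j - 2)\<close> are then governed by the same constant \<open>M\<close>, which
    does not depend on i.\<close>
  have tele: "(- 1 / 2) ^ i / fact i * (tt i (int k - 2 * int i)
        - vev (kp * (theta ^ i * QQ ^ i * (dp zeta (int k - 1 - 2 * int i) * T)))) = aa (int k) i - aa (int k) (Suc i)" for i
  proof -
    define j where "j = int k - 1 - 2 * int i"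
    define M :: complex where "M = 2 * of_nat n + of_nat k - 1"
    have kj: "of_nat k = of_int j + 1 + 2 * (of_nat i :: complex)"
    proof -
      have "int k = j + 1 + 2 * int i" by (simp add: j_def)
      then have "(of_int (int k) :: complex) = of_int (j + 1 + 2 * int i)" by simp
      then show ?thesis by simp
    qed
    have y: "of_nat (Suc i) * (of_int j * tt i j - 2 * yy i (j - 1))
      = tt (Suc i) (j - 1) - (of_nat n + 2 * of_nat i + (of_int j + 2) / 2) * tt (Suc i) (j - 2)"
      using yy_relation[of i "j - 1"] by simp
    define V where "V = vev (kp * (theta ^ i * QQ ^ i * (dp zeta j * T)))"
    have V: "2 * of_nat (Suc i) * V = of_nat (Suc i) * (M * tt i j) - (tt (Suc i) (j - 1) - M / 2 * tt (Suc i) (j - 2))"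
    proof -
      have "2 * of_nat (Suc i) * V = of_nat (Suc i) * (2 * of_nat n + 2 * of_nat i + of_int j) * tt i j
          - of_nat (Suc i) * (of_int j * tt i j - 2 * yy i (j - 1)) - of_nat (Suc i) * tt (Suc i) (j - 2)"
        unfolding V_def vev_kp by (simp add: algebra_simps)
      then show ?thesis unfolding y M_def kj by (simp add: field_simps)
    qed
    have "V = M / 2 * tt i j - 1 / (2 * of_nat (Suc i)) * (tt (Suc i) (j - 1) - M / 2 * tt (Suc i) (j - 2))"
    proof -
      have "(2 * of_nat (Suc i) :: complex) \<noteq> 0" by (metis mult_eq_0_iff of_nat_eq_0_iff zero_neq_numeral nat.distinct(1))
      then have "V = (2 * of_nat (Suc i) * V) / (2 * of_nat (Suc i))" by simp
      also have "\<dots> = (of_nat (Suc i) * (M * tt i j)) / (2 * of_nat (Suc i)) - (tt (Suc i) (j - 1) - M / 2 * tt (Suc i) (j - 2)) / (2 * of_nat (Suc i))"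
        by (simp only: V diff_divide_distrib)
      finally show ?thesis by (simp del: of_nat_Suc)
    qed
    moreover have "(- 1 / 2) ^ Suc i / fact (Suc i) = - ((- 1 / 2) ^ i / fact i * (1 / (2 * of_nat (Suc i))) :: complex)" for i :: nat
      by (simp add: fact_Suc del: of_nat_Suc)
    ultimately have "(- 1 / 2) ^ i / fact i * (tt i (int k - 2 * int i) - V)
       = (- 1 / 2) ^ i / fact i * (tt i (int k - 2 * int i) - M / 2 * tt i j)
         - (- 1 / 2) ^ Suc i / fact (Suc i) * (tt (Suc i) (j - 1) - M / 2 * tt (Suc i) (j - 2))"
      by (simp only:) (simp add: algebra_simps del: of_nat_Suc)
    then show ?thesis by (simp add: aa_def V_def M_def j_def algebra_simps)
  qed
  have "vev (PP (int k)) = (\<Sum>i\<in>{0..int k}. vev (dp hh i * dp zeta (int k - 2 * i)) - vev (kp * (dp hh i * (dp zeta (int k - 1 - 2 * i) * T))))"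
    by (simp add: PP_expand vev_diff vev_sum sum_subtractf)
  also have "\<dots> = (\<Sum>i\<in>{0..k}. vev (dp hh (int i) * dp zeta (int k - 2 * int i)) - vev (kp * (dp hh (int i) * (dp zeta (int k - 1 - 2 * int i) * T))))"
    by (rule sum.reindex_bij_witness[of _ int nat]) auto
  also have "\<dots> = (\<Sum>i\<in>{0..k}. aa (int k) i - aa (int k) (Suc i))"
  proof (intro sum.cong refl)
    fix i
    have q: "of_rat ((- 1 / 2) ^ i / fact i) = (- 1 / 2) ^ i / (fact i :: complex)"
    proof -
      have "of_rat (fact i) = (fact i :: complex)" by (metis of_nat_fact of_rat_of_nat_eq)
      then show ?thesis by (simp add: of_rat_divide of_rat_power of_rat_minus)
    qed
    have "vev (dp hh (int i) * dp zeta (int k - 2 * int i)) - vev (kp * (dp hh (int i) * (dp zeta (int k - 1 - 2 * int i) * T)))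
      = (- 1 / 2) ^ i / fact i * (tt i (int k - 2 * int i)
        - vev (kp * (theta ^ i * QQ ^ i * (dp zeta (int k - 1 - 2 * int i) * T))))"
      unfolding dp_hh mult.assoc[of "sc _"] sc_lcomm[of kp] vev_sc q tt_def by (simp add: right_diff_distrib)
    then show "vev (dp hh (int i) * dp zeta (int k - 2 * int i)) - vev (kp * (dp hh (int i) * (dp zeta (int k - 1 - 2 * int i) * T)))
      = aa (int k) i - aa (int k) (Suc i)" by (simp only: tele)
  qed
  also have "\<dots> = aa (int k) 0 - aa (int k) (Suc k)"
    unfolding atLeast0AtMost by (rule sum_telescope)
  \<comment> \<open>At \<open>Suc k\<close> both \<open>tt\<close> have a negative second
    argument.\<close>
  also have "\<dots> = aa (int k) 0" by (simp add: aa_def tt_neg)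
  finally show ?thesis by (simp add: aa_def tt_def)
qed

end

section \<open>Sums over non-decreasing sequences\<close>

lemma nondec_seqs_finite: "finite (nondec_seqs N k)"
  unfolding nondec_seqs_def by (rule finite_subset[OF _ finite_PiE[of "{1..k}" "\<lambda>_. {1..N}"]]) auto

lemma nondec_seqs_mono: "\<alpha> \<in> nondec_seqs N k \<Longrightarrow> i \<in> {1..k} \<Longrightarrow> j \<in> {1..k} \<Longrightarrow> i \<le> j \<Longrightarrow> \<alpha> i \<le> \<alpha> j"
  by (auto simp: nondec_seqs_def mono_on_def)

lemma nondec_seqs_range: "\<alpha> \<in> nondec_seqs N k \<Longrightarrow> j \<in> {1..k} \<Longrightarrow> \<alpha> j \<in> {1..N}"
  by (auto simp: nondec_seqs_def PiE_iff)

text \<open>Appends k - l copies of the new largest value to a sequence of length l; the value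
  outside \<open>{1..k}\<close> is the one required of extensional functions.\<close>

definition extend_seq :: "nat \<Rightarrow> nat \<Rightarrow> nat \<Rightarrow> (nat \<Rightarrow> nat) \<Rightarrow> nat \<Rightarrow> nat" where
  "extend_seq M k l \<beta> = (\<lambda>j. if j \<in> {1..k} then (if j \<le> l then \<beta> j else Suc M) else undefined)"

lemma nondec_low_card:
  assumes \<alpha>: "\<alpha> \<in> nondec_seqs N k"
  shows "{j \<in> {1..k}. \<alpha> j \<le> M} = {1..card {j \<in> {1..k}. \<alpha> j \<le> M}}" (is "?A = _")
proof (cases "?A = {}")
  case True
  then show ?thesis by (simp only: card.empty) simp
next
  case False
  define m where "m = Max ?A"
  have fin: "finite ?A" by simp
  have m: "m \<in> ?A" unfolding m_def by (rule Max_in[OF fin False])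
  have "?A = {1..m}"
  proof (intro equalityI subsetI)
    fix j assume "j \<in> ?A"
    then show "j \<in> {1..m}" using Max_ge[OF fin, of j] by (auto simp: m_def)
  next
    fix j assume j: "j \<in> {1..m}"
    then have "j \<in> {1..k}" "\<alpha> j \<le> \<alpha> m" using m nondec_seqs_mono[OF \<alpha>, of j m] by auto
    then show "j \<in> ?A" using m by auto
  qed
  then show ?thesis by simp
qed

text \<open>By monotonicity the entries at most M form an initial segment
  (\<open>nondec_low_card\<close>); its length l and the sequence on it determine the whole.\<close>

lemma sum_nondec_seqs_Suc:
  "(\<Sum>\<alpha>\<in>nondec_seqs (Suc M) k. h \<alpha>) = (\<Sum>l\<in>{0..k}. \<Sum>\<beta>\<in>nondec_seqs M l. h (extend_seq M k l \<beta>))"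
proof -
  define low where "low \<alpha> = card {j \<in> {1..k}. \<alpha> j \<le> M}" for \<alpha>
  have low: "j \<le> low \<alpha> \<longleftrightarrow> \<alpha> j \<le> M" if "\<alpha> \<in> nondec_seqs (Suc M) k" "j \<in> {1..k}" for \<alpha> j
  proof -
    have "j \<in> {j \<in> {1..k}. \<alpha> j \<le> M} \<longleftrightarrow> j \<in> {1..low \<alpha>}"
      by (simp only: nondec_low_card[OF that(1), of M, folded low_def])
    then show ?thesis using that(2) by simp
  qed
  have low_le: "low \<alpha> \<le> k" for \<alpha>
  proof -
    have "card {j \<in> {1..k}. \<alpha> j \<le> M} \<le> card {1..k}" by (rule card_mono) auto
    then show ?thesis by (simp add: low_def)
  qed
  have ext: "extend_seq M k l \<beta> \<in> nondec_seqs (Suc M) k \<and> low (extend_seq M k l \<beta>) = l"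
    if l: "l \<le> k" and \<beta>: "\<beta> \<in> nondec_seqs M l" for l \<beta>
  proof
    have b: "\<beta> j \<in> {1..M}" if "1 \<le> j" "j \<le> l" for j using nondec_seqs_range[OF \<beta>, of j] that by auto
    show "extend_seq M k l \<beta> \<in> nondec_seqs (Suc M) k"
      unfolding nondec_seqs_def
    proof (intro CollectI conjI PiE_I mono_onI)
      fix j assume j: "j \<in> {1..k}"
      then show "extend_seq M k l \<beta> j \<in> {1..Suc M}"
        using b[of j] by (cases "j \<le> l") (auto simp: extend_seq_def)
    next
      fix i j assume ij: "i \<in> {1..k}" "j \<in> {1..k}" "i \<le> j"
      then show "extend_seq M k l \<beta> i \<le> extend_seq M k l \<beta> j"
        using b[of i] nondec_seqs_mono[OF \<beta>, of i j]
        by (cases "i \<le> l"; cases "j \<le> l") (auto simp: extend_seq_def)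
    next
      fix j assume "j \<notin> {1..k}"
      then show "extend_seq M k l \<beta> j = undefined" unfolding extend_seq_def by (rule if_not_P)
    qed
    have "{j \<in> {1..k}. extend_seq M k l \<beta> j \<le> M} = {1..l}"
    proof (rule Set.set_eqI)
      fix j
      show "j \<in> {j \<in> {1..k}. extend_seq M k l \<beta> j \<le> M} \<longleftrightarrow> j \<in> {1..l}"
        using b[of j] l by (cases "j \<le> l") (simp_all add: extend_seq_def)
    qed
    then show "low (extend_seq M k l \<beta>) = l" by (simp add: low_def)
  qed
  have restr: "restrict \<alpha> {1..low \<alpha>} \<in> nondec_seqs M (low \<alpha>)"
    "extend_seq M k (low \<alpha>) (restrict \<alpha> {1..low \<alpha>}) = \<alpha>" if \<alpha>: "\<alpha> \<in> nondec_seqs (Suc M) k" for \<alpha>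
  proof -
    have r: "\<alpha> j \<in> {1..M}" if "j \<in> {1..low \<alpha>}" for j
      using that low[OF \<alpha>, of j] low_le[of \<alpha>] nondec_seqs_range[OF \<alpha>, of j] by auto
    have m: "\<alpha> i \<le> \<alpha> j" if "i \<in> {1..low \<alpha>}" "j \<in> {1..low \<alpha>}" "i \<le> j" for i j
      using that low_le[of \<alpha>] nondec_seqs_mono[OF \<alpha>, of i j] by auto
    show "restrict \<alpha> {1..low \<alpha>} \<in> nondec_seqs M (low \<alpha>)"
      unfolding nondec_seqs_def using r m by (auto simp: PiE_iff mono_on_def)
    show "extend_seq M k (low \<alpha>) (restrict \<alpha> {1..low \<alpha>}) = \<alpha>"
    proof
      fix j
      show "extend_seq M k (low \<alpha>) (restrict \<alpha> {1..low \<alpha>}) j = \<alpha> j"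
      proof (cases "j \<in> {1..k}")
        case True
        then show ?thesis using low[OF \<alpha> True] nondec_seqs_range[OF \<alpha> True] by (auto simp: extend_seq_def)
      next
        case False
        then show ?thesis using \<alpha> by (auto simp: extend_seq_def nondec_seqs_def PiE_iff extensional_def)
      qed
    qed
  qed
  have restr': "restrict (extend_seq M k l \<beta>) {1..l} = \<beta>" if "l \<le> k" "\<beta> \<in> nondec_seqs M l" for l \<beta>
    using that by (auto simp: extend_seq_def nondec_seqs_def PiE_iff extensional_def fun_eq_iff)
  have "(\<Sum>l\<in>{0..k}. \<Sum>\<beta>\<in>nondec_seqs M l. h (extend_seq M k l \<beta>))
      = (\<Sum>(l, \<beta>)\<in>Sigma {0..k} (nondec_seqs M). h (extend_seq M k l \<beta>))"
    by (rule sum.Sigma) (auto simp: nondec_seqs_finite)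
  also have "\<dots> = (\<Sum>\<alpha>\<in>nondec_seqs (Suc M) k. h \<alpha>)"
  proof (rule sum.reindex_bij_witness[of _ "\<lambda>\<alpha>. (low \<alpha>, restrict \<alpha> {1..low \<alpha>})" "\<lambda>(l, \<beta>). extend_seq M k l \<beta>"])
    fix x assume "x \<in> Sigma {0..k} (nondec_seqs M)"
    then obtain l \<beta> where x: "x = (l, \<beta>)" "l \<le> k" "\<beta> \<in> nondec_seqs M l" by auto
    show "(case x of (l, \<beta>) \<Rightarrow> extend_seq M k l \<beta>) \<in> nondec_seqs (Suc M) k"
      using x ext[of l \<beta>] by simp
    show "(low (case x of (l, \<beta>) \<Rightarrow> extend_seq M k l \<beta>), restrict (case x of (l, \<beta>) \<Rightarrow> extend_seq M k l \<beta>) {1..low (case x of (l, \<beta>) \<Rightarrow> extend_seq M k l \<beta>)}) = x"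
      using x ext[of l \<beta>] restr'[of l \<beta>] by simp
  next
    fix \<alpha> assume \<alpha>: "\<alpha> \<in> nondec_seqs (Suc M) k"
    show "(low \<alpha>, restrict \<alpha> {1..low \<alpha>}) \<in> Sigma {0..k} (nondec_seqs M)"
      using restr(1)[OF \<alpha>] low_le[of \<alpha>] by simp
    show "(case (low \<alpha>, restrict \<alpha> {1..low \<alpha>}) of (l, \<beta>) \<Rightarrow> extend_seq M k l \<beta>) = \<alpha>"
      using restr(2)[OF \<alpha>] by simp
  qed auto
  finally show ?thesis ..
qed

lemma seq_fact_extend:
  assumes "l \<le> k" "\<beta> \<in> nondec_seqs M l"
  shows "seq_fact (Suc M) k (extend_seq M k l \<beta>) = seq_fact M l \<beta> * fact (k - l)"
proof -
  have b: "\<beta> j \<in> {1..M}" if "j \<in> {1..l}" for j using nondec_seqs_range[OF assms(2) that] .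
  have "{j \<in> {1..k}. extend_seq M k l \<beta> j = i} = {j \<in> {1..l}. \<beta> j = i}" if "i \<in> {1..M}" for i
  proof (rule Set.set_eqI)
    fix j
    show "j \<in> {j \<in> {1..k}. extend_seq M k l \<beta> j = i} \<longleftrightarrow> j \<in> {j \<in> {1..l}. \<beta> j = i}"
      using that assms(1) by (cases "j \<le> l") (auto simp: extend_seq_def)
  qed
  moreover have "{j \<in> {1..k}. extend_seq M k l \<beta> j = Suc M} = {Suc l..k}"
  proof (rule Set.set_eqI)
    fix j
    show "j \<in> {j \<in> {1..k}. extend_seq M k l \<beta> j = Suc M} \<longleftrightarrow> j \<in> {Suc l..k}"
      using assms(1) b[of j] by (cases "j \<le> l") (auto simp: extend_seq_def)
  qed
  ultimately show ?thesis by (simp add: seq_fact_def atLeastAtMostSuc_conv)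
qed

section \<open>Ordered sums as products of exponentials\<close>

context rational_scalars begin

text \<open>The degree k part of the ordered product exp (a 1) ... exp (a M), as
  \<open>ordsum_Suc\<close> shows.\<close>

definition ordsum :: "(nat \<Rightarrow> 'r) \<Rightarrow> nat \<Rightarrow> nat \<Rightarrow> 'r" where
  "ordsum a M k = (\<Sum>\<alpha>\<in>nondec_seqs M k. sc (1 / of_nat (seq_fact M k \<alpha>)) * prod_list (map (\<lambda>j. a (\<alpha> j)) [1..<Suc k]))"

lemma ordsum_Suc: "ordsum a (Suc M) k = (\<Sum>l\<in>{0..k}. ordsum a M l * dp (a (Suc M)) (int k - int l))"
  unfolding ordsum_def sum_nondec_seqs_Suc sum_distrib_right
proof (intro sum.cong refl)
  fix l \<beta> assume "l \<in> {0..k}" and \<beta>: "\<beta> \<in> nondec_seqs M l"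
  then have l: "l \<le> k" by simp
  let ?x = "extend_seq M k l \<beta>"
  have "[1..<Suc k] = [1..<Suc l] @ [Suc l..<Suc k]"
    using upt_add_eq_append[of 1 "Suc l" "k - l"] l by (simp del: upt_Suc)
  moreover have "map (\<lambda>j. a (?x j)) [1..<Suc l] = map (\<lambda>j. a (\<beta> j)) [1..<Suc l]"
    using l by (auto simp: extend_seq_def simp del: upt_Suc)
  moreover have "map (\<lambda>j. a (?x j)) [Suc l..<Suc k] = map (\<lambda>_. a (Suc M)) [Suc l..<Suc k]"
    by (auto simp: extend_seq_def simp del: upt_Suc)
  moreover have "prod_list (map (\<lambda>_. z) [Suc l..<Suc k]) = z ^ (k - l)" for z :: 'r
    by (simp add: map_replicate_const del: upt_Suc)
  ultimately have "prod_list (map (\<lambda>j. a (?x j)) [1..<Suc k]) = prod_list (map (\<lambda>j. a (\<beta> j)) [1..<Suc l]) * a (Suc M) ^ (k - l)"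
    by (simp only: map_append prod_list.append)
  moreover have "dp (a (Suc M)) (int k - int l) = sc (1 / fact (k - l)) * a (Suc M) ^ (k - l)"
  proof -
    have "nat (int k - int l) = k - l" by simp
    then show ?thesis using l by (simp only: dp_def) simp
  qed
  moreover have "sc (1 / of_nat (seq_fact (Suc M) k ?x)) = sc (1 / of_nat (seq_fact M l \<beta>)) * sc (1 / fact (k - l))"
    by (simp add: seq_fact_extend[OF l \<beta>] sc_mult[symmetric])
  ultimately show "sc (1 / of_nat (seq_fact (Suc M) k ?x)) * prod_list (map (\<lambda>j. a (?x j)) [1..<Suc k]) =
      sc (1 / of_nat (seq_fact M l \<beta>)) * prod_list (map (\<lambda>j. a (\<beta> j)) [1..<Suc l]) * dp (a (Suc M)) (int k - int l)"
    by (simp only: mult.assoc sc_lcomm[of "prod_list _"])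
qed

lemma dp_zero: "dp 0 k = (if k = 0 then 1 else 0)"
proof (cases "0 < k")
  case True
  then obtain m where "nat k = Suc m" by (cases "nat k") auto
  then show ?thesis using True by (simp add: dp_def)
qed (auto simp: dp_def sc_1)

lemma ordsum_0: "ordsum a 0 k = dp 0 (int k)"
proof (cases "k = 0")
  case True
  have "nondec_seqs 0 0 = {\<lambda>_. undefined}" by (auto simp: nondec_seqs_def)
  then show ?thesis using True by (simp add: ordsum_def seq_fact_def dp_def sc_1)
next
  case False
  then have "nondec_seqs 0 k = {}" by (auto simp: nondec_seqs_def PiE_iff)
  then show ?thesis using False by (simp add: ordsum_def dp_zero)
qed

lemma dp_conv_zero:
  assumes "0 \<le> k"
  shows "dp_conv x 0 k = dp x k"
proof -
  have "dp_conv x 0 k = (\<Sum>l\<in>{0..k}. if l = k then dp x k else 0)"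
    unfolding dp_conv_def by (intro sum.cong refl) (auto simp: dp_zero)
  then show ?thesis using assms by (simp only: sum.delta[OF finite_atLeastAtMost_int]) simp
qed

lemma dp_conv_commute:
  assumes "x * y = y * x" "0 \<le> k"
  shows "dp_conv x y k = dp (x + y) k"
proof -
  have "dp_conv x y k = (\<Sum>i\<in>{0..k}. dp (x + y) (k - 2 * i) * dp 0 i)"
    by (rule dp_conv_Heisenberg) (simp_all add: assms)
  also have "\<dots> = (\<Sum>i\<in>{0..k}. if i = 0 then dp (x + y) k else 0)"
    by (intro sum.cong refl) (auto simp: dp_zero)
  finally show ?thesis using assms(2) by (simp only: sum.delta[OF finite_atLeastAtMost_int]) simp
qed

lemma sum_int_nat: "(\<Sum>l\<in>{0..k}. h (int l)) = (\<Sum>l\<in>{0..int k}. h l)"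
  by (rule sum.reindex_bij_witness[of _ nat int]) auto

lemma dp_conv_assoc:
  assumes "0 \<le> k"
  shows "(\<Sum>l\<in>{0..k}. dp_conv x y l * dp z (k - l)) = (\<Sum>i\<in>{0..k}. dp x i * dp_conv y z (k - i))"
proof -
  have "(\<Sum>l\<in>{0..k}. dp_conv x y l * dp z (k - l)) = (\<Sum>l\<in>{0..k}. \<Sum>i\<in>{0..k}. dp x i * dp y (l - i) * dp z (k - l))"
    unfolding dp_conv_def sum_distrib_right
    by (intro sum.cong refl sum.mono_neutral_left) (auto simp: dp_neg)
  also have "\<dots> = (\<Sum>i\<in>{0..k}. \<Sum>l\<in>{0..k}. dp x i * dp y (l - i) * dp z (k - l))" by (rule sum.swap)
  also have "\<dots> = (\<Sum>i\<in>{0..k}. dp x i * dp_conv y z (k - i))"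
  proof (intro sum.cong refl)
    fix i assume i: "i \<in> {0..k}"
    have "(\<Sum>l\<in>{0..k}. dp x i * dp y (l - i) * dp z (k - l)) = (\<Sum>l\<in>{i..k}. dp x i * dp y (l - i) * dp z (k - l))"
      using i by (intro sum.mono_neutral_right) (auto simp: dp_neg)
    also have "\<dots> = (\<Sum>l\<in>{0..k - i}. dp x i * (dp y l * dp z (k - i - l)))"
      by (rule sum.reindex_bij_witness[of _ "\<lambda>l. l + i" "\<lambda>l. l - i"]) (auto simp: mult.assoc algebra_simps)
    finally show "(\<Sum>l\<in>{0..k}. dp x i * dp y (l - i) * dp z (k - l)) = dp x i * dp_conv y z (k - i)"
      by (simp add: dp_conv_def sum_distrib_left)
  qed
  finally show ?thesis .
qed

lemma ordsum_commuting:
  assumes "\<And>i j. i \<in> {1..m} \<Longrightarrow> j \<in> {1..m} \<Longrightarrow> a i * a j = a j * a i"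
  shows "ordsum a m k = dp (\<Sum>i\<in>{1..m}. a i) (int k)"
  using assms
proof (induction m arbitrary: k)
  case (Suc m)
  let ?S = "\<Sum>i\<in>{1..m}. a i"
  have "?S * a (Suc m) = a (Suc m) * ?S"
    unfolding sum_distrib_left sum_distrib_right using Suc.prems by (intro sum.cong refl) auto
  moreover have IH: "ordsum a m k = dp ?S (int k)" for k using Suc by auto
  ultimately show ?case
    unfolding ordsum_Suc IH sum_int_nat[of "\<lambda>l. dp ?S l * dp (a (Suc m)) (int k - l)"] dp_conv_def[symmetric]
    by (simp add: dp_conv_commute)
qed (simp add: ordsum_0)

text \<open>Inside a block the exponentials merge into that of the sum; the second block is absorbed
  one factor at a time by associativity of the product.\<close>

lemma ordsum_two_blocks:
  assumes "\<And>i j. i \<in> {1..n} \<Longrightarrow> j \<in> {1..n} \<Longrightarrow> a i * a j = a j * a i"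
    and "\<And>i j. i \<in> {n + 1..n + m} \<Longrightarrow> j \<in> {n + 1..n + m} \<Longrightarrow> a i * a j = a j * a i"
  shows "ordsum a (n + m) k = dp_conv (\<Sum>i\<in>{1..n}. a i) (\<Sum>i\<in>{n + 1..n + m}. a i) (int k)"
  using assms(2)
proof (induction m arbitrary: k)
  case 0
  then show ?case using ordsum_commuting[OF assms(1)] by (simp add: dp_conv_zero)
next
  case (Suc m)
  let ?x = "\<Sum>i\<in>{1..n}. a i" and ?S = "\<Sum>i\<in>{n + 1..n + m}. a i" and ?b = "a (Suc (n + m))"
  have comm: "?S * ?b = ?b * ?S"
    unfolding sum_distrib_left sum_distrib_right using Suc.prems by (intro sum.cong refl) auto
  have IH: "ordsum a (n + m) k = dp_conv ?x ?S (int k)" for k using Suc by auto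
  have "ordsum a (n + Suc m) k = (\<Sum>l\<in>{0..int k}. dp_conv ?x ?S l * dp ?b (int k - l))"
    unfolding add_Suc_right ordsum_Suc IH sum_int_nat[of "\<lambda>l. dp_conv ?x ?S l * dp ?b (int k - l)"] ..
  also have "\<dots> = (\<Sum>i\<in>{0..int k}. dp ?x i * dp (?S + ?b) (int k - i))"
    unfolding dp_conv_assoc[OF of_nat_0_le_iff]
    by (intro sum.cong refl) (use dp_conv_commute[OF comm] in auto)
  also have "?S + ?b = (\<Sum>i\<in>{n + 1..n + Suc m}. a i)" by simp
  finally show ?case by (simp only: dp_conv_def)
qed

end

section \<open>Column-permanents as vacuum expectation values\<close>

lemma sum_permutations_of_set_Cons:
  assumes "finite A" "A \<noteq> {}"
  shows "(\<Sum>ys\<in>permutations_of_set A. h ys) = (\<Sum>x\<in>A. \<Sum>ys\<in>permutations_of_set (A - {x}). h (x # ys))"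
proof -
  have "(\<Sum>ys\<in>permutations_of_set A. h ys) = (\<Sum>x\<in>A. \<Sum>ys\<in>(\<lambda>xs. x # xs) ` permutations_of_set (A - {x}). h ys)"
    unfolding permutations_of_set_nonempty[OF assms(2)]
    using assms(1) by (intro sum.UNION_disjoint) auto
  also have "\<dots> = (\<Sum>x\<in>A. \<Sum>ys\<in>permutations_of_set (A - {x}). h (x # ys))"
    by (rule sum.cong[OF refl]) (simp add: sum.reindex inj_on_def)
  finally show ?thesis .
qed

context symplectic_oscillator begin

text \<open>\<open>Psi a i\<close> is the entry of the matrix of \<open>D n k u\<close> in row \<open>a\<close> and column \<open>i\<close>, with the column shift encoded in \<open>T\<close>.\<close>

definition Psi :: "nat \<Rightarrow> nat \<Rightarrow> 'r" where
  "Psi a i = (f a i + (if a = i then W - (if n < i then 1 else 0) else 0)) * T"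

text \<open>The generating element of column i (\<open>XH_expand\<close>); the subtracted
  \<open>e i * T\<close> accounts for the ones on the diagonal of the correction in
  \<open>Ftilde\<close>.\<close>

definition XH :: "nat \<Rightarrow> 'r" where "XH i = (if i \<le> n then X i else X i - e i * T)"

lemma Psi_comm: "e b * Psi a i = Psi a i * e b" "p b * Psi a i = Psi a i * p b" "d b * Psi a i = Psi a i * d b"
  by (simp_all add: Psi_def distrib_left distrib_right right_diff_distrib left_diff_distrib mult.assoc generator_comm)

lemma XH_expand:
  assumes i: "i \<in> idx n"
  shows "XH i = (\<Sum>a\<in>idx n. e a * Psi a i)"
proof -
  have "(\<Sum>a\<in>idx n. e a * Psi a i) = (\<Sum>a\<in>idx n. e a * f a i) * T
      + (\<Sum>a\<in>idx n. if a = i then e i * ((W - (if n < i then 1 else 0)) * T) else 0)"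
    unfolding sum_distrib_right sum.distrib[symmetric]
    by (intro sum.cong refl) (simp add: Psi_def distrib_left distrib_right mult.assoc)
  then show ?thesis
    using i by (simp add: sum_delta_if XH_def X_def g_def[symmetric] distrib_right left_diff_distrib
        right_diff_distrib mult.assoc)
qed

lemma XH_p: "XH i * p a = p a * XH i" and XH_d: "d a * XH i = XH i * d a"
  by (simp_all add: XH_def left_diff_distrib right_diff_distrib mult.assoc X_comm generator_comm)

text \<open>Two indices of the same half are never conjugate, so their \<open>X\<close> commute; the
  terms that \<open>T\<close> creates in the upper half are symmetric in i and j.\<close>

lemma pXH_comm:
  assumes ij: "i \<in> idx n" "j \<in> idx n" "i \<le> n \<longleftrightarrow> j \<le> n"
  shows "(p i * XH i) * (p j * XH j) = (p j * XH j) * (p i * XH i)"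
proof -
  have "prim n i \<noteq> j" using ij(3) prim_le_iff[OF ij(1)] by auto
  then have X: "X i * X j = X j * X i" using XX[OF ij(1,2)] by simp
  have XT: "T * X k = X k * T + e k * (T * T)" for k by (rule TX)
  have "XH i * XH j = XH j * XH i"
    using ij(3) by (auto simp: XH_def left_diff_distrib right_diff_distrib distrib_left mult.assoc X XT Xe X_comm generator_comm
        algebra_simps)
  then show ?thesis by (simp add: mult.assoc XH_p[THEN left_comm] pp generator_left_comm)
qed

lemma PP_ordsum: "PP (int k) = ordsum (\<lambda>i. p i * XH i) (2 * n) k"
proof -
  have "ordsum (\<lambda>i. p i * XH i) (n + n) k = dp_conv (\<Sum>i\<in>{1..n}. p i * XH i) (\<Sum>i\<in>{n + 1..n + n}. p i * XH i) (int k)"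
    by (intro ordsum_two_blocks pXH_comm) (auto simp: idx_def)
  moreover have "(\<Sum>i\<in>{1..n}. p i * XH i) = xi"
    unfolding xi_def by (intro sum.cong refl) (simp add: XH_def)
  moreover have "(\<Sum>i\<in>{n + 1..n + n}. p i * XH i) = eta - kp * T"
    unfolding eta_def kp_def sum_distrib_right sum_subtractf[symmetric]
    by (intro sum.cong) (auto simp: XH_def right_diff_distrib mult.assoc)
  ultimately show ?thesis by (simp add: PP_def mult_2)
qed

lemma prod_list_pXH:
  "prod_list (map (\<lambda>j. p (\<alpha> j) * XH (\<alpha> j)) js) = prod_list (map (\<lambda>j. p (\<alpha> j)) js) * prod_list (map (\<lambda>j. XH (\<alpha> j)) js)"
proof (induction js)
  case (Cons j js)
  have c: "XH i * prod_list (map (\<lambda>j. p (\<alpha> j)) xs) = prod_list (map (\<lambda>j. p (\<alpha> j)) xs) * XH i" for i xs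
    by (induction xs) (simp_all add: mult.assoc XH_p[THEN left_comm])
  show ?case using Cons by (simp add: mult.assoc left_comm[OF c])
qed simp

lemma d_prod_p:
  assumes "distinct xs"
  shows "d a * prod_list (map (\<lambda>j. p (\<alpha> j)) xs) = prod_list (map (\<lambda>j. p (\<alpha> j)) xs) * d a
    + (\<Sum>x\<in>set xs. if a = \<alpha> x then prod_list (map (\<lambda>j. p (\<alpha> j)) (remove1 x xs)) else 0)"
  using assms
proof (induction xs)
  case (Cons y xs)
  let ?P = "\<lambda>xs. prod_list (map (\<lambda>j. p (\<alpha> j)) xs)"
  have "d a * ?P (y # xs) = p (\<alpha> y) * (d a * ?P xs) + (if a = \<alpha> y then ?P xs else 0)"
    by (simp add: mult.assoc[symmetric] dp distrib_right)
  also have "p (\<alpha> y) * (d a * ?P xs) = ?P (y # xs) * d a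
      + p (\<alpha> y) * (\<Sum>x\<in>set xs. if a = \<alpha> x then ?P (remove1 x xs) else 0)"
    using Cons by (simp add: distrib_left mult.assoc)
  also have "p (\<alpha> y) * (\<Sum>x\<in>set xs. if a = \<alpha> x then ?P (remove1 x xs) else 0)
      = (\<Sum>x\<in>set xs. if a = \<alpha> x then ?P (remove1 x (y # xs)) else 0)"
    unfolding sum_distrib_left using Cons.prems by (intro sum.cong refl) auto
  finally show ?case using Cons.prems by (simp add: add.assoc add.commute)
qed simp

end

context oscillator_vacuum begin

text \<open>A Wick expansion. The \<open>e a\<close> of the leftmost remaining \<open>XH\<close> is
  carried to the front and becomes \<open>d a\<close>, which removes one of the \<open>p\<close>
  with value a and thereby chooses the row for this column. The resulting entry joins the prefix
  \<open>L\<close>, so the induction must allow any \<open>L\<close> that commutes with the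
  \<open>e\<close> and \<open>d\<close>.\<close>

lemma vev_permutations:
  assumes "distinct xs" "length js = length xs" "\<And>x. x \<in> set xs \<Longrightarrow> \<alpha> x \<in> idx n" "\<And>j. j \<in> set js \<Longrightarrow> \<alpha> j \<in> idx n"
    and "\<And>a. L * e a = e a * L" "\<And>a. d a * L = L * d a"
  shows "vev (L * (prod_list (map (\<lambda>j. p (\<alpha> j)) xs) * prod_list (map (\<lambda>j. XH (\<alpha> j)) js)))
    = (\<Sum>ys\<in>permutations_of_set (set xs). vev (L * prod_list (map2 (\<lambda>y j. Psi (\<alpha> y) (\<alpha> j)) ys js)))"
  using assms
proof (induction js arbitrary: xs L)
  case Nil
  then show ?case by simp
next
  case (Cons j js)
  let ?P = "\<lambda>xs. prod_list (map (\<lambda>j. p (\<alpha> j)) xs)" and ?Y = "prod_list (map (\<lambda>j. XH (\<alpha> j)) js)"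
  let ?F = "\<lambda>ys js. prod_list (map2 (\<lambda>y j. Psi (\<alpha> y) (\<alpha> j)) ys js)"
  have eP: "?P xs * e a = e a * ?P xs" for a xs
    by (induction xs) (simp_all add: mult.assoc ep generator_left_comm)
  have dY: "d a * ?Y = ?Y * d a" for a
    by (induction js) (simp_all add: mult.assoc XH_d[THEN left_comm])
  have PsiP: "?P xs * Psi a i = Psi a i * ?P xs" for a i xs
    by (induction xs) (simp_all add: mult.assoc Psi_comm(2)[THEN left_comm])
  have summand: "vev (L * (?P xs * (e a * Psi a (\<alpha> j) * ?Y)))
      = (\<Sum>x\<in>set xs. if a = \<alpha> x then vev (L * Psi a (\<alpha> j) * (?P (remove1 x xs) * ?Y)) else 0)" for a
  proof -
    have "L * (?P xs * (e a * Psi a (\<alpha> j) * ?Y)) = e a * (L * (?P xs * (Psi a (\<alpha> j) * ?Y)))"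
      by (simp only: mult.assoc left_comm[OF eP] left_comm[OF Cons.prems(5)])
    then have "vev (L * (?P xs * (e a * Psi a (\<alpha> j) * ?Y))) = vev (L * ((d a * ?P xs) * (Psi a (\<alpha> j) * ?Y)))"
      by (simp only: vev_e mult.assoc left_comm[OF Cons.prems(6)])
    also have "L * ((d a * ?P xs) * (Psi a (\<alpha> j) * ?Y)) = L * (?P xs * (Psi a (\<alpha> j) * ?Y)) * d a
        + (\<Sum>x\<in>set xs. if a = \<alpha> x then L * Psi a (\<alpha> j) * (?P (remove1 x xs) * ?Y) else 0)"
      unfolding d_prod_p[OF Cons.prems(1)] distrib_right distrib_left sum_distrib_right sum_distrib_left
      by (intro arg_cong2[where f = "(+)"] sum.cong refl)
         (simp_all add: mult.assoc dY Psi_comm(3)[THEN left_comm] PsiP[THEN left_comm])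
    finally show ?thesis by (simp add: vev_add vev_d vev_sum if_distrib vev_0 cong: if_cong)
  qed
  have "vev (L * (?P xs * prod_list (map (\<lambda>j. XH (\<alpha> j)) (j # js)))) = (\<Sum>a\<in>idx n. vev (L * (?P xs * (e a * Psi a (\<alpha> j) * ?Y))))"
    using Cons.prems(4)[of j] by (simp add: XH_expand sum_distrib_left sum_distrib_right vev_sum)
  also have "\<dots> = (\<Sum>x\<in>set xs. \<Sum>a\<in>idx n. if a = \<alpha> x then vev (L * Psi a (\<alpha> j) * (?P (remove1 x xs) * ?Y)) else 0)"
    unfolding summand by (rule sum.swap)
  also have "\<dots> = (\<Sum>x\<in>set xs. vev (L * Psi (\<alpha> x) (\<alpha> j) * (?P (remove1 x xs) * ?Y)))"
    using Cons.prems(3) by (intro sum.cong refl) (simp add: sum_delta_if)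
  also have "\<dots> = (\<Sum>x\<in>set xs. \<Sum>ys\<in>permutations_of_set (set xs - {x}). vev (L * ?F (x # ys) (j # js)))"
  proof (intro sum.cong refl)
    fix x assume x: "x \<in> set xs"
    have "vev (L * Psi (\<alpha> x) (\<alpha> j) * (?P (remove1 x xs) * ?Y))
      = (\<Sum>ys\<in>permutations_of_set (set (remove1 x xs)). vev (L * Psi (\<alpha> x) (\<alpha> j) * ?F ys js))"
    proof (rule Cons.IH)
      show "length js = length (remove1 x xs)" using Cons.prems(2) x by (simp add: length_remove1)
      show "L * Psi (\<alpha> x) (\<alpha> j) * e a = e a * (L * Psi (\<alpha> x) (\<alpha> j))" for a
        by (simp only: mult.assoc Psi_comm(1)[symmetric] left_comm[OF Cons.prems(5)])
      show "d a * (L * Psi (\<alpha> x) (\<alpha> j)) = L * Psi (\<alpha> x) (\<alpha> j) * d a" for a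
        by (simp only: mult.assoc Psi_comm(3) left_comm[OF Cons.prems(6)])
    qed (use Cons.prems set_remove1_subset[of x xs] in auto)
    then show "vev (L * Psi (\<alpha> x) (\<alpha> j) * (?P (remove1 x xs) * ?Y))
      = (\<Sum>ys\<in>permutations_of_set (set xs - {x}). vev (L * ?F (x # ys) (j # js)))"
      using Cons.prems(1) by (simp add: mult.assoc)
  qed
  also have "\<dots> = (\<Sum>ys\<in>permutations_of_set (set xs). vev (L * ?F ys (j # js)))"
    using Cons.prems(2) by (intro sum_permutations_of_set_Cons[symmetric]) auto
  finally show ?case .
qed

lemma vev_column_permanents:
  "(\<Sum>\<alpha>\<in>nondec_seqs (2 * n) k. of_rat (1 / of_nat (seq_fact (2 * n) k \<alpha>)) *
      (\<Sum>ys\<in>permutations_of_set {1..k}. vev (prod_list (map2 (\<lambda>y j. Psi (\<alpha> y) (\<alpha> j)) ys [1..<Suc k]))))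
    = vev (dp zeta (int k)) - (2 * of_nat n + of_nat k - 1) / 2 * vev (dp zeta (int k - 1))"
proof -
  have "vev (prod_list (map (\<lambda>j. p (\<alpha> j) * XH (\<alpha> j)) [1..<Suc k]))
      = (\<Sum>ys\<in>permutations_of_set {1..k}. vev (prod_list (map2 (\<lambda>y j. Psi (\<alpha> y) (\<alpha> j)) ys [1..<Suc k])))"
    if "\<alpha> \<in> nondec_seqs (2 * n) k" for \<alpha>
  proof -
    have s: "set [1..<Suc k] = {1..k}" by auto
    have r: "\<alpha> x \<in> idx n" if "x \<in> set [1..<Suc k]" for x
      using nondec_seqs_range[OF \<open>\<alpha> \<in> _\<close>] that unfolding s idx_def .
    show ?thesis
      using vev_permutations[of "[1..<Suc k]" "[1..<Suc k]" \<alpha> 1] r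
      by (simp add: prod_list_pXH atLeastLessThanSuc_atLeastAtMost del: upt_Suc)
  qed
  then show ?thesis
    unfolding vev_PP[symmetric] PP_ordsum ordsum_def vev_sum vev_sc
    by (intro sum.cong refl) simp
qed

end

section \<open>Invariance under the symplectic Lie algebra\<close>

locale full_oscillator = symplectic_oscillator sc n f e p d T W
  for sc :: "rat \<Rightarrow> 'r::{ring,monoid_mult}" and n f e p d T W +
  fixes dd :: "nat \<Rightarrow> 'r"
  assumes ddp: "dd a * p b = p b * dd a" and ddf: "dd a * f i j = f i j * dd a"
    and ddT: "dd a * T = T * dd a" and ddW: "dd a * W = W * dd a"
    and dde: "dd a * e b = e b * dd a + (if a = b then 1 else 0)"
begin

text \<open>A matrix unit of gl acting by commutators: it takes \<open>e c\<close> to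
  \<open>e b\<close> and \<open>p b\<close> to \<open>- p c\<close>, so the two sequences are dual
  to each other.\<close>

definition B :: "nat \<Rightarrow> nat \<Rightarrow> 'r" where "B c b = e b * dd c - p c * d b"
text \<open>\<open>M c b\<close> is the diagonal action of \<open>F n c b\<close> on the coefficients and on the variables \<open>e\<close>, \<open>p\<close>; its second part
  has vanishing vacuum expectation values on both sides.\<close>

definition M :: "nat \<Rightarrow> nat \<Rightarrow> 'r" where "M c b = f c b - B c b + sg c * (sg b * B (prim n b) (prim n c))"
definition H :: "nat \<Rightarrow> 'r" where "H c = (\<Sum>i\<in>idx n. p i * f c i)"

lemma dd_X:
  assumes c: "c \<in> idx n"
  shows "dd c * X i = X i * dd c + (f c i + (if c = i then W else 0)) * T"
proof -
  have "dd c * (e a * f a i) = e a * f a i * dd c + (if a = c then f a i else 0)" for a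
  proof -
    have "dd c * (e a * f a i) = (dd c * e a) * f a i" by (simp only: mult.assoc)
    then show ?thesis by (simp add: dde distrib_right mult.assoc ddf)
  qed
  then have g: "dd c * g i = g i * dd c + f c i"
    using c by (simp add: g_def sum_distrib_left sum_distrib_right sum.distrib sum_delta_if)
  have eW: "dd c * (e i * W) = e i * W * dd c + (if c = i then W else 0)"
  proof -
    have "dd c * (e i * W) = (dd c * e i) * W" by (simp only: mult.assoc)
    then show ?thesis by (simp add: dde distrib_right mult.assoc ddW)
  qed
  have "dd c * X i = (dd c * g i + dd c * (e i * W)) * T"
    by (simp add: X_def distrib_left distrib_right mult.assoc)
  also have "\<dots> = (g i + e i * W) * (dd c * T) + (f c i + (if c = i then W else 0)) * T"
    by (simp only: g eW distrib_right mult.assoc add_ac)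
  finally show ?thesis by (simp only: X_def ddT mult.assoc)
qed

text \<open>The parts with \<open>W\<close> cancel because \<open>kappa\<close> is invariant under
  gl; there remains the effect on the two indices of the coefficients, through \<open>H\<close> for
  rows and \<open>g\<close> for columns.\<close>

lemma B_zeta:
  assumes c: "c \<in> idx n" and b: "b \<in> idx n"
  shows "B c b * zeta = zeta * B c b + (e b * H c - p c * g b) * T"
proof -
  have "dd c * (p i * X i) = p i * X i * dd c + (p i * f c i * T + (if c = i then p i * (W * T) else 0))" for i
    by (simp add: left_comm[OF ddp] dd_X[OF c] distrib_left distrib_right mult.assoc)
  then have dz: "dd c * zeta = zeta * dd c + (H c * T + p c * (W * T))"
    using c by (simp add: zeta_def H_def sum_distrib_left sum_distrib_right sum.distrib sum_delta_if)
  have zp: "p a * zeta = zeta * p a" and ze: "e a * zeta = zeta * e a" for a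
    by (simp_all add: zeta_def sum_distrib_left sum_distrib_right mult.assoc X_comm generator_comm)
  have "B c b * zeta = e b * (dd c * zeta) - p c * (d b * zeta)"
    by (simp add: B_def left_diff_distrib mult.assoc)
  also have "\<dots> = zeta * B c b + (e b * (H c * T) + e b * (p c * (W * T)) - p c * (g b * T) - p c * (e b * (W * T)))"
    by (simp add: dz d_zeta[OF b] B_def X_def distrib_left distrib_right right_diff_distrib mult.assoc
        left_comm[OF zp] left_comm[OF ze])
  also have "\<dots> = zeta * B c b + (e b * H c - p c * g b) * T"
    by (simp add: left_diff_distrib mult.assoc generator_comm)
  finally show ?thesis .
qed

text \<open>The gl part of the commutator agrees with \<open>B_zeta\<close> for
  \<open>B c b\<close>, and the symplectic part with that for
  \<open>B (prim n b) (prim n c)\<close>; the combination \<open>M\<close> is chosen so that all of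
  this cancels.\<close>

lemma f_zeta:
  assumes c: "c \<in> idx n" and b: "b \<in> idx n"
  shows "f c b * zeta = zeta * f c b + (e b * H c - p c * g b) * T
    - sg c * (sg b * ((e (prim n c) * H (prim n b) - p (prim n b) * g (prim n c)) * T))"
proof -
  have mult_if: "x * (if P then y else 0) = (if P then x * y else 0)" "(if P then y else 0) * x = (if P then y * x else 0)"
    for x y :: 'r and P by simp_all
  have fg: "f c b * g i - g i * f c b = e b * f c i - (if c = i then g b else 0)
    - sg c * (sg b * (e (prim n c) * f (prim n b) i - (if prim n b = i then g (prim n c) else 0)))"
    if i: "i \<in> idx n" for i
  proof -
    have "f c b * g i - g i * f c b = (\<Sum>a\<in>idx n. e a * (f c b * f a i - f a i * f c b))"
      by (simp add: g_def sum_distrib_left sum_distrib_right sum_subtractf right_diff_distrib mult.assoc generator_comm)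
    also have "\<dots> = (\<Sum>a\<in>idx n. e a * ((if b = a then f c i else 0) - (if c = i then f a b else 0)
        - sg c * (sg b * ((if prim n c = a then f (prim n b) i else 0) - (if prim n b = i then f a (prim n c) else 0)))))"
      by (intro sum.cong refl arg_cong2[where f = "(*)"] f_f_sg c b i) simp_all
    also have "\<dots> = (\<Sum>a\<in>idx n. (if b = a then e a * f c i else 0) - (if c = i then e a * f a b else 0)
        - sg c * (sg b * ((if prim n c = a then e a * f (prim n b) i else 0)
            - (if prim n b = i then e a * f a (prim n c) else 0))))"
      by (simp only: right_diff_distrib sg_lcomm mult_if)
    also have "\<dots> = e b * f c i - (if c = i then g b else 0)
      - sg c * (sg b * (e (prim n c) * f (prim n b) i - (if prim n b = i then g (prim n c) else 0)))"
    proof -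
      have s: "(\<Sum>a\<in>idx n. if P then e a * f a j else 0) = (if P then g j else 0)" for P j
        by (simp add: g_def)
      show ?thesis
        unfolding sum_subtractf sum_distrib_left[of "sg c", symmetric] sum_distrib_left[of "sg b", symmetric] s
          sum_delta_if(1)[OF finite_idx b] sum_delta_if(1)[OF finite_idx prim_in[OF c]] ..
    qed
    finally show ?thesis .
  qed
  have fX: "f c b * X i - X i * f c b = (f c b * g i - g i * f c b) * T" for i
    by (simp add: X_def distrib_left distrib_right left_diff_distrib mult.assoc generator_comm)
  have "f c b * zeta - zeta * f c b = (\<Sum>i\<in>idx n. p i * (f c b * X i - X i * f c b))"
    by (simp add: zeta_def sum_distrib_left sum_distrib_right sum_subtractf right_diff_distrib mult.assoc generator_comm)
  also have "\<dots> = (\<Sum>i\<in>idx n. p i * ((e b * f c i - (if c = i then g b else 0)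
    - sg c * (sg b * (e (prim n c) * f (prim n b) i - (if prim n b = i then g (prim n c) else 0)))) * T))"
    by (intro sum.cong refl) (simp only: fX fg)
  also have "\<dots> = (\<Sum>i\<in>idx n. e b * (p i * f c i) * T - (if c = i then p i * g b * T else 0)
    - sg c * (sg b * (e (prim n c) * (p i * f (prim n b) i) * T - (if prim n b = i then p i * g (prim n c) * T else 0))))"
    by (simp only: left_diff_distrib right_diff_distrib mult.assoc generator_comm sg_lcomm mult_if)
  also have "\<dots> = (e b * H c - p c * g b) * T
    - sg c * (sg b * ((e (prim n c) * H (prim n b) - p (prim n b) * g (prim n c)) * T))"
  proof -
    have H: "(\<Sum>i\<in>idx n. e a * (p i * f j i) * T) = e a * H j * T" for a j
      by (simp add: H_def sum_distrib_left sum_distrib_right mult.assoc)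
    show ?thesis
      unfolding sum_subtractf sum_distrib_left[of "sg c", symmetric] sum_distrib_left[of "sg b", symmetric] H
        sum_delta_if(1)[OF finite_idx c] sum_delta_if(1)[OF finite_idx prim_in[OF b]] left_diff_distrib ..
  qed
  finally show ?thesis by (simp add: algebra_simps)
qed

lemma M_zeta:
  assumes c: "c \<in> idx n" and b: "b \<in> idx n"
  shows "M c b * zeta = zeta * M c b"
proof -
  have sz: "zeta * (sg a * y) = sg a * (zeta * y)" for a y by (simp add: sg_def)
  show ?thesis
    by (simp add: M_def left_diff_distrib distrib_right distrib_left right_diff_distrib mult.assoc f_zeta[OF c b]
        B_zeta[OF c b] B_zeta[OF prim_in[OF b] prim_in[OF c]] sz)
qed

end

section \<open>A model on formal power series\<close>

text \<open>All additive maps form one ring type, so scalars, coefficients, variables and shifts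
  become elements of a single ring, as the oscillator locales demand.\<close>

typedef (overloaded) 'a endo = "{h :: 'a::ab_group_add \<Rightarrow> 'a. \<forall>x y. h (x + y) = h x + h y}"
  morphisms app Endo
  by (rule exI[of _ "\<lambda>x. x"]) simp

lemma app_add: "app x (u + v) = app x u + app x v"
  using app[of x] by simp

lemma app_0: "app x 0 = 0"
  using app_add[of x 0 0] by simp

lemma app_Endo: "(\<And>x y. h (x + y) = h x + h y) \<Longrightarrow> app (Endo h) = h"
  by (rule Endo_inverse) simp

lemma endo_eqI: "(\<And>u. app x u = app y u) \<Longrightarrow> x = y"
  by (metis app_inject ext)

instantiation endo :: (ab_group_add) "{ring, monoid_mult}"
begin

definition "0 = Endo (\<lambda>_. 0)"
definition "1 = Endo (\<lambda>v. v)"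
definition "x + y = Endo (\<lambda>v. app x v + app y v)"
definition "- x = Endo (\<lambda>v. - app x v)"
definition "x - y = Endo (\<lambda>v. app x v - app y v)"
definition "x * y = Endo (\<lambda>v. app x (app y v))"

lemma app_ops:
  "app 0 v = 0" "app 1 v = v" "app (x + y) v = app x v + app y v" "app (- x) v = - app x v"
  "app (x - y) v = app x v - app y v" "app (x * y) v = app x (app y v)"
  by (simp_all add: zero_endo_def one_endo_def plus_endo_def uminus_endo_def minus_endo_def times_endo_def
      app_Endo app_add)

instance
  by standard (rule endo_eqI, simp add: app_ops app_add algebra_simps)+

end

type_synonym 'v state = "complex \<times> (nat \<Rightarrow> nat) \<times> (nat \<Rightarrow> nat) \<Rightarrow> 'v"

text \<open>A state is a formal power series in two sequences of variables, with divided-power coefficients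
  indexed by multiplicity functions, whose coefficients depend on a complex parameter. In this model
  \<open>e a\<close> and \<open>p a\<close> are (variable + derivative of the other sequence), so that they commute and
  evaluation at the origin turns \<open>e a\<close> into the derivative conjugate to \<open>p a\<close>.\<close>

locale sp_rep =
  fixes n :: nat and scale :: "complex \<Rightarrow> 'v \<Rightarrow> 'v::ab_group_add" and \<pi> :: "complex mat \<Rightarrow> 'v \<Rightarrow> 'v"
  assumes rep: "lie_rep (sp n) scale \<pi>"
begin

sublocale vs: vector_space scale using rep by (simp add: lie_rep_def)

lemma pi_add: "X \<in> sp n \<Longrightarrow> \<pi> X (u + v) = \<pi> X u + \<pi> X v"
  and pi_scale: "X \<in> sp n \<Longrightarrow> \<pi> X (scale c v) = scale c (\<pi> X v)"
  using rep by (auto simp: lie_rep_def Vector_Spaces.linear_iff)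

text \<open>Zero outside the index range: \<open>\<pi>\<close> is linear on \<open>sp n\<close>
  only, while several oscillator relations are demanded for all natural indices.\<close>

definition fF :: "nat \<Rightarrow> nat \<Rightarrow> 'v \<Rightarrow> 'v" where
  "fF i j v = (if i \<in> idx n \<and> j \<in> idx n then \<pi> (F n i j) v else 0)"

lemma fF_add: "fF i j (u + v) = fF i j u + fF i j v" and fF_scale: "fF i j (scale c v) = scale c (fF i j v)"
  by (simp_all add: fF_def pi_add pi_scale F_in_sp idx_def)

lemma fF_0: "fF i j 0 = 0"
  using fF_add[of i j 0 0] by simp

definition oF :: "nat \<Rightarrow> nat \<Rightarrow> 'v state endo" where "oF i j = Endo (\<lambda>s. \<lambda>(w, P, R). fF i j (s (w, P, R)))"
definition oW :: "'v state endo" where "oW = Endo (\<lambda>s. \<lambda>(w, P, R). scale w (s (w, P, R)))"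
definition oT :: "'v state endo" where "oT = Endo (\<lambda>s. \<lambda>(w, P, R). s (w + 1, P, R))"
definition osc :: "rat \<Rightarrow> 'v state endo" where "osc q = Endo (\<lambda>s. \<lambda>(w, P, R). scale (of_rat q) (s (w, P, R)))"
definition lowP :: "nat \<Rightarrow> 'v state endo" where "lowP a = Endo (\<lambda>s. \<lambda>(w, P, R). s (w, P(a := P a + 1), R))"
definition lowR :: "nat \<Rightarrow> 'v state endo" where "lowR a = Endo (\<lambda>s. \<lambda>(w, P, R). s (w, P, R(a := R a + 1)))"
text \<open>Multiplication by a variable in the basis of divided powers; the factor
  \<open>P a\<close> also annihilates the case in which the subtraction is truncated.\<close>

definition mulP :: "nat \<Rightarrow> 'v state endo" where
  "mulP a = Endo (\<lambda>s. \<lambda>(w, P, R). scale (of_nat (P a)) (s (w, P(a := P a - 1), R)))"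
definition mulR :: "nat \<Rightarrow> 'v state endo" where
  "mulR a = Endo (\<lambda>s. \<lambda>(w, P, R). scale (of_nat (R a)) (s (w, P, R(a := R a - 1))))"

lemma app_model:
  "app (oF i j) s (w, P, R) = fF i j (s (w, P, R))" "app oW s (w, P, R) = scale w (s (w, P, R))"
  "app oT s (w, P, R) = s (w + 1, P, R)" "app (osc q) s (w, P, R) = scale (of_rat q) (s (w, P, R))"
  "app (lowP a) s (w, P, R) = s (w, P(a := P a + 1), R)" "app (lowR a) s (w, P, R) = s (w, P, R(a := R a + 1))"
  "app (mulP a) s (w, P, R) = scale (of_nat (P a)) (s (w, P(a := P a - 1), R))"
  "app (mulR a) s (w, P, R) = scale (of_nat (R a)) (s (w, P, R(a := R a - 1)))"
  unfolding oF_def oW_def oT_def osc_def lowP_def lowR_def mulP_def mulR_def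
  by (subst app_Endo; auto simp: fun_eq_iff fF_add vs.scale_right_distrib)+

lemma state_eqI: "(\<And>s w P R. app x s (w, P, R) = app y s (w, P, R)) \<Longrightarrow> x = (y :: 'v state endo)"
  by (rule endo_eqI) (auto simp: fun_eq_iff)

lemmas model_simps = app_ops app_model

lemma low_mul:
  "lowP a * mulP b = mulP b * lowP a + (if a = b then 1 else 0)"
  "lowR a * mulR b = mulR b * lowR a + (if a = b then 1 else 0)"
  by (rule state_eqI, auto simp: model_simps fun_upd_twist vs.scale_left_distrib algebra_simps)+

lemma low_low:
  "lowP a * lowP b = lowP b * lowP a" "lowR a * lowR b = lowR b * lowR a" "lowP a * lowR b = lowR b * lowP a"
  "mulP a * mulP b = mulP b * mulP a" "mulR a * mulR b = mulR b * mulR a" "mulP a * mulR b = mulR b * mulP a"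
  "lowP a * mulR b = mulR b * lowP a" "lowR a * mulP b = mulP b * lowR a"
  by (rule state_eqI, (cases "a = b")?, auto simp: model_simps fun_upd_twist mult.commute)+

lemma coefficient_comm:
  "oF i j * lowP a = lowP a * oF i j" "oF i j * lowR a = lowR a * oF i j"
  "oF i j * mulP a = mulP a * oF i j" "oF i j * mulR a = mulR a * oF i j"
  "oW * lowP a = lowP a * oW" "oW * lowR a = lowR a * oW" "oW * mulP a = mulP a * oW" "oW * mulR a = mulR a * oW"
  "oT * lowP a = lowP a * oT" "oT * lowR a = lowR a * oT" "oT * mulP a = mulP a * oT" "oT * mulR a = mulR a * oT"
  "oT * oF i j = oF i j * oT" "oW * oF i j = oF i j * oW" "oT * oW = oW * oT + oT"
  by (rule state_eqI, simp add: model_simps fF_scale vs.scale_left_distrib mult.commute)+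

end

section \<open>Commutators of the generators, entry by entry\<close>

definition F_entry :: "nat \<Rightarrow> nat \<Rightarrow> nat \<Rightarrow> nat \<Rightarrow> nat \<Rightarrow> complex" where
  "F_entry n i j r s = of_bool (r = i) * of_bool (s = j) - eps n i * eps n j * (of_bool (r = prim n j) * of_bool (s = prim n i))"

lemma E_index: "r < 2 * n \<Longrightarrow> s < 2 * n \<Longrightarrow> E n i j $$ (r, s) = of_bool (Suc r = i) * of_bool (Suc s = j)"
  by (simp add: E_def of_bool_conj[symmetric] of_bool_def del: of_bool_conj)

lemma F_index:
  assumes "r < 2 * n" "s < 2 * n"
  shows "F n i j $$ (r, s) = F_entry n i j (Suc r) (Suc s)"
proof -
  have "F n i j $$ (r, s) = E n i j $$ (r, s) - eps n i * eps n j * E n (prim n j) (prim n i) $$ (r, s)"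
    using assms by (simp add: F_def carrier_matD[OF E_carrier])
  then show ?thesis unfolding E_index[OF assms] F_entry_def .
qed

lemma sum_Suc_idx: "(\<Sum>t<2 * n. h (Suc t)) = (\<Sum>t\<in>idx n. h t)"
  unfolding idx_def by (rule sum.reindex_bij_witness[of _ "\<lambda>t. t - 1" Suc]) auto

lemma F_mult_index:
  assumes i: "i \<in> idx n" and j: "j \<in> idx n" and r: "r < 2 * n" and s: "s < 2 * n"
  shows "(F n i j * F n k l) $$ (r, s) = of_bool (Suc r = i) * F_entry n k l j (Suc s)
    - eps n i * eps n j * of_bool (Suc r = prim n j) * F_entry n k l (prim n i) (Suc s)"
proof -
  have "(F n i j * F n k l) $$ (r, s) = (\<Sum>t<2 * n. F n i j $$ (r, t) * F n k l $$ (t, s))"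
    using r s F_carrier[of n i j] F_carrier[of n k l]
    by (simp add: scalar_prod_def lessThan_atLeast0 del: F_carrier)
  also have "\<dots> = (\<Sum>t<2 * n. F_entry n i j (Suc r) (Suc t) * F_entry n k l (Suc t) (Suc s))"
    using r s by (intro sum.cong refl) (simp add: F_index)
  also have "\<dots> = (\<Sum>t\<in>idx n. F_entry n i j (Suc r) t * F_entry n k l t (Suc s))"
    by (rule sum_Suc_idx)
  also have "\<dots> = (\<Sum>t\<in>idx n. if j = t then of_bool (Suc r = i) * F_entry n k l t (Suc s) else 0)
     - (\<Sum>t\<in>idx n. if prim n i = t then eps n i * eps n j * of_bool (Suc r = prim n j) * F_entry n k l t (Suc s) else 0)"
    unfolding sum_subtractf[symmetric]
  proof (intro sum.cong refl)
    have b: "of_bool (t = x) * y = (if x = t then y else 0)" for t x :: nat and y :: complex by simp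
    have "(a * of_bool (t = x) - c * (b * of_bool (t = z))) * y = of_bool (t = x) * (a * y) - of_bool (t = z) * (c * b * y)"
      for a b c y :: complex and t x z :: nat by (simp only: algebra_simps)
    note * = this
    show "F_entry n i j (Suc r) t * F_entry n k l t (Suc s) =
      (if j = t then of_bool (Suc r = i) * F_entry n k l t (Suc s) else 0)
      - (if prim n i = t then eps n i * eps n j * of_bool (Suc r = prim n j) * F_entry n k l t (Suc s) else 0)" for t
      unfolding F_entry_def[of n i j] * b[of t j] b[of t "prim n i"] by (rule refl)
  qed
  finally show ?thesis
    unfolding sum_delta_if(1)[OF finite_idx j] sum_delta_if(1)[OF finite_idx prim_in[OF i]] .
qed

lemma eps_prim: "i \<in> idx n \<Longrightarrow> eps n (prim n i) = - eps n i"
  by (auto simp: eps_def prim_le_iff)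

lemma eps_sq: "eps n i * eps n i = 1"
  by (simp add: eps_def)

text \<open>The entries of the commutator with all indicators replaced by complex variables:
  \<open>A\<close>, \<open>B\<close>, \<open>C\<close>, \<open>D\<close> stand for j = k, i = l, i'
  = k, j' = l, and the remaining ones for the row and column indicators. All that is retained of the
  indices is how the signs agree wherever such an indicator is nonzero.\<close>

lemma F_commutator_entry:
  fixes A B C D ei ej ek el :: complex
  assumes "A = 0 \<or> ek = ej" "B = 0 \<or> el = ei" "C = 0 \<or> ek = - ei" "D = 0 \<or> el = - ej"
    and sq: "ei * ei = 1" "ej * ej = 1" "ek * ek = 1" "el * el = 1"
  shows "ri * (A * sl - ek * el * (D * sk')) - ei * ej * rj' * (C * sl - ek * el * (B * sk'))
      - (rk * (B * sj - ei * ej * (D * si')) - ek * el * rl' * (C * sj - ei * ej * (A * si')))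
    = A * (ri * sl - ei * el * (rl' * si')) + (- B) * (rk * sj - ek * ej * (rj' * sk'))
      + (- (ei * ej * C)) * (rj' * sl - (- ej) * el * (rl' * sj)) + ei * ej * D * (rk * si' - ek * (- ei) * (ri * sk'))"
proof -
  have *: "ei * (ei * x) = x" "ej * (ej * x) = x" "ek * (ek * x) = x" "el * (el * x) = x" for x
    using sq by (simp_all add: mult.assoc[symmetric])
  have h1: "ek * el * (ei * ej) * A = ei * el * A" using assms(1) by (auto simp: * sq mult_ac)
  have h2: "ei * ej * (ek * el) * B = ek * ej * B" using assms(2) by (auto simp: * sq mult_ac)
  have h3: "ek * el * C = - (ei * ej * ej * el * C)" using assms(3) by (auto simp: * sq mult_ac)
  have h4: "ek * el * D = - (ei * ej * ek * ei * D)" using assms(4) by (auto simp: * sq mult_ac)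
  note h = h1 h2 h3 h4
  have "ri * (A * sl - ek * el * (D * sk')) - ei * ej * rj' * (C * sl - ek * el * (B * sk'))
      - (rk * (B * sj - ei * ej * (D * si')) - ek * el * rl' * (C * sj - ei * ej * (A * si')))
    = A * ri * sl - (ek * el * D) * ri * sk' - ei * ej * C * rj' * sl + (ei * ej * (ek * el) * B) * rj' * sk'
      - B * rk * sj + ei * ej * D * rk * si' + (ek * el * C) * rl' * sj - (ek * el * (ei * ej) * A) * rl' * si'"
    by (simp add: algebra_simps)
  also have "\<dots> = A * (ri * sl - ei * el * (rl' * si')) + (- B) * (rk * sj - ek * ej * (rj' * sk'))
      + (- (ei * ej * C)) * (rj' * sl - (- ej) * el * (rl' * sj)) + ei * ej * D * (rk * si' - ek * (- ei) * (ri * sk'))"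
    unfolding h by (simp add: algebra_simps)
  finally show ?thesis .
qed

lemma F_lincomb_index:
  assumes "r < 2 * n" "s < 2 * n"
  shows "(a \<cdot>\<^sub>m F n i1 j1 + b \<cdot>\<^sub>m F n i2 j2 + c \<cdot>\<^sub>m F n i3 j3 + d \<cdot>\<^sub>m F n i4 j4) $$ (r, s) =
    a * F_entry n i1 j1 (Suc r) (Suc s) + b * F_entry n i2 j2 (Suc r) (Suc s)
    + c * F_entry n i3 j3 (Suc r) (Suc s) + d * F_entry n i4 j4 (Suc r) (Suc s)"
  using assms by (simp add: F_index carrier_matD[OF F_carrier])

lemma F_commutator:
  assumes ij: "i \<in> idx n" "j \<in> idx n" and kl: "k \<in> idx n" "l \<in> idx n"
  shows "F n i j * F n k l - F n k l * F n i j =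
    of_bool (j = k) \<cdot>\<^sub>m F n i l + (- of_bool (i = l)) \<cdot>\<^sub>m F n k j
    + (- (eps n i * eps n j * of_bool (prim n i = k))) \<cdot>\<^sub>m F n (prim n j) l
    + (eps n i * eps n j * of_bool (prim n j = l)) \<cdot>\<^sub>m F n k (prim n i)" (is "?L = ?R")
proof (rule eq_matI)
  fix r s assume "r < dim_row ?R" "s < dim_col ?R"
  then have rs: "r < 2 * n" "s < 2 * n" by (simp_all add: carrier_matD[OF F_carrier])
  note pp = prim_prim[OF ij(1)] prim_prim[OF ij(2)] prim_prim[OF kl(1)] prim_prim[OF kl(2)]
  have eqs: "(j = prim n l) = (prim n j = l)" "(l = prim n j) = (prim n j = l)" "(prim n k = i) = (prim n i = k)"
    "(prim n i = prim n l) = (i = l)" "(prim n k = prim n j) = (j = k)" "(l = i) = (i = l)"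
    using ij kl by (auto simp: prim_def idx_def)
  have eps: "eps n (prim n i) = - eps n i" "eps n (prim n j) = - eps n j"
    by (simp_all add: eps_prim ij)
  have "?L $$ (r, s) = (F n i j * F n k l) $$ (r, s) - (F n k l * F n i j) $$ (r, s)"
    using rs by (simp add: carrier_matD[OF F_carrier] del: index_mult_mat(1))
  also have "\<dots> = ?R $$ (r, s)"
    unfolding F_mult_index[OF ij rs] F_mult_index[OF kl rs] F_lincomb_index[OF rs] F_entry_def eqs eps pp(1,2)
  proof (rule F_commutator_entry)
    show "(of_bool (j = k) :: complex) = 0 \<or> eps n k = eps n j" by auto
    show "(of_bool (i = l) :: complex) = 0 \<or> eps n l = eps n i" by auto
    show "(of_bool (prim n i = k) :: complex) = 0 \<or> eps n k = - eps n i" using eps(1) by (cases "prim n i = k") simp_all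
    show "(of_bool (prim n j = l) :: complex) = 0 \<or> eps n l = - eps n j" using eps(2) by (cases "prim n j = l") simp_all
  qed (rule eps_sq)+
  finally show "?L $$ (r, s) = ?R $$ (r, s)" .
qed (simp_all add: carrier_matD[OF F_carrier])

context sp_rep begin

lemma pi_lincomb: "X \<in> sp n \<Longrightarrow> Y \<in> sp n \<Longrightarrow> \<pi> (X + Y) v = \<pi> X v + \<pi> Y v"
  "X \<in> sp n \<Longrightarrow> \<pi> (c \<cdot>\<^sub>m X) v = scale c (\<pi> X v)"
  "X \<in> sp n \<Longrightarrow> Y \<in> sp n \<Longrightarrow> \<pi> (X * Y - Y * X) v = \<pi> X (\<pi> Y v) - \<pi> Y (\<pi> X v)"
  using rep by (simp_all add: lie_rep_def)

lemma sp_closed: "X \<in> sp n \<Longrightarrow> Y \<in> sp n \<Longrightarrow> X + Y \<in> sp n" "X \<in> sp n \<Longrightarrow> c \<cdot>\<^sub>m X \<in> sp n"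
  using sp_lie_subalgebra[of n] by (simp_all add: lie_subalgebra_def)

lemma F_in: "i \<in> idx n \<Longrightarrow> j \<in> idx n \<Longrightarrow> F n i j \<in> sp n"
  by (simp add: F_in_sp idx_def)

lemma fF_commutator:
  assumes ij: "i \<in> idx n" "j \<in> idx n" and kl: "k \<in> idx n" "l \<in> idx n"
  shows "fF i j (fF k l v) - fF k l (fF i j v) =
    (if j = k then fF i l v else 0) - (if i = l then fF k j v else 0)
        - scale (eps n i * eps n j) ((if prim n i = k then fF (prim n j) l v else 0) - (if prim n j = l then fF k (prim n i) v else 0))"
proof -
  note m = assms prim_in[OF ij(1)] prim_in[OF ij(2)]
  have "fF i j (fF k l v) - fF k l (fF i j v) = \<pi> (F n i j * F n k l - F n k l * F n i j) v"
    using m by (simp add: fF_def pi_lincomb F_in)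
  also have "\<dots> = scale (of_bool (j = k)) (fF i l v) + scale (- of_bool (i = l)) (fF k j v)
      + scale (- (eps n i * eps n j * of_bool (prim n i = k))) (fF (prim n j) l v)
      + scale (eps n i * eps n j * of_bool (prim n j = l)) (fF k (prim n i) v)"
    unfolding F_commutator[OF assms] using m by (simp add: fF_def pi_lincomb F_in sp_closed)
  finally show ?thesis by (simp add: of_bool_def vs.scale_right_diff_distrib)
qed

lemma eps_mult: "eps n i * eps n j = (if i \<le> n \<longleftrightarrow> j \<le> n then 1 else - 1)"
  by (simp add: eps_def)

definition oe :: "nat \<Rightarrow> 'v state endo" where "oe a = mulR a + lowP a"
definition ov :: "nat \<Rightarrow> 'v state endo" where "ov a = mulP a + lowR a"

lemmas model_comm = low_mul low_low coefficient_comm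

sublocale osc: full_oscillator osc n oF oe ov lowP oT oW lowR
proof unfold_locales
  show "osc (q + r) = osc q + osc r" "osc (q * r) = osc q * osc r" "osc 1 = 1" for q r
    by (rule state_eqI, simp add: model_simps of_rat_add of_rat_mult vs.scale_left_distrib)+
  show "oe a * oe b = oe b * oe a" "ov a * ov b = ov b * ov a" "oe a * ov b = ov b * oe a" for a b
    unfolding oe_def ov_def distrib_left distrib_right
    by (simp_all add: low_low low_mul eq_commute[of b] add_ac)
  show "oF i j * oF k l - oF k l * oF i j =
        (if j = k then oF i l else 0) - (if i = l then oF k j else 0)
        - (if i \<le> n \<longleftrightarrow> j \<le> n then 1 else -1) *
          ((if prim n i = k then oF (prim n j) l else 0) - (if prim n j = l then oF k (prim n i) else 0))"
    if "i \<in> idx n" "j \<in> idx n" "k \<in> idx n" "l \<in> idx n" for i j k l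
  proof (rule state_eqI)
    fix s w P R
    have if_app: "app (if b then x else y) s = (if b then app x s else app y s)" for b and x y :: "'v state endo" by simp
    have if_ev: "(if b then x else y) (w, P, R) = (if b then x (w, P, R) else y (w, P, R))" for b and x y :: "'v state" by simp
    show "app (oF i j * oF k l - oF k l * oF i j) s (w, P, R) =
      app ((if j = k then oF i l else 0) - (if i = l then oF k j else 0)
        - (if i \<le> n \<longleftrightarrow> j \<le> n then 1 else -1) *
          ((if prim n i = k then oF (prim n j) l else 0) - (if prim n j = l then oF k (prim n i) else 0))) s (w, P, R)"
      using fF_commutator[OF that, of "s (w, P, R)"] unfolding eps_mult
      by (cases "i \<le> n \<longleftrightarrow> j \<le> n") (simp_all add: app_ops app_model if_app if_ev cong: if_cong)
  qed
qed (simp_all add: oe_def ov_def distrib_left distrib_right model_comm add_ac)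

end

text \<open>A nonzero difference is extended to a basis and its coordinate is the functional. This
  transfers identities of complex expectation values to vectors of the representation.\<close>

lemma (in vector_space) separating_functional:
  assumes "\<And>l. (\<And>u v. l (u + v) = l u + l v) \<Longrightarrow> (\<And>c v. l (scale c v) = c * l v) \<Longrightarrow> l x = l y"
  shows "x = y"
proof (rule ccontr)
  assume "x \<noteq> y"
  define z where "z = x - y"
  have z: "z \<noteq> 0" using \<open>x \<noteq> y\<close> by (simp add: z_def)
  then have i: "independent {z}" by simp
  define b where "b = extend_basis {z}"
  have b: "independent b" "span b = UNIV" "z \<in> b"
    using independent_extend_basis[OF i] span_extend_basis[OF i] extend_basis_superset[OF i] by (auto simp: b_def)
  define l where "l v = representation b v z" for v
  have add: "l (u + v) = l u + l v" for u v by (simp add: l_def representation_add b)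
  have "l (scale c v) = c * l v" for c v by (simp add: l_def representation_scale b)
  with add have "l x = l y" by (rule assms)
  moreover have "l x = l z + l y" by (simp add: add[symmetric] z_def)
  moreover have "l z = 1" by (simp add: l_def representation_basis b)
  ultimately show False by simp
qed

context sp_rep begin

section \<open>Evaluation at the origin\<close>

text \<open>Constant in the parameter, so that \<open>oT\<close> fixes it, and supported in degree
  zero, so that \<open>lowP\<close> and \<open>lowR\<close> annihilate it.\<close>

definition vac :: "'v \<Rightarrow> 'v state" where
  "vac v = (\<lambda>(w, P, R). if P = (\<lambda>_. 0) \<and> R = (\<lambda>_. 0) then v else 0)"

definition ev :: "complex \<Rightarrow> 'v state endo \<Rightarrow> 'v \<Rightarrow> 'v" where
  "ev w x v = app x (vac v) (w, \<lambda>_. 0, \<lambda>_. 0)"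

lemma vac_lower: "app (lowP a) (vac v) = 0" "app (lowR a) (vac v) = 0"
  by (auto simp: fun_eq_iff app_model vac_def)

lemma vac_T: "app oT (vac v) = vac v" and vac_F: "app (oF i j) (vac v) = vac (fF i j v)"
  by (auto simp: fun_eq_iff app_model vac_def fF_0)

lemma ev_simps:
  "ev w (x + y) v = ev w x v + ev w y v" "ev w (x - y) v = ev w x v - ev w y v"
  "ev w (osc q * x) v = scale (of_rat q) (ev w x v)" "ev w (oF i j * x) v = fF i j (ev w x v)"
  "ev w (oT * x) v = ev (w + 1) x v" "ev w (oW * x) v = scale w (ev w x v)"
  "ev w (mulP a * x) v = 0" "ev w (mulR a * x) v = 0"
  "ev w (x * lowP a) v = 0" "ev w (x * lowR a) v = 0" "ev w (x * oT) v = ev w x v"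
  "ev w (x * oF i j) v = ev w x (fF i j v)" "ev w 0 v = 0" "ev w 1 v = v"
  by (simp_all add: ev_def app_ops app_model vac_lower app_0 vac_T vac_F) (simp add: vac_def)

text \<open>Multiplication by a variable vanishes at the origin, which leaves only the summand
  \<open>lowP a\<close> of \<open>oe a\<close>.\<close>

lemma vacuum:
  assumes "\<And>u v. l (u + v) = l u + l v" "\<And>c v. l (scale c v) = c * l v"
  shows "oscillator_vacuum osc n oF oe ov lowP oT oW (\<lambda>x. l (ev w x v))"
proof -
  have "l 0 = 0" using assms(1)[of 0 0] by simp
  then show ?thesis by unfold_locales (simp_all add: ev_simps assms oe_def distrib_right)
qed

definition ent :: "complex \<Rightarrow> nat \<Rightarrow> nat \<Rightarrow> 'v \<Rightarrow> 'v" where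
  "ent w a i v = fF a i v + (if a = i then scale (w - (if n < i then 1 else 0)) v else 0)"

text \<open>The \<open>T\<close> in an entry raises the parameter for every factor to its right; a
  word evaluated at c + 1 thus has shift c + j in column j.\<close>

lemma ev_Psi: "ev w (osc.Psi a i * x) v = ent w a i (ev (w + 1) x v)"
  by (simp add: osc.Psi_def distrib_right left_diff_distrib mult.assoc ev_simps ent_def vs.scale_left_diff_distrib)

lemma ev_Psi_word:
  assumes "length ys = Suc k - m" "m \<le> Suc k"
  shows "ev (c + of_nat m) (prod_list (map2 (\<lambda>y j. osc.Psi (\<alpha> y) (\<alpha> j)) ys [m..<Suc k])) v
    = foldr (\<lambda>(y, j). ent (c + of_nat j) (\<alpha> y) (\<alpha> j)) (zip ys [m..<Suc k]) v"
  using assms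
proof (induction ys arbitrary: m)
  case (Cons y ys)
  then have m: "[m..<Suc k] = m # [Suc m..<Suc k]" "length ys = Suc k - Suc m" "Suc m \<le> Suc k"
    by (auto simp: upt_conv_Cons simp del: upt_Suc)
  have "c + of_nat m + 1 = c + of_nat (Suc m)" by simp
  then show ?case by (simp only: m(1) zip_Cons_Cons list.map prod.case prod_list.Cons ev_Psi Cons.IH[OF m(2,3)] foldr.simps comp_apply)
qed (simp add: ev_simps)

text \<open>The action of \<open>D n k u\<close> when \<open>c = u - of_nat k / 2\<close>, see
  \<open>act_D_DD\<close>.\<close>

definition DD :: "nat \<Rightarrow> complex \<Rightarrow> 'v \<Rightarrow> 'v" where
  "DD k c v = (\<Sum>\<alpha>\<in>nondec_seqs (2 * n) k. scale (1 / of_nat (seq_fact (2 * n) k \<alpha>))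
     (\<Sum>ys\<in>permutations_of_set {1..k}. foldr (\<lambda>(y, j). ent (c + of_nat j) (\<alpha> y) (\<alpha> j)) (zip ys [1..<Suc k]) v))"

lemma DD_eq:
  "DD k c v = ev (c + 1) (osc.dp osc.zeta (int k) - osc ((2 * of_nat n + of_nat k - 1) / 2) * osc.dp osc.zeta (int k - 1)) v"
proof (rule vs.separating_functional)
  fix l :: "'v \<Rightarrow> complex" assume l: "\<And>u v. l (u + v) = l u + l v" "\<And>c v. l (scale c v) = c * l v"
  interpret V: oscillator_vacuum osc n oF oe ov lowP oT oW "\<lambda>x. l (ev (c + 1) x v)"
    by (rule vacuum[OF l])
  have l0: "l 0 = 0" using l(1)[of 0 0] by simp
  have ls: "l (\<Sum>a\<in>A. h a) = (\<Sum>a\<in>A. l (h a))" for h and A :: "'b set"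
    by (induction A rule: infinite_finite_induct) (simp_all add: l l0)
  have w: "ev (c + 1) (prod_list (map2 (\<lambda>y j. osc.Psi (\<alpha> y) (\<alpha> j)) ys [1..<Suc k])) v
    = foldr (\<lambda>(y, j). ent (c + of_nat j) (\<alpha> y) (\<alpha> j)) (zip ys [1..<Suc k]) v" if "ys \<in> permutations_of_set {1..k}" for ys \<alpha>
  proof -
    have "length ys = k" using that by (simp add: length_finite_permutations_of_set)
    then show ?thesis using ev_Psi_word[of ys k 1 c \<alpha> v] by simp
  qed
  have "l (DD k c v) = (\<Sum>\<alpha>\<in>nondec_seqs (2 * n) k. of_rat (1 / of_nat (seq_fact (2 * n) k \<alpha>)) *
      (\<Sum>ys\<in>permutations_of_set {1..k}. l (ev (c + 1) (prod_list (map2 (\<lambda>y j. osc.Psi (\<alpha> y) (\<alpha> j)) ys [1..<Suc k])) v)))"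
    unfolding DD_def ls l(2)
    by (intro sum.cong refl arg_cong2[where f = "(*)"]) (simp add: of_rat_divide, simp only: w)
  also have "\<dots> = l (ev (c + 1) (osc.dp osc.zeta (int k)) v) - (2 * of_nat n + of_nat k - 1) / 2 * l (ev (c + 1) (osc.dp osc.zeta (int k - 1)) v)"
    by (rule V.vev_column_permanents)
  also have "\<dots> = l (ev (c + 1) (osc.dp osc.zeta (int k) - osc ((2 * of_nat n + of_nat k - 1) / 2) * osc.dp osc.zeta (int k - 1)) v)"
    using V.vev_diff[of "osc.dp osc.zeta (int k)" "osc ((2 * of_nat n + of_nat k - 1) / 2) * osc.dp osc.zeta (int k - 1)"]
    by (simp only: V.vev_sc) (simp add: of_rat_divide of_rat_diff of_rat_add of_rat_mult)
  finally show "l (DD k c v) = l (ev (c + 1) (osc.dp osc.zeta (int k) - osc ((2 * of_nat n + of_nat k - 1) / 2) * osc.dp osc.zeta (int k - 1)) v)" .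
qed

text \<open>The products \<open>lowP b * lowR c\<close> cancel in \<open>B c b\<close>. What is left
  has a \<open>mul\<close> operator on the left, which dies at the origin, and a \<open>low\<close>
  operator on the right, which kills the vacuum.\<close>

lemma ev_B: "ev w (osc.B c b * x) v = 0" "ev w (x * osc.B c b) v = 0"
  by (simp_all add: osc.B_def oe_def ov_def distrib_right distrib_left left_diff_distrib right_diff_distrib
      mult.assoc[symmetric] ev_simps low_low(3))
     (simp_all add: mult.assoc ev_simps)

text \<open>\<open>M i j\<close> commutes with all divided powers of \<open>zeta\<close>, and by
  \<open>ev_B\<close> it reduces to \<open>oF i j\<close> at either end of an expectation.\<close>

lemma DD_commute:
  assumes c: "i \<in> idx n" and b: "j \<in> idx n"
  shows "DD k c (fF i j v) = fF i j (DD k c v)"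
proof -
  define Y where "Y = osc.dp osc.zeta (int k) - osc ((2 * of_nat n + of_nat k - 1) / 2) * osc.dp osc.zeta (int k - 1)"
  have MY: "osc.M i j * Y = Y * osc.M i j"
    using osc.dp_commute[OF osc.M_zeta[OF c b, symmetric]]
    by (simp add: Y_def right_diff_distrib left_diff_distrib osc.sc_lcomm mult.assoc)
  have "ev (c + 1) (osc.M i j * Y) v = fF i j (ev (c + 1) Y v)"
    by (cases "i \<le> n"; cases "j \<le> n")
       (simp_all add: osc.M_def osc.sg_def left_diff_distrib distrib_right ev_simps ev_B)
  moreover have "ev (c + 1) (Y * osc.M i j) v = ev (c + 1) Y (fF i j v)"
    by (cases "i \<le> n"; cases "j \<le> n")
       (simp_all add: osc.M_def osc.sg_def right_diff_distrib distrib_left ev_simps ev_B)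
  ultimately show ?thesis by (simp add: DD_eq Y_def[symmetric] MY)
qed

end

section \<open>The action of the enveloping algebra\<close>

lemma sum_permutes_lists:
  "(\<Sum>\<sigma>\<in>{\<sigma>. \<sigma> permutes {1..k}}. h (map \<sigma> [1..<Suc k])) = (\<Sum>ys\<in>permutations_of_set {1..k}. h ys)"
proof (rule sum.reindex_bij_betw)
  let ?P = "{\<sigma>. \<sigma> permutes {1..k}}" and ?m = "\<lambda>\<sigma>. map \<sigma> [1..<Suc k]"
  have s: "set [1..<Suc k] = {1..k}" by auto
  have inj: "inj_on ?m ?P"
  proof (rule inj_onI)
    fix \<sigma> \<tau> assume st: "\<sigma> \<in> ?P" "\<tau> \<in> ?P" "?m \<sigma> = ?m \<tau>"
    show "\<sigma> = \<tau>"
    proof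
      fix x
      show "\<sigma> x = \<tau> x"
        using st s by (cases "x \<in> {1..k}") (auto simp: permutes_not_in simp del: upt_Suc)
    qed
  qed
  have sub: "?m ` ?P \<subseteq> permutations_of_set {1..k}"
  proof (intro subsetI permutations_of_setI)
    fix ys assume "ys \<in> ?m ` ?P"
    then obtain \<sigma> where \<sigma>: "\<sigma> permutes {1..k}" "ys = ?m \<sigma>" by auto
    show "set ys = {1..k}" unfolding \<sigma>(2) set_map s by (rule permutes_image[OF \<sigma>(1)])
    show "distinct ys"
      unfolding \<sigma>(2) distinct_map using permutes_inj_on[OF \<sigma>(1)] by (simp del: upt_Suc)
  qed
  have "?m ` ?P = permutations_of_set {1..k}"
  proof (rule card_subset_eq[OF _ sub])
    show "card (?m ` ?P) = card (permutations_of_set {1..k})"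
      unfolding card_image[OF inj] by (simp add: card_permutations)
  qed simp
  with inj show "bij_betw ?m ?P (permutations_of_set {1..k})" by (simp add: bij_betw_def)
qed

context sp_rep begin

abbreviation "U \<equiv> env_algebra (sp n)"
abbreviation "act \<equiv> env_rep scale \<pi>"

lemma act_add:
  assumes x: "x \<in> carrier U" and y: "y \<in> carrier U"
  shows "act (x \<oplus>\<^bsub>U\<^esub> y) v = act x v + act y v"
proof -
  interpret I: ideal "env_ideal (sp n)" "free_algebra (sp n)" by (rule env_ideal_ideal[OF sp_lie_subalgebra])
  obtain p q where pq: "p \<in> carrier (free_algebra (sp n))" "q \<in> carrier (free_algebra (sp n))"
    and xy: "x = env_ideal (sp n) +>\<^bsub>free_algebra (sp n)\<^esub> p" "y = env_ideal (sp n) +>\<^bsub>free_algebra (sp n)\<^esub> q"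
    using x y by (auto simp: env_algebra_carrier)
  have "x \<oplus>\<^bsub>U\<^esub> y = env_ideal (sp n) +>\<^bsub>free_algebra (sp n)\<^esub> (p + q)"
    unfolding xy using I.a_rcos_sum[OF pq] by (simp add: env_algebra_def FactRing_def)
  then show ?thesis
    unfolding xy using pq
    by (simp add: env_rep_coset[OF sp_lie_subalgebra rep] free_algebra_closed word_eval_add[OF vs.vector_space_axioms])
qed

lemma U_ring: "ring U"
  by (rule env_algebra_ring[OF sp_lie_subalgebra])

lemma act_zero: "act \<zero>\<^bsub>U\<^esub> v = 0"
proof -
  interpret U: ring U by (rule U_ring)
  show ?thesis using act_add[of "\<zero>\<^bsub>U\<^esub>" "\<zero>\<^bsub>U\<^esub>" v] by simp
qed

lemma act_minus:
  assumes x: "x \<in> carrier U" and y: "y \<in> carrier U"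
  shows "act (x \<ominus>\<^bsub>U\<^esub> y) v = act x v - act y v"
proof -
  interpret U: ring U by (rule U_ring)
  have "x \<ominus>\<^bsub>U\<^esub> y \<oplus>\<^bsub>U\<^esub> y = x" using x y by (simp add: a_minus_def U.a_assoc U.l_neg)
  then show ?thesis using act_add[of "x \<ominus>\<^bsub>U\<^esub> y" y v] x y by simp
qed

lemma act_scalar: "act (env_scalar (sp n) c) v = scale c v"
  unfolding env_scalar_def
  by (subst env_rep_coset[OF sp_lie_subalgebra rep])
     (simp_all add: free_algebra_closed word_eval_single[OF vs.vector_space_axioms])

lemma act_one: "act \<one>\<^bsub>U\<^esub> v = v"
proof -
  have "(1 :: complex mat list \<Rightarrow>\<^sub>0 complex) = Poly_Mapping.single [] 1"
    by (simp add: single_one[symmetric] zero_list_def del: single_one)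
  then have "\<one>\<^bsub>U\<^esub> = env_scalar (sp n) 1" by (simp add: env_algebra_def FactRing_def env_scalar_def)
  then show ?thesis by (simp add: act_scalar)
qed

lemma act_finsum:
  assumes "finite A" "\<And>a. a \<in> A \<Longrightarrow> h a \<in> carrier U"
  shows "act (\<Oplus>\<^bsub>U\<^esub>a\<in>A. h a) v = (\<Sum>a\<in>A. act (h a) v)"
proof -
  interpret U: ring U by (rule U_ring)
  show ?thesis
    using assms by (induction A) (auto simp: act_zero act_add Pi_def U.finsum_insert)
qed

lemma act_product:
  assumes "\<And>x. x \<in> set xs \<Longrightarrow> h x \<in> carrier U"
  shows "foldr (\<otimes>\<^bsub>U\<^esub>) (map h xs) \<one>\<^bsub>U\<^esub> \<in> carrier U \<and>
    act (foldr (\<otimes>\<^bsub>U\<^esub>) (map h xs) \<one>\<^bsub>U\<^esub>) v = foldr (\<lambda>x. act (h x)) xs v"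
proof -
  interpret U: ring U by (rule U_ring)
  show ?thesis
    using assms by (induction xs) (auto simp: act_one env_rep_mult[OF sp_lie_subalgebra rep])
qed

lemma act_entry:
  assumes i: "i \<in> idx n" and j: "j \<in> idx n"
  defines "\<delta> \<equiv> (if i = j then 1 else 0 :: complex)"
  shows "Ftilde n i j \<oplus>\<^bsub>U\<^esub> env_scalar (sp n) (u * \<delta>) \<ominus>\<^bsub>U\<^esub> env_scalar (sp n) (\<delta> * t) \<in> carrier U \<and>
    act (Ftilde n i j \<oplus>\<^bsub>U\<^esub> env_scalar (sp n) (u * \<delta>) \<ominus>\<^bsub>U\<^esub> env_scalar (sp n) (\<delta> * t)) v = ent (u - t) i j v"
proof -
  interpret U: ring U by (rule U_ring)
  have cl: "env_incl (sp n) (F n i j) \<in> carrier U" "env_scalar (sp n) c \<in> carrier U" for c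
    by (simp_all add: env_closed[OF sp_lie_subalgebra] F_in i j)
  have F: "Ftilde n i j \<in> carrier U" "act (Ftilde n i j) v = fF i j v - scale (if i = j \<and> n < i then 1 else 0) v"
    unfolding Ftilde_def using i j
    by (simp_all only: U.minus_closed act_minus cl act_scalar env_rep_incl[OF sp_lie_subalgebra rep F_in[OF i j]] fF_def if_True simp_thms)
  show ?thesis
  proof
    show "Ftilde n i j \<oplus>\<^bsub>U\<^esub> env_scalar (sp n) (u * \<delta>) \<ominus>\<^bsub>U\<^esub> env_scalar (sp n) (\<delta> * t) \<in> carrier U"
      by (intro U.minus_closed U.a_closed F(1) cl)
    have "act (Ftilde n i j \<oplus>\<^bsub>U\<^esub> env_scalar (sp n) (u * \<delta>) \<ominus>\<^bsub>U\<^esub> env_scalar (sp n) (\<delta> * t)) v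
      = fF i j v - scale (if i = j \<and> n < i then 1 else 0) v + scale (u * \<delta>) v - scale (\<delta> * t) v"
      by (simp only: act_minus act_add U.a_closed F cl act_scalar)
    also have "\<dots> = ent (u - t) i j v"
      by (simp add: ent_def \<delta>_def vs.scale_left_diff_distrib)
    finally show "act (Ftilde n i j \<oplus>\<^bsub>U\<^esub> env_scalar (sp n) (u * \<delta>) \<ominus>\<^bsub>U\<^esub> env_scalar (sp n) (\<delta> * t)) v = ent (u - t) i j v" .
  qed
qed

lemma act_D: "act (D n k u) v = (\<Sum>\<alpha>\<in>nondec_seqs (2 * n) k. scale (1 / of_nat (seq_fact (2 * n) k \<alpha>))
     (\<Sum>\<sigma>\<in>{\<sigma>. \<sigma> permutes {1..k}}. foldr (\<lambda>j. ent (u - of_nat k / 2 + of_nat j) (\<alpha> (\<sigma> j)) (\<alpha> j)) [1..<Suc k] v))"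
proof -
  interpret U: ring U by (rule U_ring)
  let ?Z = "\<lambda>\<alpha> a b. Ftilde n (\<alpha> a) (\<alpha> b) \<oplus>\<^bsub>U\<^esub> env_scalar (sp n) (u * unit_sub \<alpha> a b)
     \<ominus>\<^bsub>U\<^esub> env_scalar (sp n) (unit_sub \<alpha> a b * (of_nat k / 2 - of_nat b))"
  have Z: "?Z \<alpha> a b \<in> carrier U \<and> act (?Z \<alpha> a b) v = ent (u - of_nat k / 2 + of_nat b) (\<alpha> a) (\<alpha> b) v"
    if "\<alpha> \<in> nondec_seqs (2 * n) k" "a \<in> {1..k}" "b \<in> {1..k}" for \<alpha> a b v
    using act_entry[of "\<alpha> a" "\<alpha> b" u "of_nat k / 2 - of_nat b" v] nondec_seqs_range[OF that(1,2)] nondec_seqs_range[OF that(1,3)]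
    unfolding unit_sub_def idx_def by (simp add: algebra_simps)
  have per: "col_per U k (?Z \<alpha>) \<in> carrier U \<and> act (col_per U k (?Z \<alpha>)) v =
    (\<Sum>\<sigma>\<in>{\<sigma>. \<sigma> permutes {1..k}}. foldr (\<lambda>j. ent (u - of_nat k / 2 + of_nat j) (\<alpha> (\<sigma> j)) (\<alpha> j)) [1..<Suc k] v)"
    if \<alpha>: "\<alpha> \<in> nondec_seqs (2 * n) k" for \<alpha> v
  proof
    show "col_per U k (?Z \<alpha>) \<in> carrier U" by (rule col_per_closed[OF U_ring]) (use Z \<alpha> in blast)
    have c: "?Z \<alpha> (\<sigma> j) j \<in> carrier U" if "\<sigma> permutes {1..k}" "j \<in> set [1..<Suc k]" for \<sigma> j
    proof -
      have j: "j \<in> {1..k}" using that(2) by auto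
      then show ?thesis using Z[OF \<alpha>, of "\<sigma> j" j] permutes_in_image[OF that(1)] by blast
    qed
    have "act (col_per U k (?Z \<alpha>)) v = (\<Sum>\<sigma>\<in>{\<sigma>. \<sigma> permutes {1..k}}. act (foldr (\<otimes>\<^bsub>U\<^esub>) (map (\<lambda>j. ?Z \<alpha> (\<sigma> j) j) [1..<Suc k]) \<one>\<^bsub>U\<^esub>) v)"
      unfolding col_per_def
    proof (rule act_finsum)
      show "finite {\<sigma>. \<sigma> permutes {1..k}}" by (rule finite_permutations) simp
      fix \<sigma> assume "\<sigma> \<in> {\<sigma>. \<sigma> permutes {1..k}}"
      then show "foldr (\<otimes>\<^bsub>U\<^esub>) (map (\<lambda>j. ?Z \<alpha> (\<sigma> j) j) [1..<Suc k]) \<one>\<^bsub>U\<^esub> \<in> carrier U"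
        using act_product[of "[1..<Suc k]" "\<lambda>j. ?Z \<alpha> (\<sigma> j) j"] c[of \<sigma>] by blast
    qed
    also have "\<dots> = (\<Sum>\<sigma>\<in>{\<sigma>. \<sigma> permutes {1..k}}. foldr (\<lambda>j. ent (u - of_nat k / 2 + of_nat j) (\<alpha> (\<sigma> j)) (\<alpha> j)) [1..<Suc k] v)"
    proof (intro sum.cong refl)
      fix \<sigma> assume "\<sigma> \<in> {\<sigma>. \<sigma> permutes {1..k}}"
      then have \<sigma>: "\<sigma> permutes {1..k}" by simp
      have "act (foldr (\<otimes>\<^bsub>U\<^esub>) (map (\<lambda>j. ?Z \<alpha> (\<sigma> j) j) [1..<Suc k]) \<one>\<^bsub>U\<^esub>) v = foldr (\<lambda>j. act (?Z \<alpha> (\<sigma> j) j)) [1..<Suc k] v"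
        using act_product[of "[1..<Suc k]" "\<lambda>j. ?Z \<alpha> (\<sigma> j) j" v] c[OF \<sigma>] by blast
      also have "\<dots> = foldr (\<lambda>j. ent (u - of_nat k / 2 + of_nat j) (\<alpha> (\<sigma> j)) (\<alpha> j)) [1..<Suc k] v"
      proof (rule foldr_cong[OF refl refl])
        fix j x assume "j \<in> set [1..<Suc k]"
        then have j: "j \<in> {1..k}" by auto
        then show "act (?Z \<alpha> (\<sigma> j) j) x = ent (u - of_nat k / 2 + of_nat j) (\<alpha> (\<sigma> j)) (\<alpha> j) x"
          using Z[OF \<alpha>, of "\<sigma> j" j] permutes_in_image[OF \<sigma>] by blast
      qed
      finally show "act (foldr (\<otimes>\<^bsub>U\<^esub>) (map (\<lambda>j. ?Z \<alpha> (\<sigma> j) j) [1..<Suc k]) \<one>\<^bsub>U\<^esub>) v =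
        foldr (\<lambda>j. ent (u - of_nat k / 2 + of_nat j) (\<alpha> (\<sigma> j)) (\<alpha> j)) [1..<Suc k] v" .
    qed
    finally show "act (col_per U k (?Z \<alpha>)) v =
      (\<Sum>\<sigma>\<in>{\<sigma>. \<sigma> permutes {1..k}}. foldr (\<lambda>j. ent (u - of_nat k / 2 + of_nat j) (\<alpha> (\<sigma> j)) (\<alpha> j)) [1..<Suc k] v)" .
  qed
  note sc = env_closed(2)[OF sp_lie_subalgebra, of n]
  have "act (D n k u) v = (\<Sum>\<alpha>\<in>nondec_seqs (2 * n) k. act (env_scalar (sp n) (1 / of_nat (seq_fact (2 * n) k \<alpha>)) \<otimes>\<^bsub>U\<^esub> col_per U k (?Z \<alpha>)) v)"
    unfolding D_def
  proof (rule act_finsum[OF nondec_seqs_finite])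
    fix \<alpha> assume "\<alpha> \<in> nondec_seqs (2 * n) k"
    then show "env_scalar (sp n) (1 / of_nat (seq_fact (2 * n) k \<alpha>)) \<otimes>\<^bsub>U\<^esub> col_per U k (?Z \<alpha>) \<in> carrier U"
      using per by (intro U.m_closed sc) blast
  qed
  then show ?thesis
    by (simp add: env_rep_mult[OF sp_lie_subalgebra rep] per sc act_scalar cong: sum.cong)
qed

lemma act_D_DD: "act (D n k u) v = DD k (u - of_nat k / 2) v"
proof -
  have "foldr (\<lambda>(y, j). ent (c + of_nat j) (\<alpha> y) (\<alpha> j)) (zip (map \<sigma> xs) xs) v
      = foldr (\<lambda>j. ent (c + of_nat j) (\<alpha> (\<sigma> j)) (\<alpha> j)) xs v" for c \<alpha> \<sigma> xs
    by (induction xs) auto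
  then show ?thesis
    unfolding act_D DD_def sum_permutes_lists[symmetric] by (simp only:)
qed

end

section \<open>The highest weight vector\<close>

text \<open>The stabiliser is counted by adjoining a point a: a permutation is a transposition of a
  and b after a permutation of the old set, and it preserves \<open>f\<close> exactly if
  \<open>f b = f a\<close> and the old one does. The choices of b supply the next factor of the
  factorial.\<close>

lemma card_permutes_preserving:
  assumes "finite S" "finite A" "f ` S \<subseteq> A"
  shows "card {p. p permutes S \<and> (\<forall>j\<in>S. f (p j) = f j)} = (\<Prod>i\<in>A. fact (card {j \<in> S. f j = i}))"
proof -
  have "(\<Sum>p\<in>{p. p permutes S}. if \<forall>j\<in>S. f (p j) = f j then 1 else 0) = (\<Prod>i\<in>A. fact (card {j \<in> S. f j = i}) :: nat)"
    using assms(1,3)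
  proof (induction S)
    case (insert a S)
    let ?g = "\<lambda>S p. if \<forall>j\<in>S. f (p j) = f j then 1 else 0 :: nat"
    have fin: "finite {p. p permutes S}" by (rule finite_permutations[OF insert.hyps(1)])
    have 1: "(\<Sum>q\<in>{p. p permutes S}. ?g (insert a S) (Transposition.transpose a b \<circ> q))
        = (if f b = f a then (\<Sum>q\<in>{p. p permutes S}. ?g S q) else 0)" if b: "b \<in> insert a S" for b
    proof -
      have "?g (insert a S) (Transposition.transpose a b \<circ> q) = (if f b = f a then ?g S q else 0)" if q: "q permutes S" for q
      proof (cases "f b = f a")
        case True
        have "f (Transposition.transpose a b x) = f x" for x using True by (simp add: transpose_def)
        moreover have "q a = a" using q insert.hyps(2) by (rule permutes_not_in)
        ultimately show ?thesis using True by simp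
      next
        case False
        have "q a = a" using q insert.hyps(2) by (rule permutes_not_in)
        then show ?thesis using False by simp
      qed
      then have "(\<Sum>q\<in>{p. p permutes S}. ?g (insert a S) (Transposition.transpose a b \<circ> q))
        = (\<Sum>q\<in>{p. p permutes S}. if f b = f a then ?g S q else 0)" by (intro sum.cong refl) simp
      then show ?thesis by simp
    qed
    let ?c = "\<lambda>S i. card {j \<in> S. f j = i}"
    have "(\<Sum>p\<in>{p. p permutes insert a S}. ?g (insert a S) p)
      = (\<Sum>b\<in>insert a S. if f b = f a then (\<Sum>q\<in>{p. p permutes S}. ?g S q) else 0)"
      unfolding sum_over_permutations_insert[OF insert.hyps(1,2)] by (intro sum.cong refl) (rule 1)
    also have "\<dots> = ?c (insert a S) (f a) * (\<Sum>q\<in>{p. p permutes S}. ?g S q)"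
      using insert.hyps(1) by (simp add: sum.If_cases Int_def Collect_conj_eq[symmetric] conj_commute del: sum.insert)
    also have "(\<Sum>q\<in>{p. p permutes S}. ?g S q) = (\<Prod>i\<in>A. fact (?c S i))"
      using insert by auto
    also have "?c (insert a S) (f a) * (\<Prod>i\<in>A. fact (?c S i)) = (\<Prod>i\<in>A. fact (?c (insert a S) i))"
    proof -
      have a: "f a \<in> A" using insert.prems by auto
      have eq: "{j \<in> insert a S. f j = f a} = insert a {j \<in> S. f j = f a}" by auto
      have c: "?c (insert a S) (f a) = Suc (?c S (f a))"
        unfolding eq using insert.hyps by (subst card_insert_disjoint) auto
      have o: "{j \<in> insert a S. f j = i} = {j \<in> S. f j = i}" if "i \<noteq> f a" for i using that by auto
      have "(\<Prod>i\<in>A. fact (?c (insert a S) i)) = fact (?c (insert a S) (f a)) * (\<Prod>i\<in>A - {f a}. fact (?c (insert a S) i) :: nat)"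
        by (rule prod.remove[OF assms(2) a])
      also have "(\<Prod>i\<in>A - {f a}. fact (?c (insert a S) i) :: nat) = (\<Prod>i\<in>A - {f a}. fact (?c S i))"
        by (intro prod.cong refl arg_cong[where f = "\<lambda>X. fact (card X)"] o) simp
      also have "fact (?c (insert a S) (f a)) = ?c (insert a S) (f a) * (fact (?c S (f a)) :: nat)"
        unfolding c fact_Suc by simp
      finally show ?thesis by (simp only: prod.remove[OF assms(2) a, of "\<lambda>i. fact (?c S i)"] mult.assoc)
    qed
    finally show ?case .
  qed (simp add: permutes_empty)
  moreover have "finite {p. p permutes S}" by (rule finite_permutations[OF assms(1)])
  ultimately show ?thesis by (simp add: sum.If_cases Collect_conj_eq)
qed

text \<open>Otherwise every position whose value is at least \<open>\<alpha> (\<sigma> m)\<close>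
  lies above m, so \<open>\<sigma>\<close> permutes these positions; but \<open>\<sigma> m\<close>
  is one of them while m is not. On the highest weight vector this excludes the entries below the
  diagonal.\<close>

lemma permutes_top_values:
  fixes \<alpha> :: "nat \<Rightarrow> nat"
  assumes \<alpha>: "mono_on {1..k} \<alpha>" and \<sigma>: "\<sigma> permutes {1..k}" and m: "m \<in> {1..k}"
    and fixed: "\<And>j. j \<in> {Suc m..k} \<Longrightarrow> \<alpha> (\<sigma> j) = \<alpha> j"
  shows "\<alpha> (\<sigma> m) \<le> \<alpha> m"
proof (rule ccontr)
  assume "\<not> \<alpha> (\<sigma> m) \<le> \<alpha> m"
  then have gt: "\<alpha> m < \<alpha> (\<sigma> m)" by simp
  define A where "A = {j \<in> {1..k}. \<alpha> (\<sigma> m) \<le> \<alpha> j}"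
  have above: "j \<in> {Suc m..k}" if "j \<in> A" for j
    using that gt mono_onD[OF \<alpha>, of j m] m by (fastforce simp: A_def not_le not_less_eq_eq)
  have "\<sigma> ` A \<subseteq> A"
    using above fixed permutes_in_image[OF \<sigma>] by (auto simp: A_def)
  moreover have "inj_on \<sigma> A" using permutes_inj_on[OF \<sigma>] .
  ultimately have "\<sigma> ` A = A" by (intro endo_inj_surj) (simp_all add: A_def)
  moreover have "\<sigma> m \<in> A" using m permutes_in_image[OF \<sigma>] by (simp add: A_def)
  ultimately obtain j where "j \<in> A" "\<sigma> j = \<sigma> m" by (metis imageE)
  then have "m \<in> A" using permutes_inj[OF \<sigma>] by (metis injD)
  then show False using above by fastforce
qed

context sp_rep begin

lemma ent_linear: "ent w a i (u + v) = ent w a i u + ent w a i v" "ent w a i (scale c v) = scale c (ent w a i v)"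
  by (simp_all add: ent_def fF_add fF_scale vs.scale_right_distrib mult.commute)

lemma DD_linear: "DD k c (u + v) = DD k c u + DD k c v" "DD k c (scale t v) = scale t (DD k c v)"
proof -
  have "foldr (\<lambda>(y, j). ent (c + of_nat j) (\<alpha> y) (\<alpha> j)) xs (u + v) = foldr (\<lambda>(y, j). ent (c + of_nat j) (\<alpha> y) (\<alpha> j)) xs u
      + foldr (\<lambda>(y, j). ent (c + of_nat j) (\<alpha> y) (\<alpha> j)) xs v" for \<alpha> xs
    by (induction xs) (auto simp: ent_linear)
  then show "DD k c (u + v) = DD k c u + DD k c v"
    by (simp add: DD_def sum.distrib vs.scale_right_distrib)
  have "foldr (\<lambda>(y, j). ent (c + of_nat j) (\<alpha> y) (\<alpha> j)) xs (scale t v) = scale t (foldr (\<lambda>(y, j). ent (c + of_nat j) (\<alpha> y) (\<alpha> j)) xs v)" for \<alpha> xs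
    by (induction xs) (auto simp: ent_linear)
  then show "DD k c (scale t v) = scale t (DD k c v)"
    by (simp add: DD_def vs.scale_sum_right[symmetric] mult.commute)
      (simp add: vs.scale_sum_right mult.commute)
qed

lemma F_diag_prim: "i \<in> idx n \<Longrightarrow> F n (prim n i) (prim n i) = (- 1) \<cdot>\<^sub>m F n i i"
  by (rule eq_matI) (auto simp: F_def carrier_matD[OF E_carrier] prim_prim eps_sq)

text \<open>For i > n the weight changes sign because \<open>F n i i\<close> is the negative of the
  generator at \<open>prim n i\<close>, and the further - 1 is the correction in
  \<open>Ftilde\<close>.\<close>

lemma act_D_highest_weight:
  assumes raise: "\<And>i j. 1 \<le> i \<Longrightarrow> i < j \<Longrightarrow> j \<le> 2 * n \<Longrightarrow> \<pi> (F n i j) v = 0"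
    and weight: "\<And>i. i \<in> {1..n} \<Longrightarrow> \<pi> (F n i i) v = scale (of_nat (lam i)) v"
  defines "wt \<equiv> \<lambda>i. if i \<le> n then of_nat (lam i) else - of_nat (lam (prim n i)) - 1"
  shows "act (D n k u) v = scale (\<Sum>\<alpha>\<in>nondec_seqs (2 * n) k. \<Prod>j\<in>{1..k}. u - of_nat k / 2 + of_nat j + wt (\<alpha> j)) v"
proof -
  define c where "c = u - of_nat k / 2"
  have up: "ent w a b v = 0" if "a \<in> idx n" "b \<in> idx n" "a < b" for w a b
    using that raise[of a b] by (simp add: ent_def fF_def idx_def)
  have dg: "ent w a a v = scale (w + wt a) v" if a: "a \<in> idx n" for w a
  proof (cases "a \<le> n")
    case True
    then show ?thesis using a weight[of a] by (simp add: ent_def fF_def wt_def idx_def vs.scale_left_distrib)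
  next
    case False
    have i: "prim n a \<in> idx n" "prim n a \<in> {1..n}" using a False by (auto simp: idx_def prim_def)
    have "\<pi> (F n a a) v = \<pi> ((- 1) \<cdot>\<^sub>m F n (prim n a) (prim n a)) v"
      using F_diag_prim[OF i(1)] by (simp add: prim_prim[OF a])
    also have "\<dots> = scale (- of_nat (lam (prim n a))) v"
      using weight[OF i(2)] by (simp add: pi_lincomb F_in i(1))
    finally show ?thesis using a False
      by (simp add: ent_def fF_def wt_def vs.scale_left_distrib[symmetric] vs.scale_left_diff_distrib[symmetric] algebra_simps)
  qed
  \<comment> \<open>Column k acts first, hence the induction downwards on m. As long as the later
    columns have preserved the values of \<open>\<alpha>\<close>, the vector is a multiple of
    \<open>v\<close>, and the next entry is diagonal or raising.\<close>
  have per: "foldr (\<lambda>j. ent (c + of_nat j) (\<alpha> (\<sigma> j)) (\<alpha> j)) [m..<Suc k] v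
      = (if \<forall>j\<in>{m..k}. \<alpha> (\<sigma> j) = \<alpha> j then scale (\<Prod>j\<in>{m..k}. c + of_nat j + wt (\<alpha> j)) v else 0)"
    if \<alpha>: "\<alpha> \<in> nondec_seqs (2 * n) k" and \<sigma>: "\<sigma> permutes {1..k}" and m: "1 \<le> m" "m \<le> Suc k" for \<alpha> \<sigma> m
    using m(2,1)
  proof (induction m rule: inc_induct)
    case base
    then show ?case by simp
  next
    case (step m)
    have mk: "m \<in> {1..k}" using step by auto
    have r: "\<alpha> m \<in> idx n" "\<alpha> (\<sigma> m) \<in> idx n"
      using nondec_seqs_range[OF \<alpha> mk] nondec_seqs_range[OF \<alpha>, of "\<sigma> m"] permutes_in_image[OF \<sigma>, of m] mk by (auto simp: idx_def)
    have l: "[m..<Suc k] = m # [Suc m..<Suc k]" and s: "{m..k} = insert m {Suc m..k}"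
      using mk by (auto simp: upt_conv_Cons simp del: upt_Suc)
    show ?case
    proof (cases "\<forall>j\<in>{Suc m..k}. \<alpha> (\<sigma> j) = \<alpha> j")
      case True
      have IH: "foldr (\<lambda>j. ent (c + of_nat j) (\<alpha> (\<sigma> j)) (\<alpha> j)) [Suc m..<Suc k] v = scale (\<Prod>j\<in>{Suc m..k}. c + of_nat j + wt (\<alpha> j)) v"
        using step.IH True by simp
      have "\<alpha> (\<sigma> m) \<le> \<alpha> m"
        by (rule permutes_top_values[OF _ \<sigma> mk]) (use \<alpha> True in \<open>auto simp: nondec_seqs_def\<close>)
      then consider "\<alpha> (\<sigma> m) = \<alpha> m" | "\<alpha> (\<sigma> m) < \<alpha> m" by linarith
      then show ?thesis
      proof cases
        case 1
        then have "\<forall>j\<in>{m..k}. \<alpha> (\<sigma> j) = \<alpha> j" using True s by auto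
        moreover have "foldr (\<lambda>j. ent (c + of_nat j) (\<alpha> (\<sigma> j)) (\<alpha> j)) [m..<Suc k] v = scale (\<Prod>j\<in>{m..k}. c + of_nat j + wt (\<alpha> j)) v"
          unfolding l s by (simp add: IH 1 ent_linear dg[OF r(1)] mult.commute del: upt_Suc)
        ultimately show ?thesis by simp
      next
        case 2
        then have "\<not> (\<forall>j\<in>{m..k}. \<alpha> (\<sigma> j) = \<alpha> j)" using s by force
        moreover have "foldr (\<lambda>j. ent (c + of_nat j) (\<alpha> (\<sigma> j)) (\<alpha> j)) [m..<Suc k] v = 0"
          unfolding l by (simp add: IH ent_linear up[OF r(2,1) 2] del: upt_Suc)
        ultimately show ?thesis by (simp only: if_False)
      qed
    next
      case False
      then have "\<not> (\<forall>j\<in>{m..k}. \<alpha> (\<sigma> j) = \<alpha> j)" using s by auto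
      moreover have "foldr (\<lambda>j. ent (c + of_nat j) (\<alpha> (\<sigma> j)) (\<alpha> j)) [Suc m..<Suc k] v = 0"
        using step.IH by (simp only: False if_False)
      then have "foldr (\<lambda>j. ent (c + of_nat j) (\<alpha> (\<sigma> j)) (\<alpha> j)) [m..<Suc k] v = 0"
        unfolding l using ent_linear(2)[of _ _ _ 0 0] by simp
      ultimately show ?thesis by (simp only: if_False)
    qed
  qed
  have "act (D n k u) v = (\<Sum>\<alpha>\<in>nondec_seqs (2 * n) k. scale (\<Prod>j\<in>{1..k}. c + of_nat j + wt (\<alpha> j)) v)"
    unfolding act_D c_def[symmetric]
  proof (intro sum.cong refl)
    fix \<alpha> assume \<alpha>: "\<alpha> \<in> nondec_seqs (2 * n) k"
    define e where "e = (\<Prod>j\<in>{1..k}. c + of_nat j + wt (\<alpha> j))"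
    have "(\<Sum>\<sigma>\<in>{\<sigma>. \<sigma> permutes {1..k}}. foldr (\<lambda>j. ent (c + of_nat j) (\<alpha> (\<sigma> j)) (\<alpha> j)) [1..<Suc k] v)
      = (\<Sum>\<sigma>\<in>{\<sigma>. \<sigma> permutes {1..k}}. if \<forall>j\<in>{1..k}. \<alpha> (\<sigma> j) = \<alpha> j then scale e v else 0)"
      unfolding e_def by (intro sum.cong refl per[OF \<alpha>]) auto
    also have "\<dots> = (\<Sum>\<sigma>\<in>{\<sigma>. \<sigma> permutes {1..k} \<and> (\<forall>j\<in>{1..k}. \<alpha> (\<sigma> j) = \<alpha> j)}. scale e v)"
      by (subst sum.inter_filter[symmetric]) (simp_all add: finite_permutations)
    also have "\<dots> = scale (of_nat (card {\<sigma>. \<sigma> permutes {1..k} \<and> (\<forall>j\<in>{1..k}. \<alpha> (\<sigma> j) = \<alpha> j)}) * e) v"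
      by (simp only: vs.sum_constant_scale vs.scale_scale)
    also have "card {\<sigma>. \<sigma> permutes {1..k} \<and> (\<forall>j\<in>{1..k}. \<alpha> (\<sigma> j) = \<alpha> j)} = seq_fact (2 * n) k \<alpha>"
      unfolding seq_fact_def using nondec_seqs_range[OF \<alpha>] by (intro card_permutes_preserving) auto
    finally show "scale (1 / of_nat (seq_fact (2 * n) k \<alpha>)) (\<Sum>\<sigma>\<in>{\<sigma>. \<sigma> permutes {1..k}}. foldr (\<lambda>j. ent (c + of_nat j) (\<alpha> (\<sigma> j)) (\<alpha> j)) [1..<Suc k] v)
      = scale e v"
      by (simp add: seq_fact_def)
  qed
  then show ?thesis by (simp add: c_def vs.scale_sum_left)
qed


section \<open>From the generators to the whole Lie algebra\<close>

lemma sum_F_in_sp: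
  fixes t :: "nat \<times> nat \<Rightarrow> complex"
  assumes "finite A" "A \<subseteq> idx n \<times> idx n"
  defines "S \<equiv> mat (2 * n) (2 * n) (\<lambda>rs. \<Sum>ij\<in>A. t ij * F n (fst ij) (snd ij) $$ rs)"
  shows "S \<in> sp n \<and> \<pi> S v = (\<Sum>ij\<in>A. scale (t ij) (fF (fst ij) (snd ij) v))"
  unfolding S_def using assms(1,2)
proof (induction A)
  case empty
  have z: "mat (2 * n) (2 * n) (\<lambda>rs. \<Sum>ij\<in>{}. t ij * F n (fst ij) (snd ij) $$ rs) = 0\<^sub>m (2 * n) (2 * n)"
    by (rule eq_matI) auto
  have in_sp: "0\<^sub>m (2 * n) (2 * n) \<in> sp n" using sp_lie_subalgebra[of n] by (simp add: lie_subalgebra_def)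
  have "\<pi> (0\<^sub>m (2 * n) (2 * n)) v = 0"
    using pi_lincomb(1)[OF in_sp in_sp, of v] by simp
  then show ?case unfolding z using in_sp by simp
next
  case (insert ij A)
  have IH: "mat (2 * n) (2 * n) (\<lambda>rs. \<Sum>ij\<in>A. t ij * F n (fst ij) (snd ij) $$ rs) \<in> sp n"
    "\<pi> (mat (2 * n) (2 * n) (\<lambda>rs. \<Sum>ij\<in>A. t ij * F n (fst ij) (snd ij) $$ rs)) v = (\<Sum>ij\<in>A. scale (t ij) (fF (fst ij) (snd ij) v))"
    using insert by auto
  have ij: "fst ij \<in> idx n" "snd ij \<in> idx n" using insert.prems by auto
  have z: "mat (2 * n) (2 * n) (\<lambda>rs. \<Sum>ij\<in>insert ij A. t ij * F n (fst ij) (snd ij) $$ rs)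
    = t ij \<cdot>\<^sub>m F n (fst ij) (snd ij) + mat (2 * n) (2 * n) (\<lambda>rs. \<Sum>ij\<in>A. t ij * F n (fst ij) (snd ij) $$ rs)"
    using insert.hyps by (intro eq_matI) (simp_all add: carrier_matD[OF F_carrier])
  have Fsp: "t ij \<cdot>\<^sub>m F n (fst ij) (snd ij) \<in> sp n" by (rule sp_closed(2)[OF F_in[OF ij]])
  have "\<pi> (F n (fst ij) (snd ij)) v = fF (fst ij) (snd ij) v" using ij by (simp add: fF_def)
  then show ?case
    unfolding z unfolding sum.insert[OF insert.hyps] pi_lincomb(1)[OF Fsp IH(1)] pi_lincomb(2)[OF F_in[OF ij]] IH(2)
    using sp_closed(1)[OF Fsp IH(1)] by (simp only:)
qed

text \<open>Each \<open>F n i j\<close> is a matrix unit minus its image under the involution that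
  defines \<open>sp n\<close>; on an element of \<open>sp n\<close> both parts contribute equally,
  hence the factor 1/2.\<close>

lemma pi_eq_sum_F:
  assumes X: "X \<in> sp n"
  shows "\<pi> X v = (\<Sum>ij\<in>idx n \<times> idx n. scale (X $$ (fst ij - 1, snd ij - 1) / 2) (fF (fst ij) (snd ij) v))"
proof -
  define x where "x i j = X $$ (i - 1, j - 1)" for i j :: nat
  \<comment> \<open>The defining relation of \<open>sp n\<close> at the position with 0-based
    indices \<open>prim n r - 1\<close> and \<open>s - 1\<close>, multiplied by
    \<open>eps n s\<close>.\<close>
  have sym: "x (prim n s) (prim n r) = - (eps n s * eps n r * x r s)" if rs: "r \<in> idx n" "s \<in> idx n" for r s
  proof -
    have "prim n r - 1 < 2 * n" "s - 1 < 2 * n" using rs by (auto simp: prim_def idx_def)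
    then have "eps n (Suc (s - 1)) * X $$ (2 * n - 1 - (s - 1), prim n r - 1)
        + eps n (2 * n - (prim n r - 1)) * X $$ (2 * n - 1 - (prim n r - 1), s - 1) = 0"
      using X unfolding sp_index by blast
    moreover have "Suc (s - 1) = s" "2 * n - 1 - (s - 1) = prim n s - 1" "2 * n - (prim n r - 1) = r"
      "2 * n - 1 - (prim n r - 1) = r - 1"
      using rs by (auto simp: prim_def idx_def)
    ultimately have "eps n s * x (prim n s) (prim n r) + eps n r * x r s = 0" by (simp add: x_def)
    then have "eps n s * (eps n s * x (prim n s) (prim n r)) = - (eps n s * (eps n r * x r s))"
      by (simp add: add_eq_0_iff)
    then show ?thesis by (simp add: mult.assoc[symmetric] eps_sq)
  qed
  have "mat (2 * n) (2 * n) (\<lambda>rs. \<Sum>ij\<in>idx n \<times> idx n. x (fst ij) (snd ij) / 2 * F n (fst ij) (snd ij) $$ rs) = X"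
  proof (rule eq_matI)
    fix r s assume "r < dim_row X" "s < dim_col X"
    then have rs: "r < 2 * n" "s < 2 * n" using X by (auto simp: sp_def)
    have in_idx: "Suc r \<in> idx n" "Suc s \<in> idx n" using rs by (auto simp: idx_def)
    note pr = prim_in[OF in_idx(1)] prim_in[OF in_idx(2)]
    have "(\<Sum>ij\<in>idx n \<times> idx n. x (fst ij) (snd ij) / 2 * F n (fst ij) (snd ij) $$ (r, s))
      = (\<Sum>i\<in>idx n. \<Sum>j\<in>idx n. x i j / 2 * F_entry n i j (Suc r) (Suc s))"
      by (simp add: sum.cartesian_product case_prod_beta F_index rs)
    also have "\<dots> = (\<Sum>i\<in>idx n. \<Sum>j\<in>idx n. (if Suc s = j then (if Suc r = i then x i j / 2 else 0) else 0))
      - (\<Sum>i\<in>idx n. \<Sum>j\<in>idx n. if prim n (Suc r) = j then (if prim n (Suc s) = i then x i j / 2 * (eps n i * eps n j) else 0) else 0)"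
      unfolding sum_subtractf[symmetric]
    proof (intro sum.cong refl)
      fix i j assume "i \<in> idx n" "j \<in> idx n"
      then have "Suc r = prim n j \<longleftrightarrow> prim n (Suc r) = j" "Suc s = prim n i \<longleftrightarrow> prim n (Suc s) = i"
        using in_idx by (auto simp: prim_def idx_def)
      then have o: "of_bool (Suc r = prim n j) = (of_bool (prim n (Suc r) = j) :: complex)"
        "of_bool (Suc s = prim n i) = (of_bool (prim n (Suc s) = i) :: complex)" by simp_all
      have b: "a * (of_bool P * of_bool Q - c * (of_bool P' * of_bool Q'))
        = (if Q then (if P then a else 0) else 0) - (if P' then (if Q' then a * c else 0) else 0)"
        for a c :: complex and P Q P' Q' by (auto simp: right_diff_distrib)
      show "x i j / 2 * F_entry n i j (Suc r) (Suc s) = (if Suc s = j then (if Suc r = i then x i j / 2 else 0) else 0)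
        - (if prim n (Suc r) = j then (if prim n (Suc s) = i then x i j / 2 * (eps n i * eps n j) else 0) else 0)"
        unfolding F_entry_def o by (rule b)
    qed
    also have "\<dots> = x (Suc r) (Suc s) / 2
      - x (prim n (Suc s)) (prim n (Suc r)) / 2 * (eps n (prim n (Suc s)) * eps n (prim n (Suc r)))"
      by (simp only: sum_delta_if(1)[OF finite_idx in_idx(2)] sum_delta_if(1)[OF finite_idx in_idx(1)]
          sum_delta_if(1)[OF finite_idx pr(1)] sum_delta_if(1)[OF finite_idx pr(2)])
    also have "\<dots> = x (Suc r) (Suc s)"
    proof -
      have "eps n a * (eps n a * y) = y" for a y by (simp add: mult.assoc[symmetric] eps_sq)
      note sq = this
      show ?thesis by (simp add: sym in_idx eps_prim mult_ac eps_sq) (simp add: sq)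
    qed
    finally show "mat (2 * n) (2 * n) (\<lambda>rs. \<Sum>ij\<in>idx n \<times> idx n. x (fst ij) (snd ij) / 2 * F n (fst ij) (snd ij) $$ rs) $$ (r, s) = X $$ (r, s)"
      using rs by (simp add: x_def)
  qed (use X in \<open>auto simp: sp_def\<close>)
  then show ?thesis
    using sum_F_in_sp[of "idx n \<times> idx n" "\<lambda>ij. x (fst ij) (snd ij) / 2" v] by (simp only: x_def) simp
qed

lemma DD_eigenspace_invariant:
  "invariant_subspace (sp n) scale \<pi> {w. DD k c w = scale t w}"
proof -
  have z: "DD k c 0 = 0" using DD_linear(2)[of k c 0 0] by simp
  have sub: "vs.subspace {w. DD k c w = scale t w}"
    by (rule vs.subspaceI) (simp_all add: z DD_linear vs.scale_right_distrib mult.commute)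
  moreover have "\<pi> X w \<in> {w. DD k c w = scale t w}" if X: "X \<in> sp n" and w: "w \<in> {w. DD k c w = scale t w}" for X w
    unfolding pi_eq_sum_F[OF X]
  proof (intro vs.subspace_sum[OF sub] vs.subspace_scale[OF sub])
    fix ij assume "ij \<in> idx n \<times> idx n"
    then have ij: "fst ij \<in> idx n" "snd ij \<in> idx n" by auto
    show "fF (fst ij) (snd ij) w \<in> {w. DD k c w = scale t w}"
      using w by (simp add: DD_commute[OF ij] fF_scale)
  qed
  ultimately show ?thesis by (simp add: invariant_subspace_def)
qed

end

text \<open>The two conditions say that exactly the first l entries are at most n, so the inner sums
  group the sequences by the number of such entries.\<close>

lemma sum_nondec_split:
  "(\<Sum>\<alpha>\<in>nondec_seqs N k. h \<alpha>) = (\<Sum>l = 0..k. \<Sum>\<alpha> \<in> {\<alpha> \<in> nondec_seqs N k.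
     (\<forall>j\<in>{1..l}. \<alpha> j \<le> n) \<and> (\<forall>j\<in>{l + 1..k}. n + 1 \<le> \<alpha> j)}. h \<alpha>)"
proof -
  define low where "low \<alpha> = card {j \<in> {1..k}. \<alpha> j \<le> n}" for \<alpha> :: "nat \<Rightarrow> nat"
  have low_le: "low \<alpha> \<le> k" for \<alpha>
  proof -
    have "low \<alpha> \<le> card {1..k}" unfolding low_def by (rule card_mono) auto
    then show ?thesis by simp
  qed
  have "(\<forall>j\<in>{1..l}. \<alpha> j \<le> n) \<and> (\<forall>j\<in>{l + 1..k}. n + 1 \<le> \<alpha> j) \<longleftrightarrow> low \<alpha> = l"
    if \<alpha>: "\<alpha> \<in> nondec_seqs N k" and l: "l \<le> k" for \<alpha> l
  proof
    assume r: "(\<forall>j\<in>{1..l}. \<alpha> j \<le> n) \<and> (\<forall>j\<in>{l + 1..k}. n + 1 \<le> \<alpha> j)"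
    have "{j \<in> {1..k}. \<alpha> j \<le> n} = {1..l}"
    proof (rule Set.set_eqI)
      fix j
      show "j \<in> {j \<in> {1..k}. \<alpha> j \<le> n} \<longleftrightarrow> j \<in> {1..l}"
      proof (cases "j \<le> l")
        case True
        then show ?thesis using r l by auto
      next
        case False
        then show ?thesis using bspec[OF conjunct2[OF r], of j] by auto
      qed
    qed
    then show "low \<alpha> = l" by (simp add: low_def)
  next
    assume "low \<alpha> = l"
    then have "{j \<in> {1..k}. \<alpha> j \<le> n} = {1..l}"
      using nondec_low_card[OF \<alpha>, of n, folded low_def] by (simp only:)
    then have j: "j \<in> {1..k} \<and> \<alpha> j \<le> n \<longleftrightarrow> j \<in> {1..l}" for j by blast
    show "(\<forall>j\<in>{1..l}. \<alpha> j \<le> n) \<and> (\<forall>j\<in>{l + 1..k}. n + 1 \<le> \<alpha> j)"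
    proof (intro conjI ballI)
      fix i assume "i \<in> {l + 1..k}"
      then show "n + 1 \<le> \<alpha> i" using j[of i] by auto
    qed (use j in blast)
  qed
  then have "(\<Sum>l = 0..k. \<Sum>\<alpha> \<in> {\<alpha> \<in> nondec_seqs N k.
     (\<forall>j\<in>{1..l}. \<alpha> j \<le> n) \<and> (\<forall>j\<in>{l + 1..k}. n + 1 \<le> \<alpha> j)}. h \<alpha>)
    = (\<Sum>l = 0..k. \<Sum>\<alpha> \<in> {\<alpha> \<in> nondec_seqs N k. low \<alpha> = l}. h \<alpha>)"
    by (intro sum.cong refl Collect_cong) auto
  also have "\<dots> = (\<Sum>\<alpha>\<in>nondec_seqs N k. h \<alpha>)"
    by (rule sum.group) (use low_le nondec_seqs_finite in auto)
  finally show ?thesis ..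
qed

theorem theorem4p4:
  fixes n k :: nat and u :: complex and lam :: "nat \<Rightarrow> nat"
    and scale :: "complex \<Rightarrow> 'v \<Rightarrow> 'v::ab_group_add"
    and \<pi> :: "complex mat \<Rightarrow> 'v \<Rightarrow> 'v"
  assumes "n \<ge> 1" and "k \<ge> 1"
    and "antimono_on {1..n} lam"
    and "highest_weight_rep n lam scale \<pi>"
  shows "\<forall>v. env_rep scale \<pi> (D n k u) v =
    scale (\<Sum>l = 0..k. \<Sum>\<alpha> \<in> {\<alpha> \<in> nondec_seqs (2 * n) k.
                (\<forall>j\<in>{1..l}. \<alpha> j \<le> n) \<and> (\<forall>j\<in>{l + 1..k}. n + 1 \<le> \<alpha> j)}.
             (\<Prod>j = 1..l. u + of_nat (lam (\<alpha> j)) - of_nat k / 2 + of_nat j)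
           * (\<Prod>j = l + 1..k. u - of_nat (lam (prim n (\<alpha> j))) - of_nat k / 2 + of_nat j - 1)) v"
proof -
  interpret sp_rep n scale \<pi>
    using assms(4) by unfold_locales (simp add: highest_weight_rep_def irreducible_rep_def)
  obtain v where gen: "\<And>W. invariant_subspace (sp n) scale \<pi> W \<Longrightarrow> v \<in> W \<Longrightarrow> W = UNIV"
    and raise: "\<And>i j. 1 \<le> i \<Longrightarrow> i < j \<Longrightarrow> j \<le> 2 * n \<Longrightarrow> \<pi> (F n i j) v = 0"
    and weight: "\<And>i. i \<in> {1..n} \<Longrightarrow> \<pi> (F n i i) v = scale (of_nat (lam i)) v"
    using assms(4) unfolding highest_weight_rep_def by blast
  define wt where "wt i = (if i \<le> n then of_nat (lam i) else - of_nat (lam (prim n i)) - 1 :: complex)" for i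
  define t where "t = (\<Sum>\<alpha>\<in>nondec_seqs (2 * n) k. \<Prod>j\<in>{1..k}. u - of_nat k / 2 + of_nat j + wt (\<alpha> j))"
  have "act (D n k u) v = scale t v"
    unfolding t_def wt_def by (rule act_D_highest_weight[OF raise weight])
  \<comment> \<open>The eigenspace is an invariant subspace that contains the generating
    vector.\<close>
  then have "{w. DD k (u - of_nat k / 2) w = scale t w} = UNIV"
    by (intro gen DD_eigenspace_invariant) (simp add: act_D_DD)
  then have "act (D n k u) w = scale t w" for w
    unfolding act_D_DD by blast
  moreover have "t = (\<Sum>l = 0..k. \<Sum>\<alpha> \<in> {\<alpha> \<in> nondec_seqs (2 * n) k.
                (\<forall>j\<in>{1..l}. \<alpha> j \<le> n) \<and> (\<forall>j\<in>{l + 1..k}. n + 1 \<le> \<alpha> j)}.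
             (\<Prod>j = 1..l. u + of_nat (lam (\<alpha> j)) - of_nat k / 2 + of_nat j)
           * (\<Prod>j = l + 1..k. u - of_nat (lam (prim n (\<alpha> j))) - of_nat k / 2 + of_nat j - 1))"
    unfolding t_def sum_nondec_split[of _ _ _ n]
  proof (intro sum.cong refl)
    fix l \<alpha> assume l: "l \<in> {0..k}" and "\<alpha> \<in> {\<alpha> \<in> nondec_seqs (2 * n) k.
                (\<forall>j\<in>{1..l}. \<alpha> j \<le> n) \<and> (\<forall>j\<in>{l + 1..k}. n + 1 \<le> \<alpha> j)}"
    then have "\<forall>j\<in>{1..l}. \<alpha> j \<le> n" "\<forall>j\<in>{l + 1..k}. n + 1 \<le> \<alpha> j" by simp_all
    then have low: "\<And>j. j \<in> {1..l} \<Longrightarrow> \<alpha> j \<le> n" and high: "\<And>j. j \<in> {l + 1..k} \<Longrightarrow> \<not> \<alpha> j \<le> n"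
      by fastforce+
    have "{1..k} = {1..l} \<union> {l + 1..k}" using l by auto
    then have "(\<Prod>j\<in>{1..k}. u - of_nat k / 2 + of_nat j + wt (\<alpha> j))
      = (\<Prod>j\<in>{1..l}. u - of_nat k / 2 + of_nat j + wt (\<alpha> j)) * (\<Prod>j\<in>{l + 1..k}. u - of_nat k / 2 + of_nat j + wt (\<alpha> j))"
      by (simp only:) (rule prod.union_disjoint, auto)
    also have "(\<Prod>j\<in>{1..l}. u - of_nat k / 2 + of_nat j + wt (\<alpha> j)) = (\<Prod>j = 1..l. u + of_nat (lam (\<alpha> j)) - of_nat k / 2 + of_nat j)"
      by (intro prod.cong refl) (simp add: low wt_def del: atLeastAtMost_iff)
    also have "(\<Prod>j\<in>{l + 1..k}. u - of_nat k / 2 + of_nat j + wt (\<alpha> j)) = (\<Prod>j = l + 1..k. u - of_nat (lam (prim n (\<alpha> j))) - of_nat k / 2 + of_nat j - 1)"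
    proof (intro prod.cong refl)
      fix j assume "j \<in> {l + 1..k}"
      then show "u - of_nat k / 2 + of_nat j + wt (\<alpha> j) = u - of_nat (lam (prim n (\<alpha> j))) - of_nat k / 2 + of_nat j - 1"
        using high[of j] by (simp only: wt_def if_False) simp
    qed
    finally show "(\<Prod>j\<in>{1..k}. u - of_nat k / 2 + of_nat j + wt (\<alpha> j))
      = (\<Prod>j = 1..l. u + of_nat (lam (\<alpha> j)) - of_nat k / 2 + of_nat j)
           * (\<Prod>j = l + 1..k. u - of_nat (lam (prim n (\<alpha> j))) - of_nat k / 2 + of_nat j - 1)" .
  qed
  ultimately show ?thesis by simp
qed

end
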